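(* Let $G(V,E)$ be a finite connected graph (loops and multiple edges allowed, $|E|\ge 1$) with all edges of length $1$, each edge $e_j$ parametrized by $x\in(0,1)$ (which gives an orientation on $G$), and let $q_j\in L^1(0,1)$ be a real-valued potential on $e_j$ for each $j$. Consider the eigenvalue problem $-y''+q_j(x)y=\lambda y$ on $e_j$ (for all $j$) with standard matching conditions at the vertices. There are exactly $|E|-|V|+2$ eigenvalues (counting multiplicities) such that $\lambda=(2k\pi)^2+O(1)$ as $k\to\infty$ ($k\in\mathbb{Z}^+$); that is, there is a constant $C_0$ such that for every $C\ge C_0$ and all sufficiently large $k$ (depending on $C$), exactly $|E|-|V|+2$ eigenvalues, counted with multiplicity, satisfy $|\lambda-(2k\pi)^2|\le C$. Among these eigenvalues at least one has the asymptotics $$\lambda=(2k\pi)^2+\frac{1}{|E|}\sum_{j}\int_0^{1}q_j\,dx+o(1)\qquad(k\to\infty).$$ Moreover, if $G$ is bipartite, the same is true for $k$ instead of $2k$: there are exactly $|E|-|V|+2$ eigenvalues (counting multiplicities) such that $\lambda=(k\pi)^2+O(1)$ as $k\to\infty$ (in the same sense), and among them at least one has the asymptotics $\lambda=(k\pi)^2+\frac{1}{|E|}\sum_{j}\int_0^{1}q_j\,dx+o(1)$.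
   Context: Standard matching (Neumann/Kirchhoff) conditions: a function $y=(y_j)_{j}$ on $G$, with $y_j$ defined on $e_j\cong(0,1)$, satisfies (i) continuity: at each vertex $v$ all the boundary values of $y$ at $v$ coincide, i.e. $y_j(\kappa_j)=y_k(\kappa_k)$ whenever $e_j,e_k$ are attached to $v$, where $\kappa=0$ for an edge leaving $v$, $\kappa=1$ for an edge entering $v$ (both $0$ and $1$ occur for a loop); and (ii) for every vertex $v$, $\sum_{e_j\text{ leaves }v}y_j'(0)=\sum_{e_j\text{ enters }v}y_j'(1)$, with loops counted on both sides. Solutions of the differential equation are understood with $y_j,y_j'$ absolutely continuous. An eigenvalue is a $\lambda$ for which there is a nonzero $y$ satisfying the equation on every edge together with (i) and (ii); its multiplicity is the dimension of the space of such $y$. *)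

theory Defs
  imports "HOL-Analysis.Analysis" "HOL-Library.Function_Algebras" "Graph_Theory.Digraph_Component"
begin

text \<open>
  A graph whose edges are parametrized by \<open>(0,1)\<close> is a directed multigraph: the arc \<open>e\<close> is the
  edge, \<open>tail G e\<close> sits at \<open>x = 0\<close> and \<open>head G e\<close> at \<open>x = 1\<close>. Connectedness is that of the
  underlying undirected graph, which is what \<open>Digraph_Component.connected\<close> expresses (the bare
  name would be ambiguous with the topological notion).
\<close>

definition bipartite :: "('v, 'e) pre_digraph \<Rightarrow> bool" where
  "bipartite G \<longleftrightarrow> (\<exists>U W. verts G = U \<union> W \<and> U \<inter> W = {} \<and>
     (\<forall>e\<in>arcs G. (tail G e \<in> U \<and> head G e \<in> W) \<or> (tail G e \<in> W \<and> head G e \<in> U)))"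

text \<open>
  Absolute continuity of functions (the library only has the notion for measures). A division
  \<open>D division_of T\<close> is a finite family of compact intervals with disjoint interiors and union \<open>T\<close>.
\<close>

definition abs_continuous_on :: "real set \<Rightarrow> (real \<Rightarrow> 'a::real_normed_vector) \<Rightarrow> bool" where
  "abs_continuous_on S f \<longleftrightarrow>
     (\<forall>\<epsilon>>0. \<exists>\<delta>>0. \<forall>D T. D division_of T \<and> T \<subseteq> S \<and> (\<Sum>K\<in>D. measure lborel K) < \<delta> \<longrightarrow>
        (\<Sum>K\<in>D. norm (f (Sup K) - f (Inf K))) < \<epsilon>)"

text \<open>The derivative on the closed unit interval, one-sided at the two end points.\<close>

definition unit_deriv :: "(real \<Rightarrow> complex) \<Rightarrow> real \<Rightarrow> complex" where
  "unit_deriv f x = vector_derivative f (at x within {0..1})"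

definition solves_schroedinger :: "(real \<Rightarrow> real) \<Rightarrow> complex \<Rightarrow> (real \<Rightarrow> complex) \<Rightarrow> bool" where
  "solves_schroedinger p \<mu> f \<longleftrightarrow>
     abs_continuous_on {0..1} f \<and>
     (\<forall>x\<in>{0..1}. f differentiable (at x within {0..1})) \<and>
     abs_continuous_on {0..1} (unit_deriv f) \<and>
     (AE x in lebesgue. x \<in> {0<..<1} \<longrightarrow>
        (\<exists>f''. (unit_deriv f has_vector_derivative f'') (at x) \<and>
               - f'' + complex_of_real (p x) * f x = \<mu> * f x))"

text \<open>A loop contributes both of its end values to the set below.\<close>

definition boundary_values :: "('v, 'e) pre_digraph \<Rightarrow> ('e \<Rightarrow> real \<Rightarrow> complex) \<Rightarrow> 'v \<Rightarrow> complex set" where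
  "boundary_values G y v = (\<lambda>e. y e 0) ` out_arcs G v \<union> (\<lambda>e. y e 1) ` in_arcs G v"

definition standard_matching :: "('v, 'e) pre_digraph \<Rightarrow> ('e \<Rightarrow> real \<Rightarrow> complex) \<Rightarrow> bool" where
  "standard_matching G y \<longleftrightarrow>
     (\<forall>v\<in>verts G. \<forall>a\<in>boundary_values G y v. \<forall>b\<in>boundary_values G y v. a = b) \<and>
     (\<forall>v\<in>verts G. (\<Sum>e\<in>out_arcs G v. unit_deriv (y e) 0) = (\<Sum>e\<in>in_arcs G v. unit_deriv (y e) 1))"

text \<open>
  Functions on the graph are total functions that vanish off the edges and off \<open>[0,1]\<close>; without
  this normalization the irrelevant values would inflate the dimension.
\<close>

definition eigenspace ::
  "('v, 'e) pre_digraph \<Rightarrow> ('e \<Rightarrow> real \<Rightarrow> real) \<Rightarrow> complex \<Rightarrow> ('e \<Rightarrow> real \<Rightarrow> complex) set" where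
  "eigenspace G q \<mu> = {y.
     (\<forall>e x. e \<notin> arcs G \<or> x \<notin> {0..1} \<longrightarrow> y e x = 0) \<and>
     (\<forall>e\<in>arcs G. solves_schroedinger (q e) \<mu> (y e)) \<and>
     standard_matching G y}"

definition fun_scale :: "complex \<Rightarrow> ('e \<Rightarrow> real \<Rightarrow> complex) \<Rightarrow> 'e \<Rightarrow> real \<Rightarrow> complex" where
  "fun_scale c y = (\<lambda>e x. c * y e x)"

interpretation cfun: vector_space "fun_scale :: complex \<Rightarrow> ('e \<Rightarrow> real \<Rightarrow> complex) \<Rightarrow> _"
  by unfold_locales (auto simp: fun_scale_def fun_eq_iff algebra_simps)

definition is_eigenvalue :: "('v, 'e) pre_digraph \<Rightarrow> ('e \<Rightarrow> real \<Rightarrow> real) \<Rightarrow> complex \<Rightarrow> bool" where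
  "is_eigenvalue G q \<mu> \<longleftrightarrow> (\<exists>y\<in>eigenspace G q \<mu>. y \<noteq> 0)"

definition eigenvalue_mult :: "('v, 'e) pre_digraph \<Rightarrow> ('e \<Rightarrow> real \<Rightarrow> real) \<Rightarrow> complex \<Rightarrow> nat" where
  "eigenvalue_mult G q \<mu> = cfun.dim (eigenspace G q \<mu>)"

text \<open>
  \<open>S\<close> contains exactly \<open>n\<close> eigenvalues counted with multiplicity. The two finiteness conditions are
  needed because \<open>dim\<close> and \<open>sum\<close> take the value 0 on infinite objects.
\<close>

definition eigenvalue_count_in ::
  "('v, 'e) pre_digraph \<Rightarrow> ('e \<Rightarrow> real \<Rightarrow> real) \<Rightarrow> complex set \<Rightarrow> int \<Rightarrow> bool" where
  "eigenvalue_count_in G q S n \<longleftrightarrow>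
     finite {\<mu>\<in>S. is_eigenvalue G q \<mu>} \<and>
     (\<forall>\<mu>\<in>S. \<exists>B. finite B \<and> eigenspace G q \<mu> \<subseteq> cfun.span B) \<and>
     int (\<Sum>\<mu> | \<mu> \<in> S \<and> is_eigenvalue G q \<mu>. eigenvalue_mult G q \<mu>) = n"

definition mean_potential :: "('v, 'e) pre_digraph \<Rightarrow> ('e \<Rightarrow> real \<Rightarrow> real) \<Rightarrow> real" where
  "mean_potential G q =
     1 / real (card (arcs G)) * (\<Sum>e\<in>arcs G. LINT x:{0<..<1}|lebesgue. q e x)"

end

theory Submission
  imports Defs
begin

text \<open>Put \<open>\<lambda> = \<omega>\<^sup>2 + d\<close> with \<open>sin \<omega> = 0\<close>. On an edge, a solution is determined by the midpoints of the
  amplitudes in its representation as a slowly modulated combination of \<open>cos (\<omega> x)\<close> and \<open>sin (\<omega> x)\<close>.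
  In terms of one value per vertex and one flow per edge, the matching conditions then say that a vector
  lies in the radical of a Hermitian form \<open>H = \<omega> B + s(d)\<close>, where \<open>B\<close> pairs potential
  differences with flows. By Green's formula \<open>s(d)\<close> decreases with \<open>d\<close>, strictly on the radicals, so the
  eigenvalues with \<open>a < d \<le> b\<close> are counted by the drop of the positive index of \<open>H\<close> from \<open>a\<close> to \<open>b\<close>.
  As \<open>\<omega> \<rightarrow> \<infinity>\<close>, the Riemann--Lebesgue lemma gives \<open>s(d) \<rightarrow> M(d)\<close>, which on edge \<open>e\<close> is half of
  \<open>\<integral>q\<^sub>e - d\<close> times the squared amplitudes. The form \<open>B\<close> has \<open>|V| - 1\<close> positive and as many negative
  squares, and its radical, constants plus circulations, has dimension \<open>|E| - |V| + 2\<close>. For large \<open>C\<close> the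
  form \<open>M\<close> is positive there at \<open>d = -C\<close> and negative at \<open>d = C\<close>, which gives the count. The constants lie in the
  radical of \<open>M\<close> restricted to the radical of \<open>B\<close> when \<open>d\<close> is the mean potential, which forces an eigenvalue nearby.\<close>

section \<open>Hermitian forms depending on a parameter\<close>

text \<open>Without potential, \<open>d = 0\<close> is one eigenvalue of multiplicity |E| - |V| + 2,
  and the potential splits it by amounts of order one. Inertia counts the pieces with multiplicity
  without locating them, and it asks of the form only limits of entries, continuity and monotonicity
  in \<open>d\<close>. Midpoints rather than initial values serve as coordinates because, when the
  cosine of the frequency is 1 or -1, the change of the Wronskian along an edge is antisymmetric in
  half-sums and jumps of the end data; this is what makes the form Hermitian. Two obstacles shape
  the argument. The form has no limit, since its \<open>B\<close> part grows with the frequency; its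
  signature is therefore pinned down by exhibiting positive and negative subspaces of complementary
  size. And the part depending on \<open>d\<close> sees vertex values only through averages over
  edges: on a bipartite graph, values alternating in sign along every edge are invisible to it, so
  on the whole space the decrease is only weak. Finally, eigenvalues are counted in complex discs,
  so nonreal ones have to be excluded separately.\<close>

locale complex_space = vector_space scale
  for scale :: "complex \<Rightarrow> 'b::ab_group_add \<Rightarrow> 'b"
begin

definition hermitian :: "('b \<Rightarrow> 'b \<Rightarrow> complex) \<Rightarrow> bool" where
  "hermitian h \<longleftrightarrow> (\<forall>x y z. h (x + y) z = h x z + h y z) \<and>
     (\<forall>c x y. h (scale c x) y = c * h x y) \<and> (\<forall>x y. h y x = cnj (h x y))"

definition radical :: "('b \<Rightarrow> 'b \<Rightarrow> complex) \<Rightarrow> 'b set \<Rightarrow> 'b set" where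
  "radical h U = {x \<in> U. \<forall>y\<in>U. h x y = 0}"

definition positive_on :: "('b \<Rightarrow> 'b \<Rightarrow> complex) \<Rightarrow> 'b set \<Rightarrow> bool" where
  "positive_on h V \<longleftrightarrow> (\<forall>x\<in>V. x \<noteq> 0 \<longrightarrow> 0 < Re (h x x))"

definition orthogonal_set :: "('b \<Rightarrow> 'b \<Rightarrow> complex) \<Rightarrow> 'b set \<Rightarrow> bool" where
  "orthogonal_set h S \<longleftrightarrow> (\<forall>x\<in>S. \<forall>y\<in>S. x \<noteq> y \<longrightarrow> h x y = 0)"

lemma hermitianD:
  assumes "hermitian h"
  shows hermitian_add_left: "h (x + y) z = h x z + h y z"
    and hermitian_scale_left: "h (scale c x) y = c * h x y"
    and hermitian_sym: "h y x = cnj (h x y)"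
  using assms unfolding hermitian_def by blast+

lemma hermitian_add_right: "hermitian h \<Longrightarrow> h x (y + z) = h x y + h x z"
  by (metis hermitian_add_left hermitian_sym complex_cnj_add)

lemma hermitian_scale_right: "hermitian h \<Longrightarrow> h x (scale c y) = cnj c * h x y"
  by (metis hermitian_scale_left hermitian_sym complex_cnj_mult)

lemma hermitian_zero_left: "hermitian h \<Longrightarrow> h 0 y = 0"
  using hermitian_scale_left[of h 0 0 y] by simp

lemma hermitian_zero_right: "hermitian h \<Longrightarrow> h y 0 = 0"
  using hermitian_scale_right[of h y 0 0] by simp

lemma hermitian_diff_left: "hermitian h \<Longrightarrow> h (x - y) z = h x z - h y z"
  using hermitian_add_left[of h x "scale (-1) y" z] hermitian_scale_left[of h "-1" y z]
  by simp

lemma hermitian_sum_left: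
  assumes "hermitian h" "finite S"
  shows "h (\<Sum>b\<in>S. f b) y = (\<Sum>b\<in>S. h (f b) y)"
  using assms(2)
  by (induction S) (auto simp: hermitian_zero_left[OF assms(1)] hermitian_add_left[OF assms(1)])

lemma hermitian_sum_right:
  assumes "hermitian h" "finite S"
  shows "h y (\<Sum>b\<in>S. f b) = (\<Sum>b\<in>S. h y (f b))"
  using assms(2)
  by (induction S) (auto simp: hermitian_zero_right[OF assms(1)] hermitian_add_right[OF assms(1)])

lemma hermitian_sum_sum:
  assumes "hermitian h" "finite S"
  shows "h (\<Sum>b\<in>S. scale (c b) b) (\<Sum>b\<in>S. scale (e b) b) =
    (\<Sum>b\<in>S. \<Sum>b'\<in>S. c b * cnj (e b') * h b b')"
  using assms
  by (simp add: hermitian_sum_left hermitian_sum_right hermitian_scale_left hermitian_scale_right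
      sum_distrib_left mult.assoc)

lemma hermitian_real: "hermitian h \<Longrightarrow> h x x = complex_of_real (Re (h x x))"
  using hermitian_sym[of h x x] by (metis Reals_cnj_iff of_real_Re)

lemma hermitian_uminus: "hermitian h \<Longrightarrow> hermitian (\<lambda>x y. - h x y)"
  unfolding hermitian_def by (metis add_uminus_conv_diff complex_cnj_minus minus_add_distrib mult_minus_right)

section \<open>Independence, dimension counts and orthogonal bases\<close>

lemma span_finite_sum:
  assumes "finite S" "x \<in> span S"
  obtains c where "x = (\<Sum>b\<in>S. scale (c b) b)"
  using assms span_finite[of S] by auto

lemma independent_Un:
  assumes "independent S" "independent T" "finite S" "finite T" "span S \<inter> span T \<subseteq> {0}"
  shows "independent (S \<union> T)" and "S \<inter> T = {}"
proof -
  have "0 \<notin> S" using assms(1) dependent_zero by blast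
  then show dis: "S \<inter> T = {}"
    using assms(5) by (auto dest: span_base)
  show "independent (S \<union> T)"
  proof (rule independent_if_scalars_zero)
    fix u v assume 0: "(\<Sum>x\<in>S \<union> T. scale (u x) x) = 0" and v: "v \<in> S \<union> T"
    have "(\<Sum>x\<in>S. scale (u x) x) + (\<Sum>x\<in>T. scale (u x) x) = 0"
      using 0 assms dis by (simp add: sum.union_disjoint)
    then have eq: "(\<Sum>x\<in>S. scale (u x) x) = (\<Sum>x\<in>T. scale (- u x) x)"
      by (simp add: sum_negf eq_neg_iff_add_eq_0)
    have "(\<Sum>x\<in>S. scale (u x) x) \<in> span S" "(\<Sum>x\<in>T. scale (- u x) x) \<in> span T"
      by (rule span_sum, rule span_scale, rule span_base, assumption)+
    then have "(\<Sum>x\<in>S. scale (u x) x) = 0" "(\<Sum>x\<in>T. scale (- u x) x) = 0"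
      using eq assms(5) by auto
    then show "u v = 0"
      using v independentD[OF assms(1,3) subset_refl, of u]
        independentD[OF assms(2,4) subset_refl, of "\<lambda>x. - u x"] by auto
  qed (use assms in auto)
qed

lemma card_add_le_dim:
  assumes "independent S" "independent T" "span S \<inter> span T \<subseteq> {0}"
    and "S \<subseteq> span F" "T \<subseteq> span F" "finite F" "dim (span F) \<le> n"
  shows "card S + card T \<le> n"
proof -
  obtain B where B: "B \<subseteq> span F" "independent B" "span F \<subseteq> span B" "card B = dim (span F)"
    using basis_exists by blast
  have finB: "finite B" using independent_span_bound[OF assms(6) B(2)] B(1) by auto
  have fin: "finite S" "finite T"
    using independent_span_bound[OF assms(6)] assms by auto
  have "S \<union> T \<subseteq> span B" using assms(4,5) B(3) by auto
  then have "card (S \<union> T) \<le> card B"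
    using independent_span_bound[OF finB independent_Un(1)[OF assms(1,2) fin assms(3)]] by simp
  then show ?thesis
    using card_Un_disjoint[OF fin independent_Un(2)[OF assms(1,2) fin assms(3)]] B assms by simp
qed

lemma finite_dim_subspace_basis:
  assumes "subspace U" "U \<subseteq> span F" "finite F"
  obtains B where "B \<subseteq> U" "finite B" "independent B" "span B = U" "card B = dim U"
proof -
  obtain B where B: "B \<subseteq> U" "independent B" "U \<subseteq> span B" "card B = dim U"
    using basis_exists by blast
  moreover have "finite B" using independent_span_bound[OF assms(3) B(2)] B assms by auto
  moreover have "span B = U" using B span_minimal[OF B(1) assms(1)] by auto
  ultimately show ?thesis using that by blast
qed

text \<open>Orthogonalization for a form that may be indefinite or degenerate: split off one vector
  with \<open>h x x \<noteq> 0\<close>, whose orthogonal space is then a genuine complement, and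
  recurse into that space. When no such vector is left, the form vanishes by polarization and any
  basis will do.\<close>

lemma orthogonal_basis_exists:
  assumes h: "hermitian h" and "subspace U" "U \<subseteq> span F" "finite F"
  shows "\<exists>B. B \<subseteq> U \<and> finite B \<and> independent B \<and> span B = U \<and> card B = dim U \<and> orthogonal_set h B"
  using assms(2,3)
proof (induction "dim U" arbitrary: U rule: less_induct)
  case less
  obtain B where B: "B \<subseteq> U" "finite B" "independent B" "span B = U" "card B = dim U"
    using finite_dim_subspace_basis[OF less(2,3) assms(4)] by blast
  show ?case
  proof (cases "\<forall>x\<in>U. h x x = 0")
    case True
    have "h x y = 0" if "x \<in> U" "y \<in> U" for x y
    proof -
      \<comment> \<open>Expansion at \<open>x + y\<close> and at \<open>x + \<i> y\<close> isolates
        the sum and the difference of \<open>h x y\<close> and \<open>h y x\<close>.\<close>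
      have "h (x + y) (x + y) = 0" "h (x + scale \<i> y) (x + scale \<i> y) = 0"
        using True that less(2) by (simp_all add: subspace_add subspace_scale)
      then have "h x y + h y x = 0" "- \<i> * h x y + \<i> * h y x = 0"
        using True that h by (simp_all add: hermitian_add_left hermitian_add_right
          hermitian_scale_left hermitian_scale_right)
      then have "h x y + h y x = 0" "h x y - h y x = 0" by (auto simp: algebra_simps)
      moreover have "2 * h x y = (h x y + h y x) + (h x y - h y x)" by simp
      ultimately show ?thesis by simp
    qed
    then show ?thesis using B unfolding orthogonal_set_def by (intro exI[of _ B]) auto
  next
    case False
    then obtain x where x: "x \<in> U" "h x x \<noteq> 0" by auto
    define V where "V = {u \<in> U. h u x = 0}"
    have V: "subspace V"
      using less(2) h unfolding V_def subspace_def
      by (auto simp: hermitian_zero_left hermitian_add_left hermitian_scale_left)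
    have VU: "V \<subseteq> U" by (auto simp: V_def)
    obtain C where C: "C \<subseteq> V" "finite C" "independent C" "span C = V" "card C = dim V"
      using finite_dim_subspace_basis[OF V _ assms(4)] VU less(3) by blast
    have "x \<notin> V" using x by (simp add: V_def)
    \<comment> \<open>Used twice: with an arbitrary basis of \<open>V\<close>, to see that the
      dimension drops by one, and then with the orthogonal basis supplied by the induction
      hypothesis.\<close>
    have ins: "independent (insert x C')" "span (insert x C') = U" if "C' \<subseteq> V" "independent C'" "span C' = V" for C'
    proof -
      show "independent (insert x C')"
        using that \<open>x \<notin> V\<close> by (intro independent_insertI) auto
      have "u \<in> span (insert x C')" if u: "u \<in> U" for u
      proof -
        have "u - scale (h u x / h x x) x \<in> V"
          using u x h less(2) by (simp add: V_def subspace_diff subspace_scale hermitian_diff_left hermitian_scale_left)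
        then show ?thesis using \<open>span C' = V\<close>
          using span_breakdown_eq by blast
      qed
      moreover have "span (insert x C') \<subseteq> U"
        using that VU x by (intro span_minimal less(2)) auto
      ultimately show "span (insert x C') = U" by auto
    qed
    have "dim U = Suc (dim V)"
      using dim_eq_card[of "insert x C" U] ins[OF C(1,3,4)] C \<open>x \<notin> V\<close> less(2)
      by (metis C(1) C(2) C(5) card_insert_disjoint span_eq_iff subset_iff)
    then obtain C' where C': "C' \<subseteq> V" "finite C'" "independent C'" "span C' = V" "card C' = dim V" "orthogonal_set h C'"
      using less(1)[OF _ V] VU less(3) by auto
    have "orthogonal_set h (insert x C')"
    proof -
      have "h u x = 0 \<and> h x u = 0" if "u \<in> C'" for u
        using that C'(1) hermitian_sym[OF h, of x u] by (auto simp: V_def)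
      then show ?thesis using C'(6) by (auto simp: orthogonal_set_def)
    qed
    moreover have "card (insert x C') = dim U"
      using C' \<open>x \<notin> V\<close> \<open>dim U = _\<close> by (metis card_insert_disjoint subset_iff)
    ultimately show ?thesis
      using ins[OF C'(1,3,4)] C' x VU by (intro exI[of _ "insert x C'"]) auto
  qed
qed

lemma orthogonal_sum:
  assumes "hermitian h" "finite S" "orthogonal_set h S"
  shows "h (\<Sum>b\<in>S. scale (c b) b) (\<Sum>b\<in>S. scale (c b) b) = (\<Sum>b\<in>S. complex_of_real ((cmod (c b))\<^sup>2) * h b b)"
proof -
  have "(\<Sum>b'\<in>S. c b * cnj (c b') * h b b') = (\<Sum>b'\<in>S. if b' = b then complex_of_real ((cmod (c b))\<^sup>2) * h b b else 0)"
    if "b \<in> S" for b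
    using that assms(3) by (intro sum.cong) (auto simp: orthogonal_set_def complex_norm_square simp del: of_real_power)
  then show ?thesis
    unfolding hermitian_sum_sum[OF assms(1,2)] using assms(2) by (simp add: sum.delta)
qed

section \<open>Sylvester bases and the law of inertia\<close>

definition sylvester :: "('b \<Rightarrow> 'b \<Rightarrow> complex) \<Rightarrow> 'b set \<Rightarrow> 'b set \<Rightarrow> 'b set \<Rightarrow> 'b set \<Rightarrow> bool" where
  "sylvester h U P Z N \<longleftrightarrow> finite (P \<union> Z \<union> N) \<and> independent (P \<union> Z \<union> N) \<and> span (P \<union> Z \<union> N) = U \<and>
     orthogonal_set h (P \<union> Z \<union> N) \<and>
     (\<forall>b\<in>P. Re (h b b) > 0) \<and> (\<forall>b\<in>Z. h b b = 0) \<and> (\<forall>b\<in>N. Re (h b b) < 0)"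

lemma sylvester_exists:
  assumes "hermitian h" "subspace U" "U \<subseteq> span F" "finite F"
  obtains P Z N where "sylvester h U P Z N"
proof -
  obtain B where B: "B \<subseteq> U" "finite B" "independent B" "span B = U" "card B = dim U" "orthogonal_set h B"
    using orthogonal_basis_exists[OF assms] by blast
  have "{b\<in>B. Re (h b b) > 0} \<union> {b\<in>B. h b b = 0} \<union> {b\<in>B. Re (h b b) < 0} = B"
    using hermitian_real[OF assms(1)] by (auto simp: not_less) (metis less_eq_real_def of_real_0)
  then have "sylvester h U {b\<in>B. Re (h b b) > 0} {b\<in>B. h b b = 0} {b\<in>B. Re (h b b) < 0}"
    using B unfolding sylvester_def by auto
  then show ?thesis using that by blast
qed

lemma orthogonal_set_mono: "orthogonal_set h S \<Longrightarrow> T \<subseteq> S \<Longrightarrow> orthogonal_set h T"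
  unfolding orthogonal_set_def by blast

lemma positive_on_orthogonal:
  assumes "hermitian h" "finite S" "orthogonal_set h S" "\<And>b. b \<in> S \<Longrightarrow> 0 < Re (h b b)"
  shows "positive_on h (span S)"
  unfolding positive_on_def
proof (intro ballI impI)
  fix x assume "x \<in> span S" "x \<noteq> 0"
  then obtain c where c: "x = (\<Sum>b\<in>S. scale (c b) b)" using span_finite_sum[OF assms(2)] by blast
  then obtain b where "b \<in> S" "c b \<noteq> 0" using \<open>x \<noteq> 0\<close> by (metis (mono_tags, lifting) scale_zero_left sum.neutral)
  have "Re (h x x) = (\<Sum>b\<in>S. (cmod (c b))\<^sup>2 * Re (h b b))"
    unfolding c orthogonal_sum[OF assms(1-3)] by (simp add: Re_sum flip: of_real_power)
  also have "\<dots> > 0"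
    using \<open>b \<in> S\<close> \<open>c b \<noteq> 0\<close> assms by (intro sum_pos2[of S b]) (auto intro!: mult_nonneg_nonneg intro: less_imp_le)
  finally show "Re (h x x) > 0" .
qed

lemma nonpositive_orthogonal:
  assumes "hermitian h" "finite S" "orthogonal_set h S" "\<And>b. b \<in> S \<Longrightarrow> Re (h b b) \<le> 0" "x \<in> span S"
  shows "Re (h x x) \<le> 0"
proof -
  obtain c where c: "x = (\<Sum>b\<in>S. scale (c b) b)" using span_finite_sum[OF assms(2,5)] by blast
  have "Re (h x x) = (\<Sum>b\<in>S. (cmod (c b))\<^sup>2 * Re (h b b))"
    unfolding c orthogonal_sum[OF assms(1-3)] by (simp add: Re_sum flip: of_real_power)
  also have "\<dots> \<le> 0" using assms(4) by (intro sum_nonpos) (simp add: mult_nonneg_nonpos)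
  finally show ?thesis .
qed

context
  fixes h U P Z N
  assumes h: "hermitian h" and syl: "sylvester h U P Z N"
begin

lemma sylvester_fin: "finite P" "finite Z" "finite N"
  and sylvester_indep: "independent P" "independent Z" "independent N" "independent (P \<union> Z)" "independent (N \<union> Z)"
  and sylvester_sub: "P \<subseteq> U" "Z \<subseteq> U" "N \<subseteq> U"
  and sylvester_subspace: "subspace U"
  using syl independent_mono[of "P \<union> Z \<union> N"] span_superset[of "P \<union> Z \<union> N"]
  unfolding sylvester_def by (auto simp: subset_iff)

lemma sylvester_dim: "dim U = card P + card Z + card N"
  and sylvester_disjoint: "P \<inter> Z = {}" "P \<inter> N = {}" "Z \<inter> N = {}"
proof -
  show d: "P \<inter> Z = {}" "P \<inter> N = {}" "Z \<inter> N = {}"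
    using syl unfolding sylvester_def by force+
  have "dim U = card (P \<union> Z \<union> N)"
    using syl unfolding sylvester_def by (metis dim_span_eq_card_independent)
  also have "\<dots> = card P + card Z + card N"
    using d sylvester_fin by (subst card_Un_disjoint card_Un_disjoint, auto)+
  finally show "dim U = card P + card Z + card N" .
qed

lemma sylvester_orthogonal: "orthogonal_set h P" "orthogonal_set h Z" "orthogonal_set h N" "orthogonal_set h (Z \<union> N)"
  using syl unfolding sylvester_def by (auto elim: orthogonal_set_mono)

lemma sylvester_positive: "positive_on h (span P)"
  using syl by (intro positive_on_orthogonal[OF h sylvester_fin(1) sylvester_orthogonal(1)])
    (simp add: sylvester_def)

lemma sylvester_radical: "span Z = radical h U"
proof
  have U: "U = span (P \<union> Z \<union> N)" using syl by (simp add: sylvester_def)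
  have orth: "orthogonal_set h (P \<union> Z \<union> N)" and zero: "\<forall>b\<in>Z. h b b = 0"
    using syl by (simp_all add: sylvester_def)
  have z: "h b y = 0" if "b \<in> Z" "y \<in> U" for b y
  proof -
    obtain c where c: "y = (\<Sum>b\<in>P \<union> Z \<union> N. scale (c b) b)"
      using \<open>y \<in> U\<close> U sylvester_fin span_finite_sum[of "P \<union> Z \<union> N" y] by blast
    have "h b y = (\<Sum>b'\<in>P \<union> Z \<union> N. cnj (c b') * h b b')"
      unfolding c using h sylvester_fin by (simp add: hermitian_sum_right hermitian_scale_right)
    also have "\<dots> = 0"
    proof (intro sum.neutral ballI)
      fix b' assume "b' \<in> P \<union> Z \<union> N"
      then have "h b b' = 0"
        using orth zero \<open>b \<in> Z\<close> by (cases "b' = b") (auto simp: orthogonal_set_def)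
      then show "cnj (c b') * h b b' = 0" by simp
    qed
    finally show ?thesis .
  qed
  show "span Z \<subseteq> radical h U"
  proof (rule span_minimal)
    show "Z \<subseteq> radical h U" using z sylvester_sub by (auto simp: radical_def)
    show "subspace (radical h U)"
      using h sylvester_subspace unfolding radical_def subspace_def
      by (auto simp: hermitian_zero_left hermitian_add_left hermitian_scale_left)
  qed
  show "radical h U \<subseteq> span Z"
  proof
    fix x assume x: "x \<in> radical h U"
    obtain c where c: "x = (\<Sum>b\<in>P \<union> Z \<union> N. scale (c b) b)"
      using x U sylvester_fin span_finite_sum[of "P \<union> Z \<union> N" x] by (auto simp: radical_def)
    \<comment> \<open>Pairing with \<open>b\<close> leaves only \<open>c b * h b b\<close>, and
      \<open>h b b\<close> is nonzero outside \<open>Z\<close>.\<close>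
    have "c b = 0" if b: "b \<in> P \<union> N" for b
    proof -
      have "0 = h x b" using x b sylvester_sub by (auto simp: radical_def)
      also have "\<dots> = (\<Sum>b'\<in>P \<union> Z \<union> N. c b' * h b' b)"
        unfolding c using h sylvester_fin by (simp add: hermitian_sum_left hermitian_scale_left)
      also have "\<dots> = (\<Sum>b'\<in>P \<union> Z \<union> N. if b' = b then c b * h b b else 0)"
        using orth b by (intro sum.cong) (auto simp: orthogonal_set_def)
      also have "\<dots> = c b * h b b" using b sylvester_fin by (subst sum.delta) auto
      finally show ?thesis using b syl by (auto simp: sylvester_def)
    qed
    then have "x = (\<Sum>b\<in>Z. scale (c b) b)"
      unfolding c using sylvester_fin sylvester_disjoint
      by (intro sum.mono_neutral_right) auto
    moreover have "(\<Sum>b\<in>Z. scale (c b) b) \<in> span Z"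
      by (rule span_sum, rule span_scale, rule span_base, assumption)
    ultimately show "x \<in> span Z" by simp
  qed
qed

lemma sylvester_dim_radical: "dim (radical h U) = card Z"
  using sylvester_indep sylvester_radical by (metis dim_span_eq_card_independent)

text \<open>On the span of \<open>Z \<union> N\<close> the form is nonpositive, so a subspace on
  which it is positive meets that span only in 0; the dimensions then leave room for at most
  \<open>card P\<close> vectors.\<close>

lemma sylvester_positive_le:
  assumes "independent S" "S \<subseteq> U" "positive_on h (span S)"
  shows "card S \<le> card P"
proof -
  have "card S + card (Z \<union> N) \<le> dim U"
  proof (rule card_add_le_dim)
    show "independent (Z \<union> N)" using sylvester_indep by (simp add: Un_commute)
    have "Re (h x x) \<le> 0" if "x \<in> span (Z \<union> N)" for x
    proof (rule nonpositive_orthogonal[OF h _ sylvester_orthogonal(4) _ that])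
      show "Re (h b b) \<le> 0" if "b \<in> Z \<union> N" for b
        using syl that by (auto simp: sylvester_def intro: less_imp_le)
    qed (use sylvester_fin in auto)
    then show "span S \<inter> span (Z \<union> N) \<subseteq> {0}"
      using assms(3) unfolding positive_on_def by force
    show "finite (P \<union> Z \<union> N)" using sylvester_fin by auto
    show "S \<subseteq> span (P \<union> Z \<union> N)" "Z \<union> N \<subseteq> span (P \<union> Z \<union> N)"
      using assms(2) syl span_superset[of "P \<union> Z \<union> N"] by (auto simp: sylvester_def)
    show "dim (span (P \<union> Z \<union> N)) \<le> dim U" using syl by (simp add: sylvester_def)
  qed (use assms in auto)
  moreover have "card (Z \<union> N) = card Z + card N"
    using sylvester_fin sylvester_disjoint by (simp add: card_Un_disjoint)
  ultimately show ?thesis using sylvester_dim by simp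
qed

text \<open>Every fact about negative subspaces is read off from its positive counterpart through
  this exchange.\<close>

lemma sylvester_uminus: "sylvester (\<lambda>x y. - h x y) U N Z P"
  using syl unfolding sylvester_def orthogonal_set_def by (auto simp: Un_ac)

end

lemma sylvester_negative_le:
  assumes "hermitian h" "sylvester h U P Z N"
    and "independent S" "S \<subseteq> U" "positive_on (\<lambda>x y. - h x y) (span S)"
  shows "card S \<le> card N"
  using sylvester_positive_le[OF hermitian_uminus sylvester_uminus] assms by blast

text \<open>Sylvester's law of inertia makes the choice irrelevant.\<close>

definition positive_index :: "('b \<Rightarrow> 'b \<Rightarrow> complex) \<Rightarrow> 'b set \<Rightarrow> nat" where
  "positive_index h U = (SOME n. \<exists>P Z N. sylvester h U P Z N \<and> card P = n)"

lemma positive_index_eq: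
  assumes "hermitian h" "sylvester h U P Z N"
  shows "positive_index h U = card P"
proof -
  have "\<exists>P' Z' N'. sylvester h U P' Z' N' \<and> card P' = positive_index h U"
    unfolding positive_index_def by (rule someI_ex) (use assms in blast)
  then obtain P' Z' N' where s: "sylvester h U P' Z' N'" "card P' = positive_index h U" by blast
  show ?thesis
    using s(2) sylvester_positive_le[OF assms, of P'] sylvester_positive_le[OF assms(1) s(1), of P]
      sylvester_positive[OF assms] sylvester_positive[OF assms(1) s(1)]
      sylvester_indep[OF assms] sylvester_sub[OF assms]
      sylvester_indep[OF assms(1) s(1)] sylvester_sub[OF assms(1) s(1)] by simp
qed

end

text \<open>Diagonal dominance, uniform in the coefficients. It speaks of matrices
  \<open>g k\<close> rather than of forms because it will also be applied to vectors rescaled by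
  factors depending on \<open>k\<close>.\<close>

lemma eventually_gram_positive:
  fixes g :: "'k \<Rightarrow> 'a \<Rightarrow> 'a \<Rightarrow> complex"
  assumes "finite S" and lim: "\<And>b b'. b \<in> S \<Longrightarrow> b' \<in> S \<Longrightarrow> ((\<lambda>k. g k b b') \<longlongrightarrow> l b b') F"
    and off: "\<And>b b'. b \<in> S \<Longrightarrow> b' \<in> S \<Longrightarrow> b \<noteq> b' \<Longrightarrow> l b b' = 0"
    and diag: "\<And>b. b \<in> S \<Longrightarrow> 0 < Re (l b b)"
  shows "\<forall>\<^sub>F k in F. \<forall>c. (\<exists>b\<in>S. c b \<noteq> 0) \<longrightarrow> 0 < Re (\<Sum>b\<in>S. \<Sum>b'\<in>S. c b * cnj (c b') * g k b b')"
proof (cases "S = {}")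
  case False
  define m where "m = Min ((\<lambda>b. Re (l b b)) ` S)"
  have m: "0 < m" "\<And>b. b \<in> S \<Longrightarrow> m \<le> Re (l b b)"
    using assms False by (auto simp: m_def)
  \<comment> \<open>With \<open>n\<close> the sum of the squared moduli of the coefficients, entries
    off by less than \<open>e\<close> cost at most \<open>card S * n * e\<close>, which is half of
    the lower bound \<open>n * m\<close> for the limit.\<close>
  define e where "e = m / (2 * card S)"
  have e: "e > 0" using m False assms(1) by (simp add: e_def card_gt_0_iff)
  have "\<forall>\<^sub>F k in F. \<forall>b\<in>S. \<forall>b'\<in>S. dist (g k b b') (l b b') < e"
    using assms(1) e by (intro eventually_ball_finite ballI tendstoD[OF lim]) auto
  then show ?thesis
  proof eventually_elim
    case (elim k)
    show ?case
    proof (intro allI impI)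
      fix c :: "'a \<Rightarrow> complex" assume c: "\<exists>b\<in>S. c b \<noteq> 0"
      define n where "n = (\<Sum>b\<in>S. (cmod (c b))\<^sup>2)"
      have n: "n > 0"
        using c assms(1) unfolding n_def by (auto intro: sum_pos2)
      have "(\<Sum>b'\<in>S. c b * cnj (c b') * l b b') = (\<Sum>b'\<in>S. if b' = b then complex_of_real ((cmod (c b))\<^sup>2) * l b b else 0)"
        if "b \<in> S" for b
        using that off by (intro sum.cong) (auto simp: complex_norm_square simp del: of_real_power)
      then have "(\<Sum>b\<in>S. \<Sum>b'\<in>S. c b * cnj (c b') * l b b') = (\<Sum>b\<in>S. complex_of_real ((cmod (c b))\<^sup>2) * l b b)"
        using assms(1) by (simp add: sum.delta)
      then have "Re (\<Sum>b\<in>S. \<Sum>b'\<in>S. c b * cnj (c b') * l b b') = (\<Sum>b\<in>S. (cmod (c b))\<^sup>2 * Re (l b b))"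
        by (simp add: Re_sum flip: of_real_power)
      also have "\<dots> \<ge> n * m"
        unfolding n_def sum_distrib_right using m by (intro sum_mono mult_left_mono) auto
      finally have 1: "Re (\<Sum>b\<in>S. \<Sum>b'\<in>S. c b * cnj (c b') * l b b') \<ge> n * m" .
      have "cmod ((\<Sum>b\<in>S. \<Sum>b'\<in>S. c b * cnj (c b') * g k b b') - (\<Sum>b\<in>S. \<Sum>b'\<in>S. c b * cnj (c b') * l b b'))
        \<le> (\<Sum>b\<in>S. \<Sum>b'\<in>S. cmod (c b) * cmod (c b') * e)"
      proof -
        have "(\<Sum>b\<in>S. \<Sum>b'\<in>S. c b * cnj (c b') * g k b b') - (\<Sum>b\<in>S. \<Sum>b'\<in>S. c b * cnj (c b') * l b b') =
          (\<Sum>b\<in>S. \<Sum>b'\<in>S. c b * cnj (c b') * (g k b b' - l b b'))"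
          by (simp add: sum_subtractf right_diff_distrib)
        also have "cmod \<dots> \<le> (\<Sum>b\<in>S. \<Sum>b'\<in>S. cmod (c b) * cmod (c b') * e)"
        proof (intro sum_norm_le)
          fix b b' assume "b \<in> S" "b' \<in> S"
          then have "cmod (g k b b' - l b b') \<le> e" using elim by (auto simp: dist_norm intro: less_imp_le)
          then show "cmod (c b * cnj (c b') * (g k b b' - l b b')) \<le> cmod (c b) * cmod (c b') * e"
            by (simp add: norm_mult mult_left_mono)
        qed
        finally show ?thesis .
      qed
      also have "\<dots> \<le> (\<Sum>b\<in>S. \<Sum>b'\<in>S. ((cmod (c b))\<^sup>2 + (cmod (c b'))\<^sup>2) / 2 * e)"
      proof (intro sum_mono mult_right_mono)
        fix b b' show "cmod (c b) * cmod (c b') \<le> ((cmod (c b))\<^sup>2 + (cmod (c b'))\<^sup>2) / 2"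
          using sum_squares_bound[of "cmod (c b)" "cmod (c b')"] by simp
      qed (use e in auto)
      also have "\<dots> = card S * n * e"
        by (simp add: n_def sum.distrib algebra_simps add_divide_distrib sum_distrib_left sum_distrib_right
            flip: sum_divide_distrib)
      also have "\<dots> = n * m / 2" using False assms(1) by (simp add: e_def)
      finally have "cmod ((\<Sum>b\<in>S. \<Sum>b'\<in>S. c b * cnj (c b') * g k b b') - (\<Sum>b\<in>S. \<Sum>b'\<in>S. c b * cnj (c b') * l b b')) \<le> n * m / 2" .
      then have "\<bar>Re (\<Sum>b\<in>S. \<Sum>b'\<in>S. c b * cnj (c b') * g k b b') - Re (\<Sum>b\<in>S. \<Sum>b'\<in>S. c b * cnj (c b') * l b b')\<bar> \<le> n * m / 2"
        unfolding minus_complex.sel(1)[symmetric] by (rule order_trans[OF abs_Re_le_cmod])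
      then have "Re (\<Sum>b\<in>S. \<Sum>b'\<in>S. c b * cnj (c b') * g k b b') \<ge> n * m / 2"
        using 1 by linarith
      moreover have "n * m / 2 > 0" using n m by simp
      ultimately show "0 < Re (\<Sum>b\<in>S. \<Sum>b'\<in>S. c b * cnj (c b') * g k b b')" by linarith
    qed
  qed
qed auto

section \<open>Signatures along converging and along decreasing families of forms\<close>

context complex_space
begin

lemma dim_finite_le:
  assumes "hermitian h" "sylvester h U P Z N" "independent T" "T \<subseteq> U" "positive_on (\<lambda>x y. - h x y) (span T)"
  shows "positive_index h U + dim (radical h U) + card T \<le> dim U"
  using sylvester_negative_le[OF assms] sylvester_dim[OF assms(1,2)]
    sylvester_dim_radical[OF assms(1,2)] positive_index_eq[OF assms(1,2)] by simp

lemma eventually_positive_on: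
  assumes "\<forall>\<^sub>F k in F. hermitian (h k)" and "hermitian g" and "finite S" "orthogonal_set g S"
    and "\<And>b. b \<in> S \<Longrightarrow> 0 < Re (g b b)"
    and "\<And>b b'. b \<in> S \<Longrightarrow> b' \<in> S \<Longrightarrow> ((\<lambda>k. h k b b') \<longlongrightarrow> g b b') F"
  shows "\<forall>\<^sub>F k in F. positive_on (h k) (span S)"
proof -
  have "\<forall>\<^sub>F k in F. \<forall>c. (\<exists>b\<in>S. c b \<noteq> 0) \<longrightarrow> 0 < Re (\<Sum>b\<in>S. \<Sum>b'\<in>S. c b * cnj (c b') * h k b b')"
    using assms by (intro eventually_gram_positive[where l = g]) (auto simp: orthogonal_set_def)
  with assms(1) show ?thesis
  proof eventually_elim
    case (elim k)
    show ?case unfolding positive_on_def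
    proof (intro ballI impI)
      fix x assume "x \<in> span S" "x \<noteq> 0"
      then obtain c where c: "x = (\<Sum>b\<in>S. scale (c b) b)" using span_finite_sum[OF assms(3)] by blast
      then have "\<exists>b\<in>S. c b \<noteq> 0" using \<open>x \<noteq> 0\<close> by (metis (mono_tags, lifting) scale_zero_left sum.neutral)
      then show "0 < Re (h k x x)"
        unfolding c using hermitian_sum_sum[OF elim(1) assms(3)] elim(2) by simp
    qed
  qed
qed

text \<open>The crossings of zero by the eigenvalues of a decreasing family of Hermitian forms are counted
  by the drop of the positive index. Strict decrease is only required on the radicals.\<close>

lemma positive_index_drop:
  fixes h :: "real \<Rightarrow> 'b \<Rightarrow> 'b \<Rightarrow> complex"
  assumes "a \<le> b" and U: "subspace U" "U \<subseteq> span F" "finite F"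
    and herm: "\<And>d. d \<in> {a..b} \<Longrightarrow> hermitian (h d)"
    and cont: "\<And>x y. x \<in> U \<Longrightarrow> y \<in> U \<Longrightarrow> continuous_on {a..b} (\<lambda>d. h d x y)"
    and mono: "\<And>d d' x. a \<le> d \<Longrightarrow> d < d' \<Longrightarrow> d' \<le> b \<Longrightarrow> x \<in> U \<Longrightarrow> Re (h d' x x) \<le> Re (h d x x)"
    and strict: "\<And>d d' x. a \<le> d \<Longrightarrow> d < d' \<Longrightarrow> d' \<le> b \<Longrightarrow> x \<in> radical (h d') U \<Longrightarrow> x \<noteq> 0 \<Longrightarrow> 0 < Re (h d x x)"
  shows "finite {d\<in>{a<..b}. dim (radical (h d) U) \<noteq> 0} \<and>
    positive_index (h a) U = positive_index (h b) U +
      (\<Sum>d | d \<in> {a<..b} \<and> dim (radical (h d) U) \<noteq> 0. dim (radical (h d) U))"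
proof -
  define z where "z d = dim (radical (h d) U)" for d
  define p where "p d = positive_index (h d) U" for d
  define Q where "Q s t \<longleftrightarrow> finite {d\<in>{s<..t}. z d \<noteq> 0} \<and>
      p s = p t + (\<Sum>d | d \<in> {s<..t} \<and> z d \<noteq> 0. z d)" for s t
  \<comment> \<open>The form at \<open>d\<close> is positive on the span of the positive and null
    parts at \<open>d'\<close>. A nonzero positive component has a positive value at
    \<open>d'\<close> that cannot be smaller at \<open>d\<close>; without such a component the
    vector lies in the radical at \<open>d'\<close>, where strictness applies.\<close>
  have drop: "p d' + z d' \<le> p d" if dd: "a \<le> d" "d < d'" "d' \<le> b" for d d'
  proof -
    have hd: "hermitian (h d)" "hermitian (h d')" using that herm by auto
    obtain P Z N where s: "sylvester (h d) U P Z N" using sylvester_exists[OF hd(1) U] .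
    obtain P' Z' N' where s': "sylvester (h d') U P' Z' N'" using sylvester_exists[OF hd(2) U] .
    have "positive_on (h d) (span (P' \<union> Z'))"
      unfolding positive_on_def
    proof (intro ballI impI)
      fix x assume x: "x \<in> span (P' \<union> Z')" "x \<noteq> 0"
      then obtain u v where uv: "x = u + v" "u \<in> span P'" "v \<in> span Z'"
        by (auto simp: span_Un)
      have v: "v \<in> radical (h d') U" using sylvester_radical[OF hd(2) s'] uv by simp
      have xU: "x \<in> U" "u \<in> U"
        using x uv span_minimal[OF _ U(1)] sylvester_sub[OF hd(2) s'] by (meson le_sup_iff subset_iff)+
      show "0 < Re (h d x x)"
      proof (cases "u = 0")
        case True
        then show ?thesis using strict[OF dd v] x uv by simp
      next
        case False
        have "h d' v u = 0" "h d' v v = 0" using v xU by (auto simp: radical_def)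
        moreover have "h d' u v = 0" using hermitian_sym[OF hd(2), of u v] \<open>h d' v u = 0\<close> by simp
        ultimately have "h d' x x = h d' u u"
          unfolding uv using hd by (simp add: hermitian_add_left hermitian_add_right)
        moreover have "0 < Re (h d' u u)"
          using sylvester_positive[OF hd(2) s'] uv False by (auto simp: positive_on_def)
        ultimately show ?thesis using mono[OF dd xU(1)] by simp
      qed
    qed
    then have "card (P' \<union> Z') \<le> card P"
      using sylvester_positive_le[OF hd(1) s] sylvester_indep[OF hd(2) s'] sylvester_sub[OF hd(2) s'] by simp
    then show ?thesis
      using positive_index_eq[OF hd(1) s] positive_index_eq[OF hd(2) s'] sylvester_dim_radical[OF hd(2) s']
        sylvester_disjoint[OF hd(2) s'] sylvester_fin[OF hd(2) s']
      by (simp add: p_def z_def card_Un_disjoint)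
  qed
  \<comment> \<open>The spans of \<open>P\<close> and \<open>N\<close> at \<open>t\<close> stay
    positive and negative for nearby \<open>d\<close>. The first bounds \<open>p d\<close> from
    below, the second, through the total dimension, bounds \<open>p d + z d\<close> from
    above.\<close>
  have near: "\<exists>r>0. \<forall>d\<in>{a..b}. \<bar>d - t\<bar> < r \<longrightarrow> p t \<le> p d \<and> p d + z d \<le> p t + z t" if t: "t \<in> {a..b}" for t
  proof -
    have ht: "hermitian (h t)" using herm t by auto
    obtain P Z N where s: "sylvester (h t) U P Z N" using sylvester_exists[OF ht U] .
    let ?F = "at t within {a..b}"
    have lim: "((\<lambda>d. h d x y) \<longlongrightarrow> h t x y) ?F" if "x \<in> U" "y \<in> U" for x y
      using cont[OF that] t by (auto simp: continuous_on)
    have evh: "\<forall>\<^sub>F d in ?F. hermitian (h d)"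
      using herm by (auto simp: eventually_at_filter)
    have "\<forall>\<^sub>F d in ?F. positive_on (h d) (span P)"
      using s sylvester_sub[OF ht s]
      by (intro eventually_positive_on[OF evh ht sylvester_fin(1)[OF ht s] sylvester_orthogonal(1)[OF ht s]] lim)
        (auto simp: sylvester_def)
    moreover have "\<forall>\<^sub>F d in ?F. positive_on (\<lambda>x y. - h d x y) (span N)"
      using s sylvester_sub[OF ht s]
      by (intro eventually_positive_on[OF _ hermitian_uminus[OF ht] sylvester_fin(3)[OF ht s]
            sylvester_orthogonal(1)[OF hermitian_uminus[OF ht] sylvester_uminus[OF ht s]]] tendsto_minus lim
            eventually_mono[OF evh] hermitian_uminus)
        (auto simp: sylvester_def)
    ultimately have "\<forall>\<^sub>F d in ?F. positive_on (h d) (span P) \<and> positive_on (\<lambda>x y. - h d x y) (span N)"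
      by eventually_elim auto
    then obtain r where r: "r > 0" "\<forall>d\<in>{a..b}. d \<noteq> t \<and> dist d t < r \<longrightarrow>
        positive_on (h d) (span P) \<and> positive_on (\<lambda>x y. - h d x y) (span N)"
      by (auto simp: eventually_at)
    have "p t \<le> p d \<and> p d + z d \<le> p t + z t" if d: "d \<in> {a..b}" "\<bar>d - t\<bar> < r" for d
    proof (cases "d = t")
      case False
      have hd: "hermitian (h d)" using herm d by auto
      obtain P' Z' N' where s': "sylvester (h d) U P' Z' N'" using sylvester_exists[OF hd U] .
      have "card P \<le> card P'"
        using sylvester_positive_le[OF hd s'] sylvester_indep[OF ht s] sylvester_sub[OF ht s] r d False
        by (auto simp: dist_real_def)
      moreover have "card N \<le> card N'"
        using sylvester_negative_le[OF hd s'] sylvester_indep[OF ht s] sylvester_sub[OF ht s] r d False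
        by (auto simp: dist_real_def)
      ultimately show ?thesis
        using positive_index_eq[OF hd s'] positive_index_eq[OF ht s] sylvester_dim_radical[OF hd s']
          sylvester_dim_radical[OF ht s] sylvester_dim[OF hd s'] sylvester_dim[OF ht s]
        by (simp add: p_def z_def)
    qed auto
    then show ?thesis using r by blast
  qed
  \<comment> \<open>\<open>Q\<close> is additive over adjacent intervals, so by bisection it
    suffices to verify it on short intervals around each point.\<close>
  have "a \<le> a \<and> b \<le> b \<longrightarrow> Q a b"
  proof (rule Bolzano[where P = "\<lambda>s u. a \<le> s \<and> u \<le> b \<longrightarrow> Q s u", OF \<open>a \<le> b\<close>])
    fix s t u assume "a \<le> s \<and> t \<le> b \<longrightarrow> Q s t" "a \<le> t \<and> u \<le> b \<longrightarrow> Q t u" "s \<le> t" "t \<le> u"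
    moreover have "Q s u" if trans: "Q s t" "Q t u" "s \<le> t" "t \<le> u"
    proof -
    have eq: "{d\<in>{s<..u}. z d \<noteq> 0} = {d\<in>{s<..t}. z d \<noteq> 0} \<union> {d\<in>{t<..u}. z d \<noteq> 0}"
      using trans by auto
    moreover have "(\<Sum>d | d \<in> {s<..u} \<and> z d \<noteq> 0. z d) =
      (\<Sum>d | d \<in> {s<..t} \<and> z d \<noteq> 0. z d) + (\<Sum>d | d \<in> {t<..u} \<and> z d \<noteq> 0. z d)"
      using trans unfolding Q_def eq by (intro sum.union_disjoint) auto
    ultimately show ?thesis using trans by (simp add: Q_def)
    qed
    ultimately show "a \<le> s \<and> u \<le> b \<longrightarrow> Q s u" by auto
  next
    fix t assume "a \<le> t" "t \<le> b"
    then have t: "t \<in> {a..b}" by auto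
    then obtain r where r: "r > 0" "\<And>d. d \<in> {a..b} \<Longrightarrow> \<bar>d - t\<bar> < r \<Longrightarrow> p t \<le> p d \<and> p d + z d \<le> p t + z t"
      using near by blast
    \<comment> \<open>\<open>near\<close> and \<open>drop\<close> together leave no freedom: just
      after \<open>t\<close> the index is \<open>p t\<close>, just before it
      \<open>p t + z t\<close>, and nearby only \<open>t\<close> itself can carry a radical.\<close>
    have right: "p d = p t \<and> z d = 0" if "t < d" "d \<le> b" "d < t + r" for d
      using r(2)[of d] drop[of t d] that t by auto
    have left: "p d = p t + z t \<and> z d = 0" if "d < t" "a \<le> d" "t < d + r" for d
      using r(2)[of d] drop[of d t] that t by auto
    have "Q s u" if "s \<le> t" "t \<le> u" "u - s < r" "a \<le> s" "u \<le> b" for s u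
    \<comment> \<open>The half-open interval misses \<open>t\<close> exactly when
      \<open>s = t\<close>. This fits the fact that the index jumps on the left side of
      \<open>t\<close>.\<close>
    proof (cases "s = t")
      case True
      have E: "{d\<in>{s<..u}. z d \<noteq> 0} = {}" using right that True by force
      moreover have "p s = p u" using right[of u] that True by (cases "u = t") auto
      ultimately show ?thesis unfolding Q_def E by simp
    next
      case False
      have zt: "d = t" if "s < d" "d \<le> u" "0 < z d" for d
        using right[of d] left[of d] that \<open>s \<le> t\<close> \<open>u - s < r\<close> \<open>a \<le> s\<close> \<open>u \<le> b\<close> \<open>t \<le> u\<close>
        by (cases d t rule: linorder_cases) auto
      have E: "{d\<in>{s<..u}. z d \<noteq> 0} = (if z t = 0 then {} else {t})"
      proof (rule set_eqI)
        fix d show "d \<in> {d\<in>{s<..u}. z d \<noteq> 0} \<longleftrightarrow> d \<in> (if z t = 0 then {} else {t})"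
          using zt[of d] that(1,2) False by (cases "d = t") auto
      qed
      moreover have "p u = p t" using right[of u] that by (cases "u = t") auto
      moreover have "p s = p t + z t" using left[of s] that False by auto
      ultimately show ?thesis unfolding Q_def E by simp
    qed
    then show "\<exists>r>0. \<forall>s u. s \<le> t \<and> t \<le> u \<and> u - s < r \<longrightarrow> (a \<le> s \<and> u \<le> b \<longrightarrow> Q s u)"
      using r(1) by blast
  qed
  then show ?thesis by (simp add: Q_def p_def z_def)
qed

lemma positive_index_ge:
  assumes "hermitian h" "subspace U" "U \<subseteq> span F" "finite F"
    and "independent T" "T \<subseteq> U" "positive_on h (span T)"
  shows "card T \<le> positive_index h U"
  using sylvester_exists[OF assms(1-4)] sylvester_positive_le[OF assms(1) _ assms(5-7)]
    positive_index_eq[OF assms(1)] by metis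

lemma positive_index_le:
  assumes "hermitian h" "subspace U" "U \<subseteq> span F" "finite F"
    and "independent T" "T \<subseteq> U" "positive_on (\<lambda>x y. - h x y) (span T)"
  shows "positive_index h U + dim (radical h U) + card T \<le> dim U"
  using sylvester_exists[OF assms(1-4)] dim_finite_le[OF assms(1) _ assms(5-7)] by metis

text \<open>Rescaling the vectors of the positive part of \<open>B\<close> by \<open>1 / sqrt \<omega>\<close> makes the Gram matrix of
  \<open>\<omega> B + s\<close> converge to a positive diagonal matrix.\<close>

lemma eventually_positive_family:
  assumes B: "hermitian B" "sylvester B U P Z N" and M: "hermitian M"
    and S: "finite S" "independent S" "S \<subseteq> radical B U" "positive_on M (span S)"
    and h: "\<forall>\<^sub>F k in F. hermitian (h k)" and w: "filterlim w at_top F"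
    and lim: "\<And>x y. x \<in> U \<Longrightarrow> y \<in> U \<Longrightarrow>
      ((\<lambda>k. h k x y - complex_of_real (w k) * B x y) \<longlongrightarrow> M x y) F"
  obtains T where "independent T" "T \<subseteq> U" "card T = card P + card S"
    "\<forall>\<^sub>F k in F. positive_on (h k) (span T)"
proof -
  note sub = sylvester_sub[OF B] and fin = sylvester_fin[OF B] and rad = sylvester_radical[OF B]
  \<comment> \<open>An \<open>M\<close>-orthogonal basis of the same span, so that the limiting Gram
    matrix is diagonal on this block.\<close>
  obtain S' where S': "S' \<subseteq> span S" "finite S'" "independent S'" "span S' = span S"
      "card S' = dim (span S)" "orthogonal_set M S'"
    using orthogonal_basis_exists[OF M subspace_span subset_refl S(1)] by blast
  have SZ: "span S \<subseteq> span Z" using S(3) rad by (metis span_minimal subspace_span)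
  then have S'rad: "S' \<subseteq> radical B U" using S'(1) rad by auto
  then have S'U: "S' \<subseteq> U" by (auto simp: radical_def)
  have indZ: "independent (P \<union> Z)" by (rule sylvester_indep[OF B])
  have int: "span P \<inter> span Z \<subseteq> {0}"
  proof
    fix x assume x: "x \<in> span P \<inter> span Z"
    then have "B x x = 0" using rad unfolding radical_def by auto
    then show "x \<in> {0}" using sylvester_positive[OF B] x by (force simp: positive_on_def)
  qed
  have int': "span P \<inter> span S' \<subseteq> {0}" using int SZ S'(4) by auto
  note ind = independent_Un[OF sylvester_indep(1)[OF B] S'(3) fin(1) S'(2) int']
  let ?T = "P \<union> S'"
  have card: "card ?T = card P + card S"
    using ind(2) fin S' dim_span_eq_card_independent[OF S(2)] by (simp add: card_Un_disjoint)
  have TU: "?T \<subseteq> U" using sub S'U by auto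
  have B0: "B x y = 0" "B y x = 0" if "x \<in> S'" "y \<in> U" for x y
    using that S'rad hermitian_sym[OF B(1), of x y] by (auto simp: radical_def)
  \<comment> \<open>Rescaling does not change the span of \<open>?T\<close>, so one \<open>T\<close>
    serves for all \<open>k\<close>. In the limit the \<open>P\<close> block keeps \<open>B\<close>,
    the \<open>S'\<close> block keeps \<open>M\<close>, and the mixed entries die, because
    \<open>B\<close> vanishes on them and one factor \<open>1 / sqrt (w k)\<close> remains.\<close>
  define r where "r k b = (if b \<in> P then complex_of_real (1 / sqrt (w k)) else 1)" for k b
  define g where "g k b b' = r k b * r k b' * h k b b'" for k b b'
  define l where "l b b' = (if b \<in> P \<and> b' \<in> P then B b b' else if b \<in> P \<or> b' \<in> P then 0 else M b b')" for b b'
  have wpos: "\<forall>\<^sub>F k in F. w k > 0" using w by (simp add: filterlim_at_top_dense)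
  have inv: "((\<lambda>k. complex_of_real (1 / w k)) \<longlongrightarrow> 0) F"
    using tendsto_of_real[OF tendsto_inverse_0_at_top[OF w]] unfolding inverse_eq_divide of_real_0 .
  have sqr: "((\<lambda>k. complex_of_real (1 / sqrt (w k))) \<longlongrightarrow> 0) F"
    using tendsto_of_real[OF tendsto_inverse_0_at_top[OF filterlim_compose[OF sqrt_at_top w]]]
    unfolding inverse_eq_divide of_real_0 .
  have conv: "((\<lambda>k. g k b b') \<longlongrightarrow> l b b') F" if b: "b \<in> ?T" "b' \<in> ?T" for b b'
  proof -
    note L = lim[of b b'] 
    have bU: "b \<in> U" "b' \<in> U" using b TU by auto
    consider "b \<in> P" "b' \<in> P" | "b \<in> P" "b' \<notin> P" | "b \<notin> P" "b' \<in> P" | "b \<notin> P" "b' \<notin> P" by blast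
    then show ?thesis
    proof cases
      case 1
      have "((\<lambda>k. complex_of_real (1 / w k) * (h k b b' - complex_of_real (w k) * B b b') + B b b') \<longlongrightarrow> 0 * M b b' + B b b') F"
        by (intro tendsto_intros inv L bU)
      moreover have "\<forall>\<^sub>F k in F. complex_of_real (1 / w k) * (h k b b' - complex_of_real (w k) * B b b') + B b b' = g k b b'"
        using wpos
      proof eventually_elim
        case (elim k)
        have "r k b * r k b' = complex_of_real (1 / w k)"
          using 1 elim by (simp add: r_def flip: of_real_mult)
        then show ?case using elim by (simp add: g_def field_simps)
      qed
      ultimately show ?thesis using 1 by (auto simp: l_def intro: Lim_transform_eventually)
    next
      case 2
      have "((\<lambda>k. complex_of_real (1 / sqrt (w k)) * (h k b b' - complex_of_real (w k) * B b b')) \<longlongrightarrow> 0 * M b b') F"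
        by (intro tendsto_intros sqr L bU)
      then show ?thesis using 2 B0[of b' b] b bU by (simp add: l_def g_def r_def)
    next
      case 3
      have "((\<lambda>k. complex_of_real (1 / sqrt (w k)) * (h k b b' - complex_of_real (w k) * B b b')) \<longlongrightarrow> 0 * M b b') F"
        by (intro tendsto_intros sqr L bU)
      then show ?thesis using 3 B0[of b b'] b bU by (simp add: l_def g_def r_def)
    next
      case 4
      then show ?thesis using L[OF bU] B0[of b b'] b bU by (simp add: l_def g_def r_def)
    qed
  qed
  have "\<forall>\<^sub>F k in F. \<forall>c. (\<exists>b\<in>?T. c b \<noteq> 0) \<longrightarrow> 0 < Re (\<Sum>b\<in>?T. \<Sum>b'\<in>?T. c b * cnj (c b') * g k b b')"
  proof (rule eventually_gram_positive[where l = l, OF _ conv])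
    show "finite ?T" using fin S' by auto
    show "l b b' = 0" if "b \<in> ?T" "b' \<in> ?T" "b \<noteq> b'" for b b'
      using that S'(6) sylvester_orthogonal(1)[OF B] by (auto simp: l_def orthogonal_set_def)
    show "0 < Re (l b b)" if "b \<in> ?T" for b
    proof (cases "b \<in> P")
      case True
      then show ?thesis using B(2) by (auto simp: l_def sylvester_def)
    next
      case False
      then have "b \<in> S'" using that by auto
      moreover have "b \<noteq> 0" using S'(3) \<open>b \<in> S'\<close> dependent_zero by blast
      ultimately show ?thesis using S(4) S'(1) False by (auto simp: l_def positive_on_def)
    qed
  qed
  with h wpos have "\<forall>\<^sub>F k in F. positive_on (h k) (span ?T)"
  proof eventually_elim
    case (elim k)
    have r0: "r k b \<noteq> 0" "cnj (r k b) = r k b" for b using elim by (simp_all add: r_def)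
    have finT: "finite ?T" using fin S' by auto
    show ?case unfolding positive_on_def
    proof (intro ballI impI)
      fix x assume "x \<in> span ?T" "x \<noteq> 0"
      then obtain c where c: "x = (\<Sum>b\<in>?T. scale (c b) b)" using span_finite_sum[OF finT] by blast
      then have "\<exists>b\<in>?T. c b / r k b \<noteq> 0"
        using \<open>x \<noteq> 0\<close> r0 by (metis (mono_tags, lifting) scale_zero_left sum.neutral divide_eq_0_iff)
      then have "0 < Re (\<Sum>b\<in>?T. \<Sum>b'\<in>?T. (c b / r k b) * cnj (c b' / r k b') * g k b b')"
        using elim(3)[rule_format, of "\<lambda>b. c b / r k b"] by blast
      moreover have "(c b / r k b) * cnj (c b' / r k b') * g k b b' = c b * cnj (c b') * h k b b'" for b b'
        using r0 by (simp add: g_def)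
      ultimately show "0 < Re (h k x x)"
        unfolding c using hermitian_sum_sum[OF elim(1) finT] by simp
    qed
  qed
  then show ?thesis using that[OF ind(1) TU card] by blast
qed

end

section \<open>Absolutely continuous functions\<close>

text \<open>Density of continuous functions by two dominated limits. Cutting the values off at norm
  \<open>M\<close> is dominated by twice the norm of \<open>f\<close>; the cut-off function is then
  approximated almost everywhere by continuous ones, and the cut-off itself supplies the constant
  bound.\<close>

lemma absolutely_integrable_continuous_approx:
  fixes f :: "real \<Rightarrow> 'b::euclidean_space"
  assumes f: "f absolutely_integrable_on {a..b}" and "e > 0"
  obtains g where "continuous_on UNIV g" "integral {a..b} (\<lambda>x. norm (f x - g x)) < e"
proof -
  \<comment> \<open>Nearest-point projection onto a ball is a continuous cut-off, so its composition
    with the continuous \<open>u n\<close> is again continuous.\<close>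
  define c where "c M = closest_point (cball 0 (real M) :: 'b set)" for M
  have c_cont: "continuous_on UNIV (c M)" for M
    unfolding c_def by (intro continuous_on_closest_point) auto
  have c_norm: "norm (c M v) \<le> real M" for M v
    using closest_point_in_set[of "cball 0 (real M) :: 'b set" v] by (simp add: c_def)
  have c_self: "c M v = v" if "norm v \<le> real M" for M v
    using that by (simp add: c_def closest_point_self)
  have meas: "f \<in> borel_measurable (lebesgue_on {a..b})"
    using f integrable_imp_measurable set_lebesgue_integral_eq_integral(1) by blast
  have S: "{a..b} \<in> sets lebesgue" by simp
  have cf: "(\<lambda>x. c M (u x)) absolutely_integrable_on {a..b}" if "u \<in> borel_measurable (lebesgue_on {a..b})" for M u
  proof (rule measurable_bounded_by_integrable_imp_absolutely_integrable[OF _ S])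
    show "(\<lambda>x. c M (u x)) \<in> borel_measurable (lebesgue_on {a..b})"
      using measurable_compose[OF that borel_measurable_continuous_onI[OF c_cont]] by simp
    show "(\<lambda>x. real M) integrable_on {a..b}" by auto
  qed (use c_norm in auto)
  have "(\<lambda>M. integral {a..b} (\<lambda>x. norm (f x - c M (f x)))) \<longlonglongrightarrow> integral {a..b} (\<lambda>x. 0::real)"
  proof (rule dominated_convergence)
    show "(\<lambda>x. norm (f x - c M (f x))) integrable_on {a..b}" for M
      using absolutely_integrable_norm[OF set_integral_diff(1)[OF f cf[OF meas, of M]]]
      by (auto simp: o_def dest: set_lebesgue_integral_eq_integral(1))
    show "(\<lambda>x. 2 * norm (f x)) integrable_on {a..b}"
      using absolutely_integrable_norm[OF f]
      by (auto simp: o_def dest: set_lebesgue_integral_eq_integral(1) intro!: integrable_on_mult_right)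
    show "norm (norm (f x - c M (f x))) \<le> 2 * norm (f x)" for M x
    proof (cases "norm (f x) \<le> real M")
      case False
      then show ?thesis using norm_triangle_ineq4[of "f x" "c M (f x)"] c_norm[of M "f x"] by simp
    qed (simp add: c_self)
    show "(\<lambda>M. norm (f x - c M (f x))) \<longlonglongrightarrow> 0" for x
    proof -
      have "\<forall>\<^sub>F M in sequentially. norm (f x - c M (f x)) = 0"
        using eventually_ge_at_top[of "nat \<lceil>norm (f x)\<rceil>"] by eventually_elim (auto simp: c_self nat_ceiling_le_eq)
      then show ?thesis by (rule tendsto_eventually)
    qed
  qed
  then have "\<forall>\<^sub>F M in sequentially. integral {a..b} (\<lambda>x. norm (f x - c M (f x))) < e / 2"
    using \<open>e > 0\<close> by (intro order_tendstoD(2)) auto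
  then obtain M where M: "integral {a..b} (\<lambda>x. norm (f x - c M (f x))) < e / 2"
    by (auto simp: eventually_sequentially)
  have "f measurable_on {a..b}"
    using lebesgue_measurable_imp_measurable_on[of f "{a..b}"] meas S
    by (simp add: measurable_on_iff_borel_measurable)
  then obtain N u where N: "negligible N" and u: "\<And>n. continuous_on UNIV (u n)"
    and conv: "\<And>x. x \<notin> N \<Longrightarrow> (\<lambda>n. u n x) \<longlonglongrightarrow> (if x \<in> {a..b} then f x else 0)"
    unfolding measurable_on_def by blast
  have um: "u n \<in> borel_measurable (lebesgue_on {a..b})" for n
    by (rule continuous_imp_measurable_on_sets_lebesgue[OF continuous_on_subset[OF u]]) auto
  define k where "k n x = (if x \<in> N then 0 else norm (c M (f x) - c M (u n x)))" for n x
  have ci: "(\<lambda>x. norm (c M (f x) - c M (u n x))) integrable_on {a..b}" for n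
    using absolutely_integrable_norm[OF set_integral_diff(1)[OF cf[OF meas] cf[OF um], of M M n]]
    by (auto simp: o_def dest: set_lebesgue_integral_eq_integral(1))
  have "(\<lambda>n. integral {a..b} (k n)) \<longlonglongrightarrow> integral {a..b} (\<lambda>x. 0::real)"
  proof (rule dominated_convergence)
    show "k n integrable_on {a..b}" for n
      by (rule integrable_spike[OF ci[of n] N]) (auto simp: k_def)
    show "(\<lambda>x. 2 * real M) integrable_on {a..b}" by auto
    show "norm (k n x) \<le> 2 * real M" for n x
      using norm_triangle_ineq4[of "c M (f x)" "c M (u n x)"] c_norm[of M "f x"] c_norm[of M "u n x"]
      by (simp add: k_def)
    show "(\<lambda>n. k n x) \<longlonglongrightarrow> 0" if "x \<in> {a..b}" for x
    proof (cases "x \<in> N")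
      case False
      have "(\<lambda>n. c M (u n x)) \<longlonglongrightarrow> c M (f x)"
        using conv[OF False] that continuous_on_tendsto_compose[OF c_cont, of "\<lambda>n. u n x" "f x"] by auto
      then have "(\<lambda>n. norm (c M (f x) - c M (u n x))) \<longlonglongrightarrow> norm (c M (f x) - c M (f x))"
        by (intro tendsto_intros)
      then show ?thesis using False by (simp add: k_def)
    qed (simp add: k_def)
  qed
  then have "\<forall>\<^sub>F n in sequentially. integral {a..b} (k n) < e / 2"
    using \<open>e > 0\<close> by (intro order_tendstoD(2)) auto
  then obtain n where n: "integral {a..b} (k n) < e / 2"
    by (auto simp: eventually_sequentially)
  have "integral {a..b} (\<lambda>x. norm (c M (f x) - c M (u n x))) = integral {a..b} (k n)"
    by (rule integral_spike[OF N]) (auto simp: k_def)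
  moreover have fi: "(\<lambda>x. norm (f x - c M (f x))) integrable_on {a..b}"
    using absolutely_integrable_norm[OF set_integral_diff(1)[OF f cf[OF meas, of M]]]
    by (auto simp: o_def dest: set_lebesgue_integral_eq_integral(1))
  moreover have "integral {a..b} (\<lambda>x. norm (f x - c M (u n x)))
      \<le> integral {a..b} (\<lambda>x. norm (f x - c M (f x)) + norm (c M (f x) - c M (u n x)))"
  proof (rule integral_le)
    show "(\<lambda>x. norm (f x - c M (u n x))) integrable_on {a..b}"
      using absolutely_integrable_norm[OF set_integral_diff(1)[OF f cf[OF um, of M n]]]
      by (auto simp: o_def dest: set_lebesgue_integral_eq_integral(1))
    show "norm (f x - c M (u n x)) \<le> norm (f x - c M (f x)) + norm (c M (f x) - c M (u n x))" for x
      using norm_triangle_ineq[of "f x - c M (f x)" "c M (f x) - c M (u n x)"] by simp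
  qed (intro integrable_add fi ci)
  ultimately have "integral {a..b} (\<lambda>x. norm (f x - c M (u n x))) < e"
    using M n by (simp add: integral_add[OF fi ci])
  moreover have "continuous_on UNIV (\<lambda>x. c M (u n x))"
    using continuous_on_compose2[OF c_cont u] by auto
  ultimately show ?thesis using that by blast
qed

text \<open>In one dimension the boxes without interior are the empty set and the points. The
  hypothesis on \<open>F\<close> covers the points; \<open>F'\<close> resets the value on the empty
  set, which never carries a tag.\<close>

lemma sum_snd_tagged:
  fixes F :: "real set \<Rightarrow> real"
  assumes p: "p tagged_partial_division_of {a..b}" and F: "\<And>x. F {x} = 0"
  shows "(\<Sum>(x,K)\<in>p. F K) = (\<Sum>K\<in>snd ` p. F K)"
proof -
  define F' where "F' K = (if K = {} then 0 else F K)" for K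
  have ne: "K \<noteq> {}" if "(x, K) \<in> p" for x K
    using tagged_partial_division_ofD(2)[OF p that] by auto
  have "(\<Sum>(x,K)\<in>p. F' K) = (\<Sum>K\<in>snd ` p. F' K)"
  proof (rule sum.over_tagged_division_lemma[OF tagged_partial_division_of_Union_self[OF p]])
    show "F' (cbox u v) = 0" if "box u v = {}" for u v :: real
      using that F by (cases "u = v") (auto simp: F'_def)
  qed
  moreover have "(\<Sum>(x,K)\<in>p. F' K) = (\<Sum>(x,K)\<in>p. F K)"
    using ne by (intro sum.cong) (auto simp: F'_def)
  moreover have "(\<Sum>K\<in>snd ` p. F' K) = (\<Sum>K\<in>snd ` p. F K)"
    using ne by (intro sum.cong) (auto simp: F'_def)
  ultimately show ?thesis by simp
qed

text \<open>A gauge argument with two shares of \<open>e / 2 * (b - a)\<close>. At tags outside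
  \<open>N\<close> differentiability controls the error; intervals tagged in \<open>N\<close> lie in
  an open set of small measure, and absolute continuity bounds the increments of \<open>f\<close>
  over them.\<close>

lemma abs_continuous_has_integral:
  fixes f :: "real \<Rightarrow> 'a::euclidean_space"
  assumes ab: "a \<le> b" and ac: "abs_continuous_on {a..b} f" and N: "negligible N"
    and der: "\<And>x. x \<in> {a..b} - N \<Longrightarrow> (f has_vector_derivative g x) (at x within {a..b})"
  shows "(g has_integral (f b - f a)) {a..b}"
proof -
  \<comment> \<open>With value 0 on \<open>N\<close>, an interval tagged there contributes nothing
    but the increment of \<open>f\<close>.\<close>
  define g' where "g' x = (if x \<in> N then 0 else g x)" for x
  have "(g' has_integral (f b - f a)) {a..b}"
  proof (cases "a = b")
    case False
    then have ab: "a < b" using ab by simp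
    show ?thesis unfolding has_integral_factor_content_real
    proof (intro allI impI)
      fix e :: real assume e: "e > 0"
      have "e / 2 * (b - a) > 0" using e ab by simp
      then obtain \<delta> where \<delta>: "\<delta> > 0" "\<And>D T. D division_of T \<Longrightarrow> T \<subseteq> {a..b} \<Longrightarrow> (\<Sum>K\<in>D. measure lborel K) < \<delta> \<Longrightarrow>
          (\<Sum>K\<in>D. norm (f (Sup K) - f (Inf K))) < e / 2 * (b - a)"
        using ac unfolding abs_continuous_on_def by meson
      have "N \<in> lmeasurable" "measure lebesgue N = 0"
        using N by (auto simp: negligible_iff_measure)
      then obtain U where U: "open U" "N \<subseteq> U" "U - N \<in> lmeasurable" "emeasure lebesgue (U - N) < ennreal \<delta>"
        using sets_lebesgue_outer_open[of N \<delta>] \<delta>(1) by (auto simp: fmeasurableD)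
      have "(U - N) \<union> N = U" using U(2) by auto
      then have "U \<in> lmeasurable" "measure lebesgue U < \<delta>"
        using fmeasurable.Un[OF U(3) \<open>N \<in> lmeasurable\<close>] measure_Un_le[of "U - N" lebesgue N]
          \<open>measure lebesgue N = 0\<close> \<open>N \<in> lmeasurable\<close> U(3,4) \<delta>(1)
        by (auto simp: emeasure_eq_measure2 fmeasurableD ennreal_less_iff)
      note U = U(1,2) this
      have "\<exists>r>0. (x \<in> N \<longrightarrow> ball x r \<subseteq> U) \<and> (x \<in> {a..b} - N \<longrightarrow> (\<forall>y\<in>{a..b}. \<bar>y - x\<bar> < r \<longrightarrow>
          norm (f y - f x - (y - x) *\<^sub>R g x) \<le> e / 2 * \<bar>y - x\<bar>))" for x
      proof (cases "x \<in> {a..b} - N")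
        case True
        then have "(f has_derivative (\<lambda>h. h *\<^sub>R g x)) (at x within {a..b})"
          using der by (simp add: has_vector_derivative_def)
        then obtain d where "d > 0" "\<forall>y\<in>{a..b}. norm (y - x) < d \<longrightarrow>
            norm (f y - f x - (y - x) *\<^sub>R g x) \<le> e / 2 * norm (y - x)"
          using half_gt_zero[OF e] unfolding has_derivative_within_alt by blast
        then show ?thesis using True by (intro exI[of _ d]) simp
      next
        case False
        then show ?thesis using U by (cases "x \<in> N") (auto simp: open_contains_ball subset_iff intro: exI[of _ 1])
      qed
      then obtain r where r: "\<And>x. r x > 0" "\<And>x. x \<in> N \<Longrightarrow> ball x (r x) \<subseteq> U"
        "\<And>x y. x \<in> {a..b} - N \<Longrightarrow> y \<in> {a..b} \<Longrightarrow> \<bar>y - x\<bar> < r x \<Longrightarrow> norm (f y - f x - (y - x) *\<^sub>R g x) \<le> e / 2 * \<bar>y - x\<bar>"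
        by metis
      show "\<exists>d. gauge d \<and> (\<forall>p. p tagged_division_of {a..b} \<and> d fine p \<longrightarrow>
          norm ((\<Sum>(x, k)\<in>p. measure lborel k *\<^sub>R g' x) - (f b - f a)) \<le> e * measure lborel {a..b})"
      proof (intro exI[of _ "\<lambda>x. ball x (r x)"] conjI allI impI)
        show "gauge (\<lambda>x. ball x (r x))" using r(1) by (auto simp: gauge_def)
        fix p assume "p tagged_division_of {a..b} \<and> (\<lambda>x. ball x (r x)) fine p"
        then have p: "p tagged_division_of {a..b}" and fine: "(\<lambda>x. ball x (r x)) fine p" by auto
        have finp: "finite p" using p by auto
        define A where "A = {(x, K) \<in> p. x \<in> N}"
        have AK: "A \<subseteq> p" by (auto simp: A_def)
        have pK: "\<exists>u v. K = {u..v} \<and> u \<le> x \<and> x \<le> v \<and> a \<le> u \<and> v \<le> b \<and> {u..v} \<subseteq> ball x (r x)" if xK: "(x, K) \<in> p" for x K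
        proof -
          obtain u v where "K = cbox u v" using tagged_division_ofD(4)[OF p xK] by blast
          then show ?thesis
            using tagged_division_ofD(2,3)[OF p xK] fineD[OF fine xK] by auto
        qed
        have eq: "(\<Sum>(x, K)\<in>p. measure lborel K *\<^sub>R g' x) - (f b - f a) =
            (\<Sum>(x, K)\<in>p. measure lborel K *\<^sub>R g' x - (f (Sup K) - f (Inf K)))"
          using additive_tagged_division_1[OF less_imp_le[OF ab] p, of f]
          by (simp add: sum_subtractf split_beta)
        have "norm (\<Sum>(x, K)\<in>p - A. measure lborel K *\<^sub>R g' x - (f (Sup K) - f (Inf K))) \<le> (\<Sum>(x, K)\<in>p - A. e / 2 * measure lborel K)"
        proof (rule sum_norm_le, clarify)
          fix x K assume xK: "(x, K) \<in> p" "(x, K) \<notin> A"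
          then have xN: "x \<notin> N" by (auto simp: A_def)
          obtain u v where K: "K = {u..v}" "u \<le> x" "x \<le> v" "a \<le> u" "v \<le> b" "{u..v} \<subseteq> ball x (r x)"
            using pK[OF xK(1)] by blast
          have "\<bar>u - x\<bar> < r x" "\<bar>v - x\<bar> < r x"
            using K(6)[THEN subsetD, of u] K(6)[THEN subsetD, of v] K(2,3)
            by (auto simp: dist_real_def abs_minus_commute)
          then have 1: "norm (f u - f x - (u - x) *\<^sub>R g x) \<le> e / 2 * \<bar>u - x\<bar>"
            "norm (f v - f x - (v - x) *\<^sub>R g x) \<le> e / 2 * \<bar>v - x\<bar>"
            using r(3)[of x u] r(3)[of x v] K xN by auto
          \<comment> \<open>Both end points are compared with the tag; since it lies between them,
            the two errors add up to a multiple of the length of \<open>K\<close>.\<close>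
          have "measure lborel K *\<^sub>R g' x - (f (Sup K) - f (Inf K)) =
             (f u - f x - (u - x) *\<^sub>R g x) - (f v - f x - (v - x) *\<^sub>R g x)"
            using K xN by (simp add: g'_def algebra_simps)
          also have "norm \<dots> \<le> e / 2 * \<bar>u - x\<bar> + e / 2 * \<bar>v - x\<bar>"
            using norm_triangle_ineq4 1 by (smt (verit))
          also have "\<dots> = e / 2 * measure lborel K" using K by (simp add: field_simps)
          finally show "norm (measure lborel K *\<^sub>R g' x - (f (Sup K) - f (Inf K))) \<le> e / 2 * measure lborel K" .
        qed
        also have "\<dots> \<le> (\<Sum>(x, K)\<in>p. e / 2 * measure lborel K)"
          using finp e by (intro sum_mono2) auto
        also have "\<dots> = e / 2 * (\<Sum>(x, K)\<in>p. measure lborel K)"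
          by (simp add: sum_distrib_left split_beta)
        also have "(\<Sum>(x, K)\<in>p. measure lborel K) = b - a"
          using additive_content_tagged_division[of p a b] p ab by simp
        finally have 1: "norm (\<Sum>(x, K)\<in>p - A. measure lborel K *\<^sub>R g' x - (f (Sup K) - f (Inf K))) \<le> e / 2 * (b - a)" .
        have Apart: "A tagged_partial_division_of {a..b}"
          using tagged_partial_division_subset[OF _ AK] p by (auto simp: tagged_division_of_def)
        have D: "snd ` A division_of \<Union>(snd ` A)"
          using division_of_tagged_division[OF tagged_partial_division_of_Union_self[OF Apart]] .
        have DU: "\<Union>(snd ` A) \<subseteq> U" "\<Union>(snd ` A) \<subseteq> {a..b}"
          using pK r(2) unfolding A_def by fastforce+
        have "(\<Sum>K\<in>snd ` A. measure lborel K) = (\<Sum>K\<in>snd ` A. measure lebesgue K)"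
        proof (intro sum.cong refl)
          fix K assume "K \<in> snd ` A"
          then obtain u v where "K = cbox u v" using division_ofD(4)[OF D] by blast
          then show "measure lborel K = measure lebesgue K" by (simp add: measure_completion)
        qed
        also have "\<dots> = measure lebesgue (\<Union>(snd ` A))" by (rule content_division[OF D])
        also have "\<dots> \<le> measure lebesgue U"
          using DU(1) U(3) D by (intro measure_mono_fmeasurable) (auto intro: lmeasurable_division fmeasurableD)
        finally have "(\<Sum>K\<in>snd ` A. norm (f (Sup K) - f (Inf K))) < e / 2 * (b - a)"
          using \<delta>(2)[OF D DU(2)] U(4) by simp
        moreover have "(\<Sum>(x, K)\<in>A. norm (f (Sup K) - f (Inf K))) = (\<Sum>K\<in>snd ` A. norm (f (Sup K) - f (Inf K)))"
          by (rule sum_snd_tagged[OF Apart]) simp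
        moreover have "norm (\<Sum>(x, K)\<in>A. measure lborel K *\<^sub>R g' x - (f (Sup K) - f (Inf K))) \<le> (\<Sum>(x, K)\<in>A. norm (f (Sup K) - f (Inf K)))"
          by (rule sum_norm_le) (auto simp: A_def g'_def norm_minus_commute)
        moreover have "(\<Sum>(x, K)\<in>p. measure lborel K *\<^sub>R g' x - (f (Sup K) - f (Inf K))) =
            (\<Sum>(x, K)\<in>p - A. measure lborel K *\<^sub>R g' x - (f (Sup K) - f (Inf K))) + (\<Sum>(x, K)\<in>A. measure lborel K *\<^sub>R g' x - (f (Sup K) - f (Inf K)))"
          by (rule sum.subset_diff[OF AK finp])
        ultimately show "norm ((\<Sum>(x, k)\<in>p. measure lborel k *\<^sub>R g' x) - (f b - f a)) \<le> e * measure lborel {a..b}"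
          unfolding eq using 1 ab by (simp add: field_simps) (smt (verit) norm_triangle_ineq)
      qed
    qed
  qed (use has_integral_refl(2) in auto)
  then show ?thesis
    by (rule has_integral_spike[OF N, rotated]) (auto simp: g'_def)
qed

section \<open>Closure properties of absolute continuity\<close>

lemma division_interval_cases:
  assumes "D division_of T" "T \<subseteq> {a..b}" "K \<in> D"
  obtains u v :: real where "K = {u..v}" "a \<le> u" "u \<le> v" "v \<le> b"
proof -
  obtain u v where K: "K = cbox u v" using division_ofD(4)[OF assms(1,3)] by blast
  have "K \<noteq> {}" "K \<subseteq> {a..b}" using division_ofD(2,3)[OF assms(1,3)] assms(2) by auto
  then show ?thesis using that[of u v] unfolding K by (simp add: atLeastatMost_subset_iff)
qed

text \<open>A single increment estimate from which sums, differences, products, conjugates and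
  Lipschitz functions are all obtained.\<close>

lemma abs_continuous_on_dominated:
  fixes f :: "real \<Rightarrow> 'a::real_normed_vector" and g :: "real \<Rightarrow> 'b::real_normed_vector"
    and h :: "real \<Rightarrow> 'c::real_normed_vector"
  assumes f: "abs_continuous_on {a..b} f" and g: "abs_continuous_on {a..b} g" and "0 \<le> C"
    and le: "\<And>u v. a \<le> u \<Longrightarrow> u \<le> v \<Longrightarrow> v \<le> b \<Longrightarrow> norm (h v - h u) \<le> C * (norm (f v - f u) + norm (g v - g u))"
  shows "abs_continuous_on {a..b} h"
  unfolding abs_continuous_on_def
proof (intro allI impI)
  fix e :: real assume "e > 0"
  \<comment> \<open>\<open>C + 1\<close> keeps the divisor positive when \<open>C = 0\<close>; the 2
    divides the allowance between \<open>f\<close> and \<open>g\<close>.\<close>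
  define e' where "e' = e / (C + 1) / 2"
  have e': "e' > 0" using \<open>e > 0\<close> \<open>0 \<le> C\<close> by (simp add: e'_def)
  obtain d1 where d1: "d1 > 0" "\<And>D T. D division_of T \<Longrightarrow> T \<subseteq> {a..b} \<Longrightarrow> (\<Sum>K\<in>D. measure lborel K) < d1 \<Longrightarrow>
      (\<Sum>K\<in>D. norm (f (Sup K) - f (Inf K))) < e'"
    using f e' unfolding abs_continuous_on_def by meson
  obtain d2 where d2: "d2 > 0" "\<And>D T. D division_of T \<Longrightarrow> T \<subseteq> {a..b} \<Longrightarrow> (\<Sum>K\<in>D. measure lborel K) < d2 \<Longrightarrow>
      (\<Sum>K\<in>D. norm (g (Sup K) - g (Inf K))) < e'"
    using g e' unfolding abs_continuous_on_def by meson
  have "(\<Sum>K\<in>D. norm (h (Sup K) - h (Inf K))) < e"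
    if D: "D division_of T" "T \<subseteq> {a..b}" and small: "(\<Sum>K\<in>D. measure lborel K) < min d1 d2" for D T
  proof -
    have "(\<Sum>K\<in>D. norm (h (Sup K) - h (Inf K))) \<le>
        (\<Sum>K\<in>D. C * (norm (f (Sup K) - f (Inf K)) + norm (g (Sup K) - g (Inf K))))"
    proof (rule sum_mono)
      fix K assume "K \<in> D"
      then obtain u v where "K = {u..v}" "a \<le> u" "u \<le> v" "v \<le> b"
        using division_interval_cases[OF D] by metis
      then show "norm (h (Sup K) - h (Inf K)) \<le> C * (norm (f (Sup K) - f (Inf K)) + norm (g (Sup K) - g (Inf K)))"
        using le by simp
    qed
    also have "\<dots> = C * ((\<Sum>K\<in>D. norm (f (Sup K) - f (Inf K))) + (\<Sum>K\<in>D. norm (g (Sup K) - g (Inf K))))"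
      by (simp add: sum_distrib_left sum.distrib distrib_left)
    also have "\<dots> \<le> C * (e' + e')"
      using d1(2)[OF D] d2(2)[OF D] small \<open>0 \<le> C\<close> by (intro mult_left_mono add_mono) auto
    also have "\<dots> < (C + 1) * (e' + e')" using e' by (intro mult_strict_right_mono) auto
    also have "\<dots> = e" unfolding e'_def field_sum_of_halves using \<open>0 \<le> C\<close> by simp
    finally show ?thesis .
  qed
  then show "\<exists>\<delta>>0. \<forall>D T. D division_of T \<and> T \<subseteq> {a..b} \<and> (\<Sum>K\<in>D. measure lborel K) < \<delta> \<longrightarrow>
      (\<Sum>K\<in>D. norm (h (Sup K) - h (Inf K))) < e"
    using d1(1) d2(1) by (intro exI[of _ "min d1 d2"]) auto
qed

lemma abs_continuous_on_ident: "abs_continuous_on {a..b} (\<lambda>x. x)"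
  unfolding abs_continuous_on_def
proof (intro allI impI)
  fix e :: real assume e: "e > 0"
  have "(\<Sum>K\<in>D. norm (Sup K - Inf K)) < e"
    if D: "D division_of T" "T \<subseteq> {a..b}" and small: "(\<Sum>K\<in>D. measure lborel K) < e" for D T
  proof -
    have "(\<Sum>K\<in>D. norm (Sup K - Inf K)) = (\<Sum>K\<in>D. measure lborel K)"
    proof (rule sum.cong[OF refl])
      fix K assume "K \<in> D"
      then obtain u v where "K = {u..v}" "a \<le> u" "u \<le> v" "v \<le> b"
        using division_interval_cases[OF D] by metis
      then show "norm (Sup K - Inf K) = measure lborel K" by simp
    qed
    then show ?thesis using small by simp
  qed
  then show "\<exists>\<delta>>0. \<forall>D T. D division_of T \<and> T \<subseteq> {a..b} \<and> (\<Sum>K\<in>D. measure lborel K) < \<delta> \<longrightarrow>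
      (\<Sum>K\<in>D. norm (Sup K - Inf K)) < e"
    using e by blast
qed

lemma abs_continuous_on_lipschitz:
  assumes "0 \<le> C" "\<And>u v. a \<le> u \<Longrightarrow> u \<le> v \<Longrightarrow> v \<le> b \<Longrightarrow> norm (h v - h u) \<le> C * (v - u)"
  shows "abs_continuous_on {a..b} h"
proof (rule abs_continuous_on_dominated[OF abs_continuous_on_ident abs_continuous_on_ident assms(1)])
  fix u v assume "a \<le> u" "u \<le> v" "v \<le> b"
  then show "norm (h v - h u) \<le> C * (norm (v - u) + norm (v - u))"
    using assms(2)[of u v] mult_nonneg_nonneg[OF assms(1), of "v - u"] by (simp add: algebra_simps)
qed

lemma abs_continuous_on_imp_continuous_on:
  fixes f :: "real \<Rightarrow> 'a::real_normed_vector"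
  assumes "abs_continuous_on {a..b} f"
  shows "continuous_on {a..b} f"
  unfolding continuous_on_iff
proof (intro ballI allI impI)
  fix x e :: real assume x: "x \<in> {a..b}" and e: "e > 0"
  obtain d where d: "d > 0" "\<And>D T. D division_of T \<Longrightarrow> T \<subseteq> {a..b} \<Longrightarrow> (\<Sum>K\<in>D. measure lborel K) < d \<Longrightarrow>
      (\<Sum>K\<in>D. norm (f (Sup K) - f (Inf K))) < e"
    using assms e unfolding abs_continuous_on_def by meson
  have *: "norm (f v - f u) < e" if "a \<le> u" "u \<le> v" "v \<le> b" "v - u < d" for u v
    using d(2)[of "{{u..v}}" "{u..v}"] division_of_self[of u v] that by auto
  have "dist (f y) (f x) < e" if "y \<in> {a..b}" "dist y x < d" for y
    using *[of x y] *[of y x] that x by (cases "x \<le> y") (auto simp: dist_norm norm_minus_commute)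
  then show "\<exists>d>0. \<forall>y\<in>{a..b}. dist y x < d \<longrightarrow> dist (f y) (f x) < e"
    using d(1) by blast
qed

lemma continuous_on_bounded_interval:
  fixes f :: "real \<Rightarrow> 'a::real_normed_vector"
  assumes "continuous_on {a..b} f"
  obtains B where "0 < B" "\<And>x. x \<in> {a..b} \<Longrightarrow> norm (f x) \<le> B"
  using compact_imp_bounded[OF compact_continuous_image[OF assms compact_Icc]]
  unfolding bounded_pos by (metis imageI)

lemma abs_continuous_on_mult:
  fixes f g :: "real \<Rightarrow> 'a::real_normed_algebra"
  assumes f: "abs_continuous_on {a..b} f" and g: "abs_continuous_on {a..b} g"
  shows "abs_continuous_on {a..b} (\<lambda>x. f x * g x)"
proof -
  obtain A where A: "0 < A" "\<And>x. x \<in> {a..b} \<Longrightarrow> norm (f x) \<le> A"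
    using continuous_on_bounded_interval[OF abs_continuous_on_imp_continuous_on[OF f]] by blast
  obtain B where B: "0 < B" "\<And>x. x \<in> {a..b} \<Longrightarrow> norm (g x) \<le> B"
    using continuous_on_bounded_interval[OF abs_continuous_on_imp_continuous_on[OF g]] by blast
  show ?thesis
  proof (rule abs_continuous_on_dominated[OF f g, of "A + B"])
    fix u v assume uv: "a \<le> u" "u \<le> v" "v \<le> b"
    have "f v * g v - f u * g u = f v * (g v - g u) + (f v - f u) * g u" by (simp add: algebra_simps)
    also have "norm \<dots> \<le> norm (f v) * norm (g v - g u) + norm (f v - f u) * norm (g u)"
      by (intro norm_triangle_le add_mono norm_mult_ineq)
    also have "\<dots> \<le> (A + B) * norm (g v - g u) + norm (f v - f u) * (A + B)"
      using A(1) A(2)[of v] B(1) B(2)[of u] uv by (intro add_mono mult_mono) auto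
    finally show "norm (f v * g v - f u * g u) \<le> (A + B) * (norm (f v - f u) + norm (g v - g u))"
      by (simp add: algebra_simps)
  qed (use A B in auto)
qed

lemma abs_continuous_on_add:
  fixes f g :: "real \<Rightarrow> 'a::real_normed_vector"
  assumes "abs_continuous_on {a..b} f" "abs_continuous_on {a..b} g"
  shows "abs_continuous_on {a..b} (\<lambda>x. f x + g x)"
proof (rule abs_continuous_on_dominated[OF assms, of 1])
  show "norm (f v + g v - (f u + g u)) \<le> 1 * (norm (f v - f u) + norm (g v - g u))" for u v
    using norm_triangle_ineq[of "f v - f u" "g v - g u"] by (simp add: algebra_simps)
qed auto

lemma abs_continuous_on_diff:
  fixes f g :: "real \<Rightarrow> 'a::real_normed_vector"
  assumes "abs_continuous_on {a..b} f" "abs_continuous_on {a..b} g"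
  shows "abs_continuous_on {a..b} (\<lambda>x. f x - g x)"
proof (rule abs_continuous_on_dominated[OF assms, of 1])
  show "norm (f v - g v - (f u - g u)) \<le> 1 * (norm (f v - f u) + norm (g v - g u))" for u v
    using norm_triangle_ineq4[of "f v - f u" "g v - g u"] by (simp add: algebra_simps)
qed auto

lemma abs_continuous_on_cong:
  assumes "\<And>x. x \<in> {a..b} \<Longrightarrow> f x = g x"
  shows "abs_continuous_on {a..b} f \<longleftrightarrow> abs_continuous_on {a..b} g"
proof -
  have *: "(\<Sum>K\<in>D. norm (f (Sup K) - f (Inf K))) = (\<Sum>K\<in>D. norm (g (Sup K) - g (Inf K)))"
    if D: "D division_of T" "T \<subseteq> {a..b}" for D T
  proof (rule sum.cong[OF refl])
    fix K assume "K \<in> D"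
    then obtain u v where "K = {u..v}" "a \<le> u" "u \<le> v" "v \<le> b"
      using division_interval_cases[OF D] by metis
    then show "norm (f (Sup K) - f (Inf K)) = norm (g (Sup K) - g (Inf K))"
      using assms by simp
  qed
  show ?thesis unfolding abs_continuous_on_def using * by (metis (no_types, lifting))
qed

section \<open>Indefinite integrals and their derivatives\<close>

lemma absolutely_integrable_mult_continuous:
  fixes p f :: "real \<Rightarrow> complex"
  assumes "p absolutely_integrable_on {a..b}" "continuous_on {a..b} f"
  shows "(\<lambda>x. p x * f x) absolutely_integrable_on {a..b}"
proof -
  have "(\<lambda>x. f x * p x) absolutely_integrable_on {a..b}"
  proof (rule absolutely_integrable_bounded_measurable_product[where h = "(*)", OF _ _ _ _ assms(1)])
    show "bilinear ((*) :: complex \<Rightarrow> complex \<Rightarrow> complex)" by (simp add: bilinear_times)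
    show "f \<in> borel_measurable (lebesgue_on {a..b})"
      by (intro continuous_imp_measurable_on_sets_lebesgue assms) auto
    show "bounded (f ` {a..b})"
      using assms(2) compact_Icc compact_continuous_image compact_imp_bounded by blast
  qed auto
  then show ?thesis by (simp add: mult.commute)
qed

lemma absolutely_integrable_of_real:
  fixes p :: "real \<Rightarrow> real"
  assumes "p absolutely_integrable_on S"
  shows "(\<lambda>x. complex_of_real (p x)) absolutely_integrable_on S"
  using absolutely_integrable_linear[OF assms bounded_linear_of_real] by (simp add: o_def)

text \<open>Up to an error below \<open>e / 2\<close> in mean, the integrand is a function bounded
  by \<open>M\<close>. The error is that small over every set, and the integral of the bounded part
  is at most \<open>M\<close> times the measure.\<close>

lemma abs_continuous_on_integral:
  fixes g :: "real \<Rightarrow> 'b::euclidean_space"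
  assumes g: "g absolutely_integrable_on {a..b}"
  shows "abs_continuous_on {a..b} (\<lambda>x. integral {a..x} g)"
  unfolding abs_continuous_on_def
proof (intro allI impI)
  fix e :: real assume e: "e > 0"
  obtain c where c: "continuous_on UNIV c" "integral {a..b} (\<lambda>x. norm (g x - c x)) < e / 2"
    using absolutely_integrable_continuous_approx[OF g, of "e / 2"] e by auto
  obtain M where M: "0 < M" "\<And>x. x \<in> {a..b} \<Longrightarrow> norm (c x) \<le> M"
    using continuous_on_bounded_interval[OF continuous_on_subset[OF c(1) subset_UNIV]] by blast
  have gi: "g integrable_on {a..b}" using g set_lebesgue_integral_eq_integral(1) by blast
  have "(\<lambda>x. g x - c x) absolutely_integrable_on {a..b}"
    by (intro set_integral_diff(1) g absolutely_integrable_continuous_real continuous_on_subset[OF c(1)]) auto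
  then have ni: "(\<lambda>x. norm (g x - c x)) integrable_on {a..b}"
    unfolding absolutely_integrable_on_def by simp
  have "(\<Sum>K\<in>D. norm (integral {a..Sup K} g - integral {a..Inf K} g)) < e"
    if D: "D division_of T" "T \<subseteq> {a..b}" and small: "(\<Sum>K\<in>D. measure lborel K) < e / (2 * M)" for D T
  proof -
    have "(\<Sum>K\<in>D. norm (integral {a..Sup K} g - integral {a..Inf K} g)) \<le>
        (\<Sum>K\<in>D. integral K (\<lambda>x. norm (g x - c x)) + M * measure lborel K)"
    proof (rule sum_mono)
      fix K assume "K \<in> D"
      then obtain u v where K: "K = {u..v}" "a \<le> u" "u \<le> v" "v \<le> b"
        using division_interval_cases[OF D] by metis
      have sub: "{u..v} \<subseteq> {a..b}" using K by auto
      have "integral {a..u} g + integral {u..v} g = integral {a..v} g"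
        using K by (intro Henstock_Kurzweil_Integration.integral_combine integrable_on_subinterval[OF gi]) auto
      then have "integral {a..v} g - integral {a..u} g = integral {u..v} g"
        by (metis add_diff_cancel_left')
      then have "norm (integral {a..Sup K} g - integral {a..Inf K} g) = norm (integral {u..v} g)"
        using K by simp
      also have "\<dots> \<le> integral {u..v} (\<lambda>x. norm (g x - c x) + M)"
      proof (rule integral_norm_bound_integral)
        show "g integrable_on {u..v}" by (rule integrable_on_subinterval[OF gi sub])
        show "(\<lambda>x. norm (g x - c x) + M) integrable_on {u..v}"
          by (intro integrable_add integrable_on_subinterval[OF ni sub]) auto
        show "norm (g x) \<le> norm (g x - c x) + M" if "x \<in> {u..v}" for x
          using norm_triangle_sub[of "g x" "c x"] M(2)[of x] that sub by auto
      qed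
      also have "\<dots> = integral K (\<lambda>x. norm (g x - c x)) + M * measure lborel K"
        using K by (subst integral_add[OF integrable_on_subinterval[OF ni sub]]) auto
      finally show "norm (integral {a..Sup K} g - integral {a..Inf K} g) \<le>
          integral K (\<lambda>x. norm (g x - c x)) + M * measure lborel K" .
    qed
    also have "\<dots> = (\<Sum>K\<in>D. integral K (\<lambda>x. norm (g x - c x))) + M * (\<Sum>K\<in>D. measure lborel K)"
      by (simp add: sum.distrib sum_distrib_left)
    also have "(\<Sum>K\<in>D. integral K (\<lambda>x. norm (g x - c x))) = integral T (\<lambda>x. norm (g x - c x))"
      by (rule integral_combine_division_topdown[symmetric, OF integrable_on_subdivision[OF D(1) ni D(2)] D(1)])
    also have "\<dots> \<le> integral {a..b} (\<lambda>x. norm (g x - c x))"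
      by (intro integral_subset_le integrable_on_subdivision[OF D(1) ni D(2)] ni D(2)) auto
    also have "\<dots> + M * (\<Sum>K\<in>D. measure lborel K) < e / 2 + M * (e / (2 * M))"
      using c(2) small M(1) by (intro add_strict_mono mult_strict_left_mono) auto
    also have "\<dots> = e" using M(1) by simp
    finally show ?thesis by simp
  qed
  moreover have "e / (2 * M) > 0" using e M(1) by simp
  ultimately show "\<exists>\<delta>>0. \<forall>D T. D division_of T \<and> T \<subseteq> {a..b} \<and> (\<Sum>K\<in>D. measure lborel K) < \<delta> \<longrightarrow>
      (\<Sum>K\<in>D. norm (integral {a..Sup K} g - integral {a..Inf K} g)) < e"
    by blast
qed

text \<open>Convergence of the averages over \<open>{x..x + h}\<close> yields right difference
  quotients only. Applied to the reflected function it yields the left ones, and the second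
  exceptional set is reflected back into \<open>N\<close>.\<close>

lemma integral_has_vector_derivative_ae:
  fixes g :: "real \<Rightarrow> 'b::euclidean_space"
  assumes gi: "g integrable_on {a..b}"
  obtains N where "negligible N"
    "\<And>x. x \<in> {a..b} - N \<Longrightarrow> ((\<lambda>x. integral {a..x} g) has_vector_derivative g x) (at x within {a..b})"
proof -
  \<comment> \<open>Extension by zero gives meaning to the averages also where
    \<open>{x..x + h}\<close> leaves \<open>{a..b}\<close>.\<close>
  define G where "G x = (if x \<in> {a..b} then g x else 0)" for x
  have "G integrable_on UNIV" unfolding G_def using gi by (subst integrable_restrict_UNIV)
  then have G: "G integrable_on cbox u v" for u v by (rule integrable_on_subcbox) auto
  have G': "(\<lambda>x. G (- x)) integrable_on cbox u v" for u v
    using Henstock_Kurzweil_Integration.integrable_reflect_real[where f = G and a = "-v" and b = "-u"] G[of "-v" "-u"] by simp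
  obtain N1 where N1: "negligible N1" "\<And>x e. x \<notin> N1 \<Longrightarrow> 0 < e \<Longrightarrow>
      \<exists>d>0. \<forall>h. 0 < h \<and> h < d \<longrightarrow> norm (integral (cbox x (x + h *\<^sub>R One)) G /\<^sub>R h ^ DIM(real) - G x) < e"
    using integrable_ccontinuous_explicit[of G] G by blast
  obtain N2 where N2: "negligible N2" "\<And>x e. x \<notin> N2 \<Longrightarrow> 0 < e \<Longrightarrow>
      \<exists>d>0. \<forall>h. 0 < h \<and> h < d \<longrightarrow>
        norm (integral (cbox x (x + h *\<^sub>R One)) (\<lambda>x. G (- x)) /\<^sub>R h ^ DIM(real) - G (- x)) < e"
    using integrable_ccontinuous_explicit[of "\<lambda>x. G (- x)"] G' by blast
  define N where "N = N1 \<union> uminus ` N2"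
  have "negligible N"
    unfolding N_def using N1(1) N2(1)
    by (intro negligible_Un negligible_differentiable_image_negligible) (auto intro!: derivative_intros)
  moreover have "((\<lambda>x. integral {a..x} g) has_vector_derivative g x) (at x within {a..b})" if x: "x \<in> {a..b} - N" for x
    unfolding has_vector_derivative_def has_derivative_within_alt
  proof (intro conjI allI impI)
    show "bounded_linear (\<lambda>h. h *\<^sub>R g x)" by (rule bounded_linear_scaleR_left)
    fix e :: real assume e: "e > 0"
    have "x \<notin> N1" "- x \<notin> N2" using x by (auto simp: N_def image_iff)
    then obtain d1 d2 where d1: "d1 > 0" "\<And>h. 0 < h \<Longrightarrow> h < d1 \<Longrightarrow> norm (integral {x..x + h} G /\<^sub>R h - G x) < e"
      and d2: "d2 > 0" "\<And>h. 0 < h \<Longrightarrow> h < d2 \<Longrightarrow> norm (integral {-x..-x + h} (\<lambda>x. G (- x)) /\<^sub>R h - G x) < e"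
      using N1(2)[of x e] N2(2)[of "- x" e] e by auto
    have Gg: "integral {u..v} G = integral {u..v} g" if "a \<le> u" "v \<le> b" for u v
      using that by (intro integral_cong) (auto simp: G_def)
    have comb: "integral {a..v} g - integral {a..u} g = integral {u..v} g" if "a \<le> u" "u \<le> v" "v \<le> b" for u v
      using Henstock_Kurzweil_Integration.integral_combine[OF that(1,2) integrable_on_subinterval[OF gi, of a v]] that by (simp add: algebra_simps)
    have scale: "norm (I - h *\<^sub>R z) \<le> e * h" if "norm (I /\<^sub>R h - z) < e" "h > 0" for I z :: 'b and h
    proof -
      have "I - h *\<^sub>R z = h *\<^sub>R (I /\<^sub>R h - z)" using that by (simp add: scaleR_diff_right)
      then have "norm (I - h *\<^sub>R z) = h * norm (I /\<^sub>R h - z)" using that(2) by simp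
      then show ?thesis using that by (simp add: mult.commute)
    qed
    have "norm (integral {a..y} g - integral {a..x} g - (y - x) *\<^sub>R g x) \<le> e * norm (y - x)"
      if y: "y \<in> {a..b}" "norm (y - x) < min d1 d2" for y
    proof (cases x y rule: linorder_cases)
      case less
      then show ?thesis
        using scale[OF d1(2), of "y - x"] y x comb[of x y] Gg[of x y] by (auto simp: G_def)
    next
      case greater
      have "integral {-x..-x + (x - y)} (\<lambda>x. G (- x)) = integral {y..x} G"
        using integral_reflect_real[where f = G and a = y and b = x] by simp
      then have "norm (integral {y..x} g - (x - y) *\<^sub>R g x) \<le> e * (x - y)"
        using scale[OF d2(2), of "x - y"] y x greater Gg[of y x] by (auto simp: G_def)
      moreover have "integral {a..y} g - integral {a..x} g - (y - x) *\<^sub>R g x = - (integral {y..x} g - (x - y) *\<^sub>R g x)"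
        using comb[of y x] greater x y by (simp add: algebra_simps)
      ultimately show ?thesis using greater by (simp only: norm_minus_cancel) simp
    qed simp
    then show "\<exists>d>0. \<forall>y\<in>{a..b}. norm (y - x) < d \<longrightarrow>
        norm (integral {a..y} g - integral {a..x} g - (y - x) *\<^sub>R g x) \<le> e * norm (y - x)"
      using d1(1) d2(1) by (intro exI[of _ "min d1 d2"]) auto
  qed
  ultimately show ?thesis using that by blast
qed

section \<open>Rapidly oscillating integrals\<close>

lemma has_vector_derivative_cis_mult:
  "((\<lambda>x. cis (w * x)) has_vector_derivative \<i> * of_real w * cis (w * x)) (at x within S)"
  unfolding has_vector_derivative_complex_iff by (auto intro!: derivative_eq_intros)

text \<open>Three errors of \<open>e / 3\<close>: the integrable function is replaced by a
  continuous one, this by a polynomial, and the polynomial is integrated by parts, which gains a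
  factor \<open>1 / w k\<close>.\<close>

lemma riemann_lebesgue:
  fixes p :: "real \<Rightarrow> complex"
  assumes p: "p absolutely_integrable_on {0..1}" and w: "filterlim w at_top F"
  shows "((\<lambda>k. integral {0..1} (\<lambda>x. p x * cis (w k * x))) \<longlongrightarrow> 0) F"
proof (rule tendstoI)
  fix e :: real assume e: "e > 0"
  obtain c where c: "continuous_on UNIV c" "integral {0..1} (\<lambda>x. norm (p x - c x)) < e / 3"
    using absolutely_integrable_continuous_approx[OF p, of "e / 3"] e by auto
  obtain P where P: "polynomial_function P" "\<And>x. x \<in> {0..1} \<Longrightarrow> norm (c x - P x) < e / 3"
    using Stone_Weierstrass_polynomial_function[OF compact_Icc continuous_on_subset[OF c(1) subset_UNIV], of "e / 3" 0 1] e by auto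
  obtain P' where P': "polynomial_function P'" "\<And>x. (P has_vector_derivative P' x) (at x)"
    using has_vector_derivative_polynomial_function[OF P(1)] by blast
  have cont: "continuous_on {0..1} P" "continuous_on {0..1} P'"
    using P(1) P'(1) continuous_on_polymonial_function by blast+
  obtain A where A: "0 < A" "\<And>x. x \<in> {0..1} \<Longrightarrow> norm (P x) \<le> A"
    using continuous_on_bounded_interval[OF cont(1)] by blast
  obtain B where B: "0 < B" "\<And>x. x \<in> {0..1} \<Longrightarrow> norm (P' x) \<le> B"
    using continuous_on_bounded_interval[OF cont(2)] by blast
  have cis_cont: "continuous_on {0..1} (\<lambda>x. cis (u * x))" for u by (intro continuous_intros)
  \<comment> \<open>Each of the two boundary terms of the integration by parts costs
    \<open>A / w k\<close>, the remaining integral \<open>B / w k\<close>.\<close>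
  have "\<forall>\<^sub>F k in F. w k > 0 \<and> (2 * A + B) / w k < e / 3"
  proof -
    have "\<forall>\<^sub>F k in F. w k > 3 * (2 * A + B) / e" "\<forall>\<^sub>F k in F. w k > 0"
      using w by (simp_all add: filterlim_at_top_dense)
    then show ?thesis by eventually_elim (use e in \<open>auto simp: field_simps\<close>)
  qed
  then show "\<forall>\<^sub>F k in F. dist (integral {0..1} (\<lambda>x. p x * cis (w k * x))) 0 < e"
  proof eventually_elim
    case (elim k)
    let ?u = "w k"
    have hi: "((\<lambda>x. P' x * (cis (?u * x) / (\<i> * ?u)) + P x * cis (?u * x)) has_integral
        P 1 * (cis (?u * 1) / (\<i> * ?u)) - P 0 * (cis (?u * 0) / (\<i> * ?u))) {0..1}"
    proof (rule fundamental_theorem_of_calculus)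
      fix x :: real assume "x \<in> {0..1}"
      have "((\<lambda>x. P x * (cis (?u * x) / (\<i> * ?u))) has_vector_derivative
          P x * ((\<i> * ?u * cis (?u * x)) / (\<i> * ?u)) + P' x * (cis (?u * x) / (\<i> * ?u))) (at x within {0..1})"
        by (intro has_vector_derivative_mult has_vector_derivative_divide has_vector_derivative_cis_mult
            has_vector_derivative_at_within[OF P'(2)])
      then show "((\<lambda>x. P x * (cis (?u * x) / (\<i> * ?u))) has_vector_derivative
          P' x * (cis (?u * x) / (\<i> * ?u)) + P x * cis (?u * x)) (at x within {0..1})"
        using elim by (simp add: add.commute)
    qed simp
    have i1: "(\<lambda>x. P' x * (cis (?u * x) / (\<i> * ?u))) integrable_on {0..1}"
      using elim by (intro integrable_continuous_real continuous_intros cont cis_cont) auto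
    have i2: "(\<lambda>x. P x * cis (?u * x)) integrable_on {0..1}"
      by (intro integrable_continuous_real continuous_intros cont cis_cont)
    have n1: "norm (cis (?u * x) / (\<i> * ?u)) = 1 / ?u" for x using elim by (simp add: norm_divide norm_mult)
    have "integral {0..1} (\<lambda>x. P x * cis (?u * x)) =
        P 1 * (cis (?u * 1) / (\<i> * ?u)) - P 0 * (cis (?u * 0) / (\<i> * ?u)) - integral {0..1} (\<lambda>x. P' x * (cis (?u * x) / (\<i> * ?u)))"
      using integral_unique[OF hi] integral_add[OF i1 i2] by (simp add: algebra_simps)
    also have "norm \<dots> \<le> A / ?u + A / ?u + B / ?u"
    proof (intro norm_triangle_le_diff add_mono)
      show "norm (P 1 * (cis (?u * 1) / (\<i> * ?u))) \<le> A / ?u" "norm (P 0 * (cis (?u * 0) / (\<i> * ?u))) \<le> A / ?u"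
        using A(2)[of 0] A(2)[of 1] elim unfolding norm_mult n1 by (simp_all add: field_simps)
      have "norm (integral {0..1} (\<lambda>x. P' x * (cis (?u * x) / (\<i> * ?u)))) \<le> B / ?u * (1 - 0)"
      proof (rule integral_bound)
        show "norm (P' x * (cis (?u * x) / (\<i> * ?u))) \<le> B / ?u" if "x \<in> {0..1}" for x
          using B(2)[OF that] elim unfolding norm_mult n1 by (simp add: field_simps)
        show "continuous_on {0..1} (\<lambda>x. P' x * (cis (?u * x) / (\<i> * ?u)))"
          using elim by (intro continuous_intros cont cis_cont) auto
      qed simp
      then show "norm (integral {0..1} (\<lambda>x. P' x * (cis (?u * x) / (\<i> * ?u)))) \<le> B / ?u" by simp
    qed
    also have "\<dots> < e / 3" using elim by (simp add: add_divide_distrib)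
    finally have 1: "norm (integral {0..1} (\<lambda>x. P x * cis (?u * x))) < e / 3" .
    have pcis: "(\<lambda>x. p x * cis (?u * x)) integrable_on {0..1}"
      using absolutely_integrable_mult_continuous[OF p cis_cont[of ?u]] set_lebesgue_integral_eq_integral(1) by blast
    have ni: "(\<lambda>x. norm (p x - c x)) integrable_on {0..1}"
      using set_integral_diff(1)[OF p absolutely_integrable_continuous_real[OF continuous_on_subset[OF c(1) subset_UNIV]]]
      unfolding absolutely_integrable_on_def by simp
    have "norm (integral {0..1} (\<lambda>x. p x * cis (?u * x)) - integral {0..1} (\<lambda>x. P x * cis (?u * x))) =
        norm (integral {0..1} (\<lambda>x. p x * cis (?u * x) - P x * cis (?u * x)))"
      by (simp add: integral_diff[OF pcis i2])
    also have "\<dots> \<le> integral {0..1} (\<lambda>x. norm (p x - c x) + e / 3)"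
    proof (rule integral_norm_bound_integral)
      show "(\<lambda>x. p x * cis (?u * x) - P x * cis (?u * x)) integrable_on {0..1}"
        by (rule integrable_diff[OF pcis i2])
      show "(\<lambda>x. norm (p x - c x) + e / 3) integrable_on {0..1}"
        by (intro integrable_add ni) auto
      show "norm (p x * cis (?u * x) - P x * cis (?u * x)) \<le> norm (p x - c x) + e / 3" if "x \<in> {0..1}" for x
      proof -
        have "p x * cis (?u * x) - P x * cis (?u * x) = (p x - P x) * cis (?u * x)" by (simp add: algebra_simps)
        then have "norm (p x * cis (?u * x) - P x * cis (?u * x)) = norm (p x - P x)" by (simp add: norm_mult)
        also have "\<dots> \<le> norm (p x - c x) + norm (c x - P x)"
          using norm_triangle_ineq[of "p x - c x" "c x - P x"] by simp
        finally show ?thesis using P(2)[OF that] by simp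
      qed
    qed
    also have "\<dots> = integral {0..1} (\<lambda>x. norm (p x - c x)) + e / 3"
      by (subst integral_add[OF ni]) auto
    also have "\<dots> < e / 3 + e / 3" using c(2) by simp
    finally show ?case
      using 1 norm_triangle_sub[of "integral {0..1} (\<lambda>x. p x * cis (?u * x))" "integral {0..1} (\<lambda>x. P x * cis (?u * x))"]
      by (simp add: dist_norm norm_minus_commute)
  qed
qed

section \<open>Restrictions, conjugates and smooth functions\<close>

lemma abs_continuous_on_subset:
  "abs_continuous_on S f \<Longrightarrow> T \<subseteq> S \<Longrightarrow> abs_continuous_on T f"
  unfolding abs_continuous_on_def by (meson order_trans)

lemma abs_continuous_on_cmult:
  fixes f :: "real \<Rightarrow> 'a::real_normed_algebra"
  assumes "abs_continuous_on {a..b} f"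
  shows "abs_continuous_on {a..b} (\<lambda>x. c * f x)"
  by (rule abs_continuous_on_mult[OF abs_continuous_on_lipschitz[of 0] assms]) auto

lemma abs_continuous_on_cnj:
  assumes "abs_continuous_on {a..b} f"
  shows "abs_continuous_on {a..b} (\<lambda>x. cnj (f x))"
proof (rule abs_continuous_on_dominated[OF assms assms, of 1])
  show "cmod (cnj (f v) - cnj (f u)) \<le> 1 * (cmod (f v - f u) + cmod (f v - f u))" for u v
    by (simp flip: complex_cnj_diff)
qed auto

lemma abs_continuous_on_has_derivative:
  fixes f :: "real \<Rightarrow> 'a::real_normed_vector"
  assumes der: "\<And>x. x \<in> {a..b} \<Longrightarrow> (f has_vector_derivative f' x) (at x within {a..b})"
    and f': "continuous_on {a..b} f'"
  shows "abs_continuous_on {a..b} f"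
proof -
  obtain B where B: "0 < B" "\<And>x. x \<in> {a..b} \<Longrightarrow> norm (f' x) \<le> B"
    using continuous_on_bounded_interval[OF f'] by blast
  show ?thesis
  proof (rule abs_continuous_on_lipschitz)
    fix u v assume uv: "a \<le> u" "u \<le> v" "v \<le> b"
    have "norm (f v - f u) \<le> B * norm (v - u)"
    proof (rule differentiable_bound[where S = "{a..b}"])
      show "(f has_derivative (\<lambda>h. h *\<^sub>R f' x)) (at x within {a..b})" if "x \<in> {a..b}" for x
        using der[OF that] by (simp add: has_vector_derivative_def)
      show "onorm (\<lambda>h. h *\<^sub>R f' x) \<le> B" if "x \<in> {a..b}" for x
        using B(2)[OF that] by (intro onorm_le) (simp add: mult.commute[of _ "norm (f' x)"] mult_right_mono)
    qed (use uv in auto)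
    then show "norm (f v - f u) \<le> B * (v - u)" using uv by simp
  qed (use B in simp)
qed

section \<open>The equation on one edge\<close>

lemma has_vector_derivative_of_real_trig:
  "((\<lambda>x. complex_of_real (cos (w * x))) has_vector_derivative - complex_of_real w * complex_of_real (sin (w * x))) (at x within S)"
  "((\<lambda>x. complex_of_real (sin (w * x))) has_vector_derivative complex_of_real w * complex_of_real (cos (w * x))) (at x within S)"
  unfolding has_vector_derivative_complex_iff by (auto intro!: derivative_eq_intros)

lemma abs_continuous_on_trig:
  "abs_continuous_on {a..b} (\<lambda>x. complex_of_real (cos (w * x)))"
  "abs_continuous_on {a..b} (\<lambda>x. complex_of_real (sin (w * x)))"
  by (rule abs_continuous_on_has_derivative[OF has_vector_derivative_of_real_trig(1)],
      intro continuous_intros,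
      rule abs_continuous_on_has_derivative[OF has_vector_derivative_of_real_trig(2)],
      intro continuous_intros)

section \<open>Solutions on the unit interval\<close>

lemma unit_deriv_eq:
  assumes "(f has_vector_derivative D) (at x within {0..1})" "x \<in> {0..1}"
  shows "unit_deriv f x = D"
  unfolding unit_deriv_def using vector_derivative_within_cbox[of 0 1 x f D] assms by simp

text \<open>The equation as a first-order system for \<open>f\<close> and \<open>v\<close>, where
  only the second equation may fail, on an explicit negligible set.
  \<open>solves_schroedingerD\<close> is the converse reading; the analysis below uses this
  form.\<close>

lemma solves_schroedingerI:
  assumes der: "\<And>x. x \<in> {0..1} \<Longrightarrow> (f has_vector_derivative v x) (at x within {0..1})"
    and v: "abs_continuous_on {0..1} v" and N: "negligible N"
    and v': "\<And>x. x \<in> {0..1} - N \<Longrightarrow> (v has_vector_derivative (of_real (p x) - \<mu>) * f x) (at x within {0..1})"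
  shows "solves_schroedinger p \<mu> f" "\<And>x. x \<in> {0..1} \<Longrightarrow> unit_deriv f x = v x"
proof -
  show u: "unit_deriv f x = v x" if "x \<in> {0..1}" for x
    using unit_deriv_eq[OF der[OF that] that] .
  show "solves_schroedinger p \<mu> f"
    unfolding solves_schroedinger_def
  proof (intro conjI ballI)
    show "abs_continuous_on {0..1} f"
      by (rule abs_continuous_on_has_derivative[OF der abs_continuous_on_imp_continuous_on[OF v]])
    show "f differentiable at x within {0..1}" if "x \<in> {0..1}" for x
      using der[OF that] by (rule differentiableI_vector)
    show "abs_continuous_on {0..1} (unit_deriv f)"
      using abs_continuous_on_cong[of 0 1 "unit_deriv f" v] u v by simp
    show "AE x in lebesgue. x \<in> {0<..<1} \<longrightarrow>
        (\<exists>f''. (unit_deriv f has_vector_derivative f'') (at x) \<and> - f'' + complex_of_real (p x) * f x = \<mu> * f x)"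
    proof (rule AE_I')
      show "N \<in> null_sets lebesgue" using N by (simp add: negligible_iff_null_sets)
      have "\<exists>f''. (unit_deriv f has_vector_derivative f'') (at x) \<and> - f'' + complex_of_real (p x) * f x = \<mu> * f x"
        if x: "x \<in> {0<..<1}" "x \<notin> N" for x
      proof (intro exI conjI)
        have "(v has_vector_derivative (of_real (p x) - \<mu>) * f x) (at x within {0<..<1})"
          using v'[of x] x by (intro has_vector_derivative_within_subset[of v _ x "{0..1}" "{0<..<1}"]) auto
        then have "(v has_vector_derivative (of_real (p x) - \<mu>) * f x) (at x)"
          using at_within_open[of x "{0<..<1}"] x by simp
        then show "(unit_deriv f has_vector_derivative (of_real (p x) - \<mu>) * f x) (at x)"
          by (rule has_vector_derivative_transform_within_open[of _ _ _ "{0<..<1}"]) (use x u in auto)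
        show "- ((of_real (p x) - \<mu>) * f x) + complex_of_real (p x) * f x = \<mu> * f x"
          by (simp add: algebra_simps)
      qed
      then show "{x \<in> space lebesgue. \<not> (x \<in> {0<..<1} \<longrightarrow>
          (\<exists>f''. (unit_deriv f has_vector_derivative f'') (at x) \<and> - f'' + complex_of_real (p x) * f x = \<mu> * f x))} \<subseteq> N"
        by blast
    qed
  qed
qed

lemma solves_schroedingerD:
  assumes s: "solves_schroedinger p \<mu> f"
  shows "\<And>x. x \<in> {0..1} \<Longrightarrow> (f has_vector_derivative unit_deriv f x) (at x within {0..1})"
    and "abs_continuous_on {0..1} f" "abs_continuous_on {0..1} (unit_deriv f)"
    and "\<exists>N. negligible N \<and> (\<forall>x\<in>{0..1} - N.
      (unit_deriv f has_vector_derivative (of_real (p x) - \<mu>) * f x) (at x within {0..1}))"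
proof -
  show "(f has_vector_derivative unit_deriv f x) (at x within {0..1})" if "x \<in> {0..1}" for x
    unfolding unit_deriv_def using s that
    by (auto simp: solves_schroedinger_def vector_derivative_works[symmetric])
  show "abs_continuous_on {0..1} f" "abs_continuous_on {0..1} (unit_deriv f)"
    using s by (auto simp: solves_schroedinger_def)
  have "AE x in lebesgue. x \<in> {0<..<1} \<longrightarrow>
        (\<exists>f''. (unit_deriv f has_vector_derivative f'') (at x) \<and> - f'' + complex_of_real (p x) * f x = \<mu> * f x)"
    using s by (simp add: solves_schroedinger_def)
  then obtain N where N: "N \<in> null_sets lebesgue" "{x \<in> space lebesgue. \<not> (x \<in> {0<..<1} \<longrightarrow>
        (\<exists>f''. (unit_deriv f has_vector_derivative f'') (at x) \<and> - f'' + complex_of_real (p x) * f x = \<mu> * f x))} \<subseteq> N"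
    unfolding eventually_ae_filter by blast
  show "\<exists>N. negligible N \<and> (\<forall>x\<in>{0..1} - N.
      (unit_deriv f has_vector_derivative (of_real (p x) - \<mu>) * f x) (at x within {0..1}))"
  proof (intro exI conjI ballI)
    \<comment> \<open>The definition states the equation on the open interval, so the end points
      join the exceptional set.\<close>
    show "negligible (N \<union> {0, 1})"
      using N(1) by (intro negligible_Un) (simp_all add: negligible_iff_null_sets)
    fix x assume x: "x \<in> {0..1} - (N \<union> {0, 1})"
    then have "x \<in> {0<..<1}" "x \<notin> N" by auto
    then obtain f'' where "(unit_deriv f has_vector_derivative f'') (at x)" "- f'' + complex_of_real (p x) * f x = \<mu> * f x"
      using N(2) by auto
    moreover from this(2) have "f'' = (of_real (p x) - \<mu>) * f x"
      by (simp add: algebra_simps)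
    ultimately show "(unit_deriv f has_vector_derivative (of_real (p x) - \<mu>) * f x) (at x within {0..1})"
      using has_vector_derivative_at_within by blast
  qed
qed

lemma solves_schroedinger_lincomb:
  assumes f: "solves_schroedinger p \<mu> f" and g: "solves_schroedinger p \<mu> g"
  shows "solves_schroedinger p \<mu> (\<lambda>x. c * f x + e * g x)"
    and "\<And>x. x \<in> {0..1} \<Longrightarrow> unit_deriv (\<lambda>x. c * f x + e * g x) x = c * unit_deriv f x + e * unit_deriv g x"
proof -
  obtain M N where M: "negligible M" "\<forall>x\<in>{0..1} - M.
      (unit_deriv f has_vector_derivative (of_real (p x) - \<mu>) * f x) (at x within {0..1})"
    and N: "negligible N" "\<forall>x\<in>{0..1} - N.
      (unit_deriv g has_vector_derivative (of_real (p x) - \<mu>) * g x) (at x within {0..1})"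
    using solves_schroedingerD(4)[OF f] solves_schroedingerD(4)[OF g] by blast
  have 1: "((\<lambda>x. c * f x + e * g x) has_vector_derivative (c * unit_deriv f x + e * unit_deriv g x)) (at x within {0..1})"
    if "x \<in> {0..1}" for x
    by (intro has_vector_derivative_add has_vector_derivative_mult_right solves_schroedingerD(1)[OF f] solves_schroedingerD(1)[OF g] that)
  have 2: "abs_continuous_on {0..1} (\<lambda>x. c * unit_deriv f x + e * unit_deriv g x)"
    by (intro abs_continuous_on_add abs_continuous_on_cmult solves_schroedingerD(3)[OF f] solves_schroedingerD(3)[OF g])
  have 3: "((\<lambda>x. c * unit_deriv f x + e * unit_deriv g x) has_vector_derivative (of_real (p x) - \<mu>) * (c * f x + e * g x)) (at x within {0..1})"
    if "x \<in> {0..1} - (M \<union> N)" for x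
  proof -
    have "((\<lambda>x. c * unit_deriv f x + e * unit_deriv g x) has_vector_derivative
        c * ((of_real (p x) - \<mu>) * f x) + e * ((of_real (p x) - \<mu>) * g x)) (at x within {0..1})"
      using M(2) N(2) that by (intro has_vector_derivative_add has_vector_derivative_mult_right) auto
    then show ?thesis by (simp add: algebra_simps)
  qed
  note * = solves_schroedingerI[OF 1 2 negligible_Un[OF M(1) N(1)] 3]
  show "solves_schroedinger p \<mu> (\<lambda>x. c * f x + e * g x)" by (rule *(1))
  show "unit_deriv (\<lambda>x. c * f x + e * g x) x = c * unit_deriv f x + e * unit_deriv g x" if "x \<in> {0..1}" for x
    by (rule *(2)[OF _ _ that])
qed

lemma solves_schroedinger_cnj:
  assumes f: "solves_schroedinger p \<mu> f"
  shows "solves_schroedinger p (cnj \<mu>) (\<lambda>x. cnj (f x))"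
    and "\<And>x. x \<in> {0..1} \<Longrightarrow> unit_deriv (\<lambda>x. cnj (f x)) x = cnj (unit_deriv f x)"
proof -
  obtain M where M: "negligible M" "\<forall>x\<in>{0..1} - M.
      (unit_deriv f has_vector_derivative (of_real (p x) - \<mu>) * f x) (at x within {0..1})"
    using solves_schroedingerD(4)[OF f] by blast
  have cnj: "((\<lambda>x. cnj (h x)) has_vector_derivative cnj D) (at x within {0..1})"
    if "(h has_vector_derivative D) (at x within {0..1})" for h D and x :: real
    using that by (rule has_vector_derivative_cnj)
  have 1: "((\<lambda>x. cnj (f x)) has_vector_derivative cnj (unit_deriv f x)) (at x within {0..1})" if "x \<in> {0..1}" for x
    by (intro cnj solves_schroedingerD(1)[OF f] that)
  have 2: "abs_continuous_on {0..1} (\<lambda>x. cnj (unit_deriv f x))"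
    by (intro abs_continuous_on_cnj solves_schroedingerD(3)[OF f])
  have 3: "((\<lambda>x. cnj (unit_deriv f x)) has_vector_derivative (of_real (p x) - cnj \<mu>) * cnj (f x)) (at x within {0..1})"
    if "x \<in> {0..1} - M" for x
    using cnj[OF M(2)[rule_format, OF that]] by simp
  note * = solves_schroedingerI[OF 1 2 M(1) 3]
  show "solves_schroedinger p (cnj \<mu>) (\<lambda>x. cnj (f x))" by (rule *(1))
  show "unit_deriv (\<lambda>x. cnj (f x)) x = cnj (unit_deriv f x)" if "x \<in> {0..1}" for x
    by (rule *(2)[OF _ _ that])
qed

text \<open>The potential cancels in the derivative of the Wronskian. The identity is bilinear;
  conjugation enters by inserting the conjugate of a solution for \<open>g\<close>, which also
  solves the equation because the potential is real.\<close>

lemma green_identity: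
  assumes f: "solves_schroedinger p \<mu> f" and g: "solves_schroedinger p \<nu> g"
  shows "((\<lambda>x. (\<mu> - \<nu>) * (f x * g x)) has_integral
    (f 1 * unit_deriv g 1 - unit_deriv f 1 * g 1) - (f 0 * unit_deriv g 0 - unit_deriv f 0 * g 0)) {0..1}"
proof -
  obtain M N where M: "negligible M" "\<forall>x\<in>{0..1} - M.
      (unit_deriv f has_vector_derivative (of_real (p x) - \<mu>) * f x) (at x within {0..1})"
    and N: "negligible N" "\<forall>x\<in>{0..1} - N.
      (unit_deriv g has_vector_derivative (of_real (p x) - \<nu>) * g x) (at x within {0..1})"
    using solves_schroedingerD(4)[OF f] solves_schroedingerD(4)[OF g] by blast
  show ?thesis
  proof (rule abs_continuous_has_integral[OF _ _ negligible_Un[OF M(1) N(1)], where f = "\<lambda>x. f x * unit_deriv g x - unit_deriv f x * g x"])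
    show "abs_continuous_on {0..1} (\<lambda>x. f x * unit_deriv g x - unit_deriv f x * g x)"
      by (intro abs_continuous_on_diff abs_continuous_on_mult solves_schroedingerD(2,3)[OF f] solves_schroedingerD(2,3)[OF g])
    fix x :: real assume x: "x \<in> {0..1} - (M \<union> N)"
    have "((\<lambda>x. f x * unit_deriv g x - unit_deriv f x * g x) has_vector_derivative
        (f x * ((of_real (p x) - \<nu>) * g x) + unit_deriv f x * unit_deriv g x) -
        (unit_deriv f x * unit_deriv g x + (of_real (p x) - \<mu>) * f x * g x)) (at x within {0..1})"
      using M(2) N(2) x
      by (intro has_vector_derivative_diff has_vector_derivative_mult solves_schroedingerD(1)[OF f] solves_schroedingerD(1)[OF g]) auto
    then show "((\<lambda>x. f x * unit_deriv g x - unit_deriv f x * g x) has_vector_derivative (\<mu> - \<nu>) * (f x * g x)) (at x within {0..1})"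
      by (simp add: algebra_simps)
  qed simp
qed

text \<open>\<open>small\<close> makes the integral equation below a contraction with constant at
  most 1/2. With \<open>sin w = 0\<close> a free wave returns at 1 to its value at 0 up to the sign
  \<open>cos w\<close>.\<close>

locale edge =
  fixes p :: "real \<Rightarrow> real" and w d :: real
  assumes p: "p absolutely_integrable_on {0..1}"
    and w_pos: "w > 0" and sin_w: "sin w = 0"
    and small: "2 * integral {0..1} (\<lambda>x. \<bar>p x - d\<bar>) \<le> w"
begin

definition L where "L = integral {0..1} (\<lambda>x. \<bar>p x - d\<bar>)"

definition cosc :: "real \<Rightarrow> complex" where "cosc x = of_real (cos (w * x))"

definition sinc :: "real \<Rightarrow> complex" where "sinc x = of_real (sin (w * x))"

definition osc :: "(real \<Rightarrow> complex) \<Rightarrow> (real \<Rightarrow> complex) \<Rightarrow> real \<Rightarrow> complex" where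
  "osc s f x = integral {0..x} (\<lambda>t. of_real (p t - d) * f t * s t)"

text \<open>Variation of constants, normalized by the midpoints \<open>\<alpha>\<close> and \<open>\<beta>\<close> of the slowly varying
  amplitudes instead of by initial values.\<close>

definition volterra :: "complex \<Rightarrow> complex \<Rightarrow> (real \<Rightarrow> complex) \<Rightarrow> real \<Rightarrow> complex" where
  "volterra \<alpha> \<beta> f x = cosc x * (\<alpha> + (osc sinc f 1 - 2 * osc sinc f x) / (2 * of_real w)) +
     sinc x * (\<beta> - (osc cosc f 1 - 2 * osc cosc f x) / (2 * of_real w))"

lemma L_small: "2 * L \<le> w" using small by (simp add: L_def)

lemma cos_w_sq: "cos w * cos w = 1"
  using sin_cos_squared_add[of w] sin_w by (simp add: power2_eq_square)

lemma trig_sq: "cosc x * cosc x + sinc x * sinc x = 1"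
proof -
  have "(cos (w * x))\<^sup>2 + (sin (w * x))\<^sup>2 = 1" by simp
  then show ?thesis unfolding cosc_def sinc_def power2_eq_square by (metis of_real_1 of_real_add of_real_mult)
qed

lemma trig_values: "cosc 0 = 1" "sinc 0 = 0" "cosc 1 = of_real (cos w)" "sinc 1 = 0"
  by (simp_all add: cosc_def sinc_def sin_w)

lemma trig_norm: "norm (cosc x) \<le> 1" "norm (sinc x) \<le> 1"
  by (simp_all add: cosc_def sinc_def)

lemma trig_cont: "continuous_on S cosc" "continuous_on S sinc"
  unfolding cosc_def sinc_def by (intro continuous_intros)+

lemma trig_deriv:
  "(cosc has_vector_derivative - of_real w * sinc x) (at x within S)"
  "(sinc has_vector_derivative of_real w * cosc x) (at x within S)"
  using has_vector_derivative_of_real_trig[of w x S] by (simp_all add: cosc_def[abs_def] sinc_def[abs_def])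

lemma trig_ac: "abs_continuous_on {a..b} cosc" "abs_continuous_on {a..b} sinc"
  using abs_continuous_on_trig[of a b w] by (simp_all add: cosc_def[abs_def] sinc_def[abs_def])

section \<open>Contraction estimates and the fixed point\<close>

lemma pd: "(\<lambda>x. p x - d) absolutely_integrable_on {0..1}"
  by (intro set_integral_diff(1) p absolutely_integrable_continuous_real) auto

lemma pd_abs: "(\<lambda>x. \<bar>p x - d\<bar>) integrable_on {0..1}"
  using pd unfolding absolutely_integrable_on_def by simp

lemma L_nonneg: "0 \<le> L"
  unfolding L_def by (intro integral_nonneg pd_abs) auto

lemma osc_integrable:
  fixes f s :: "real \<Rightarrow> complex"
  assumes "continuous_on {0..1} f" "continuous_on {0..1} s"
  shows "(\<lambda>t. of_real (p t - d) * f t * s t) absolutely_integrable_on {0..1}"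
  by (intro absolutely_integrable_mult_continuous absolutely_integrable_of_real pd assms)

lemma osc_integrable':
  fixes f s :: "real \<Rightarrow> complex"
  assumes "continuous_on {0..1} f" "continuous_on {0..1} s" "0 \<le> a" "b \<le> 1"
  shows "(\<lambda>t. of_real (p t - d) * f t * s t) integrable_on {a..b}"
proof (rule integrable_on_subinterval)
  show "(\<lambda>t. of_real (p t - d) * f t * s t) integrable_on {0..1}"
    using osc_integrable[OF assms(1,2)] set_lebesgue_integral_eq_integral(1) by blast
qed (use assms in auto)

text \<open>The combination is the integral over \<open>{x..1}\<close> minus the integral over
  \<open>{0..x}\<close>, so the midpoint normalization costs the weight \<open>L\<close> only
  once.\<close>

lemma osc_bound:
  assumes f: "continuous_on {0..1} f" and s: "continuous_on {0..1} s"
    and B: "\<And>x. x \<in> {0..1} \<Longrightarrow> norm (f x) \<le> B" and s1: "\<And>x. norm (s x) \<le> 1" and x: "x \<in> {0..1}"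
  shows "norm (osc s f 1 - 2 * osc s f x) \<le> L * B"
proof -
  let ?h = "\<lambda>t. complex_of_real (p t - d) * f t * s t"
  have B0: "0 \<le> B" using order_trans[OF norm_ge_zero B[of 0]] by simp
  have le: "norm (?h t) \<le> \<bar>p t - d\<bar> * B" if "t \<in> {0..1}" for t
  proof -
    have "norm (?h t) = \<bar>p t - d\<bar> * (norm (f t) * norm (s t))" by (simp add: norm_mult del: of_real_diff)
    also have "\<dots> \<le> \<bar>p t - d\<bar> * (B * 1)"
      using B[OF that] s1[of t] B0 by (intro mult_left_mono mult_mono) auto
    finally show ?thesis by simp
  qed
  have int: "?h integrable_on {0..x}" "?h integrable_on {x..1}"
    using x by (intro osc_integrable' f s; simp)+
  have pdi: "(\<lambda>t. \<bar>p t - d\<bar> * B) integrable_on {a..b}" if "0 \<le> a" "b \<le> 1" for a b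
    using that by (intro integrable_on_mult_left integrable_on_subinterval[OF pd_abs]) auto
  have "osc s f 1 = osc s f x + integral {x..1} ?h"
    unfolding osc_def using x by (intro Henstock_Kurzweil_Integration.integral_combine[symmetric] osc_integrable' f s) auto
  then have "osc s f 1 - 2 * osc s f x = integral {x..1} ?h - integral {0..x} ?h"
    unfolding osc_def by simp
  also have "norm \<dots> \<le> integral {x..1} (\<lambda>t. \<bar>p t - d\<bar> * B) + integral {0..x} (\<lambda>t. \<bar>p t - d\<bar> * B)"
    using x by (intro norm_triangle_le_diff add_mono integral_norm_bound_integral int pdi le) auto
  also have "\<dots> = integral {0..1} (\<lambda>t. \<bar>p t - d\<bar> * B)"
    using Henstock_Kurzweil_Integration.integral_combine[of 0 x 1 "\<lambda>t. \<bar>p t - d\<bar> * B"] x pdi[of 0 1] by simp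
  also have "\<dots> = L * B" by (simp add: L_def)
  finally show ?thesis .
qed

lemma osc_diff:
  assumes "continuous_on {0..1} f" "continuous_on {0..1} g" "continuous_on {0..1} s" "x \<in> {0..1}"
  shows "osc s f x - osc s g x = osc s (\<lambda>t. f t - g t) x"
proof -
  have "osc s f x - osc s g x = integral {0..x} (\<lambda>t. of_real (p t - d) * f t * s t - of_real (p t - d) * g t * s t)"
    unfolding osc_def using assms by (intro integral_diff[symmetric] osc_integrable') auto
  also have "\<dots> = osc s (\<lambda>t. f t - g t) x"
    unfolding osc_def by (intro integral_cong) (simp add: algebra_simps)
  finally show ?thesis .
qed

lemma volterra_dist:
  assumes f: "continuous_on {0..1} f" and g: "continuous_on {0..1} g"
    and B: "\<And>x. x \<in> {0..1} \<Longrightarrow> norm (f x - g x) \<le> B" and x: "x \<in> {0..1}"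
  shows "norm (volterra \<alpha> \<beta> f x - volterra \<alpha> \<beta> g x) \<le> L * B / w"
proof -
  let ?h = "\<lambda>t. f t - g t"
  have h: "continuous_on {0..1} ?h" by (intro continuous_intros f g)
  have d1: "osc s f 1 - 2 * osc s f x - (osc s g 1 - 2 * osc s g x) = osc s ?h 1 - 2 * osc s ?h x"
    if "continuous_on {0..1} s" for s
    using osc_diff[OF f g that x] osc_diff[OF f g that, of 1] by (simp add: algebra_simps)
  have eq: "volterra \<alpha> \<beta> f x - volterra \<alpha> \<beta> g x =
    cosc x * ((osc sinc ?h 1 - 2 * osc sinc ?h x) / (2 * of_real w)) -
    sinc x * ((osc cosc ?h 1 - 2 * osc cosc ?h x) / (2 * of_real w))"
    unfolding volterra_def d1[OF trig_cont(1), symmetric] d1[OF trig_cont(2), symmetric]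
    by (simp add: algebra_simps diff_divide_distrib add_divide_distrib)
  have "norm (cosc x * ((osc sinc ?h 1 - 2 * osc sinc ?h x) / (2 * of_real w)) -
    sinc x * ((osc cosc ?h 1 - 2 * osc cosc ?h x) / (2 * of_real w))) \<le> 1 * (L * B / (2 * w)) + 1 * (L * B / (2 * w))"
  proof (intro norm_triangle_le_diff add_mono)
    have "norm ((osc s ?h 1 - 2 * osc s ?h x) / (2 * of_real w)) \<le> L * B / (2 * w)"
      if "continuous_on {0..1} s" "\<And>x. norm (s x) \<le> 1" for s
      using osc_bound[OF h that(1) B that(2) x] w_pos by (simp add: norm_divide norm_mult divide_right_mono)
    then have 1: "norm ((osc sinc ?h 1 - 2 * osc sinc ?h x) / (2 * of_real w)) \<le> L * B / (2 * w)"
      "norm ((osc cosc ?h 1 - 2 * osc cosc ?h x) / (2 * of_real w)) \<le> L * B / (2 * w)"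
      using trig_cont trig_norm by blast+
    show "norm (cosc x * ((osc sinc ?h 1 - 2 * osc sinc ?h x) / (2 * of_real w))) \<le> 1 * (L * B / (2 * w))"
      "norm (sinc x * ((osc cosc ?h 1 - 2 * osc cosc ?h x) / (2 * of_real w))) \<le> 1 * (L * B / (2 * w))"
      unfolding norm_mult[of "cosc x"] norm_mult[of "sinc x"]
      by (intro mult_mono 1 trig_norm; simp)+
  qed
  also have "\<dots> = L * B / w" by simp
  finally show ?thesis unfolding eq .
qed

lemma volterra_zero: "volterra \<alpha> \<beta> (\<lambda>x. 0) x = \<alpha> * cosc x + \<beta> * sinc x"
  by (simp add: volterra_def osc_def)

lemma osc_cont:
  assumes "continuous_on {0..1} f" "continuous_on {0..1} s"
  shows "continuous_on {0..1} (osc s f)"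
  unfolding osc_def by (intro indefinite_integral_continuous_1 osc_integrable' assms) auto

lemma volterra_cont:
  assumes "continuous_on {0..1} f"
  shows "continuous_on {0..1} (volterra \<alpha> \<beta> f)"
  unfolding volterra_def using w_pos
  by (intro continuous_intros trig_cont osc_cont assms) auto

lemma volterra_cong:
  assumes "\<And>x. x \<in> {0..1} \<Longrightarrow> f x = g x" "x \<in> {0..1}"
  shows "volterra \<alpha> \<beta> f x = volterra \<alpha> \<beta> g x"
proof -
  have "osc s f y = osc s g y" if "y \<in> {0..1}" for s y
    unfolding osc_def using that assms(1) by (intro integral_cong) auto
  then show ?thesis using assms(2) by (simp add: volterra_def)
qed

lemma volterra_fixed_point:
  obtains f where "continuous_on {0..1} f" "\<And>x. x \<notin> {0..1} \<Longrightarrow> f x = 0"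
    "\<And>x. x \<in> {0..1} \<Longrightarrow> f x = volterra \<alpha> \<beta> f x"
proof -
  \<comment> \<open>Clamping to \<open>{0..1}\<close> lets the map act on the bounded continuous
    functions on the line, a complete space, and changes nothing on the interval itself.\<close>
  define cl :: "real \<Rightarrow> real" where "cl x = max 0 (min 1 x)" for x
  have cl: "cl x \<in> {0..1}" "x \<in> {0..1} \<Longrightarrow> cl x = x" for x by (auto simp: cl_def)
  define T where "T F = Bcontfun (\<lambda>x. volterra \<alpha> \<beta> (apply_bcontfun F) (cl x))" for F :: "real \<Rightarrow>\<^sub>C complex"
  have Fc: "continuous_on {0..1} (apply_bcontfun F)" for F :: "real \<Rightarrow>\<^sub>C complex"
    by (rule continuous_on_apply_bcontfun)
  have T: "apply_bcontfun (T F) x = volterra \<alpha> \<beta> (apply_bcontfun F) (cl x)" for F x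
  proof -
    obtain B where B: "\<And>x. x \<in> {0..1} \<Longrightarrow> norm (volterra \<alpha> \<beta> (apply_bcontfun F) x) \<le> B"
      using continuous_on_bounded_interval[OF volterra_cont[OF Fc]] by metis
    have "(\<lambda>x. volterra \<alpha> \<beta> (apply_bcontfun F) (cl x)) \<in> bcontfun"
    proof (rule bcontfun_normI)
      have "continuous_on UNIV cl" unfolding cl_def by (intro continuous_intros)
      then show "continuous_on UNIV (\<lambda>x. volterra \<alpha> \<beta> (apply_bcontfun F) (cl x))"
        using continuous_on_compose2[OF volterra_cont[OF Fc]] cl(1) by blast
      show "norm (volterra \<alpha> \<beta> (apply_bcontfun F) (cl x)) \<le> B" for x
        by (rule B[OF cl(1)])
    qed
    then show ?thesis by (simp add: T_def Bcontfun_inverse)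
  qed
  have "\<exists>!F. T F = F"
  proof (rule banach_fix_type[of "1/2"])
    show "\<forall>F H. dist (T F) (T H) \<le> 1 / 2 * dist F H"
    proof (intro allI dist_bound)
      fix F H :: "real \<Rightarrow>\<^sub>C complex" and x
      have "dist (T F x) (T H x) \<le> L * dist F H / w"
        unfolding T dist_norm
        by (intro volterra_dist Fc cl) (use dist_bounded[of F _ H] in \<open>simp add: dist_norm\<close>)
      also have "\<dots> = (L / w) * dist F H" by simp
      also have "\<dots> \<le> 1 / 2 * dist F H"
        using L_small w_pos by (intro mult_right_mono) (auto simp: field_simps)
      finally show "dist (T F x) (T H x) \<le> 1 / 2 * dist F H" .
    qed
  qed auto
  then obtain F where F: "T F = F" by blast
  define f where "f x = (if x \<in> {0..1} then apply_bcontfun F x else 0)" for x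
  have eq: "f x = apply_bcontfun F x" if "x \<in> {0..1}" for x using that by (simp add: f_def)
  show ?thesis
  proof
    show "continuous_on {0..1} f" using iffD2[OF continuous_on_cong[OF refl eq] Fc] .
    show "f x = 0" if "x \<notin> {0..1}" for x unfolding f_def using that by (rule if_not_P)
    show "f x = volterra \<alpha> \<beta> f x" if "x \<in> {0..1}" for x
    proof -
      have "f x = apply_bcontfun (T F) x" using eq[OF that] unfolding F .
      also have "\<dots> = volterra \<alpha> \<beta> (apply_bcontfun F) x" unfolding T cl(2)[OF that] ..
      also have "\<dots> = volterra \<alpha> \<beta> f x" by (rule volterra_cong[OF eq[symmetric] that])
      finally show ?thesis .
    qed
  qed
qed

section \<open>From the integral equation to solutions and back\<close>

definition amp1 where "amp1 \<alpha> f x = \<alpha> + (osc sinc f 1 - 2 * osc sinc f x) / (2 * of_real w)"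

definition amp2 where "amp2 \<beta> f x = \<beta> - (osc cosc f 1 - 2 * osc cosc f x) / (2 * of_real w)"

lemma osc_ac:
  assumes "continuous_on {0..1} f" "continuous_on {0..1} s"
  shows "abs_continuous_on {0..1} (osc s f)"
  unfolding osc_def by (intro abs_continuous_on_integral osc_integrable assms)

lemma amp_ac:
  assumes f: "continuous_on {0..1} f"
  shows "abs_continuous_on {0..1} (amp1 \<alpha> f)" "abs_continuous_on {0..1} (amp2 \<beta> f)"
proof -
  have const: "abs_continuous_on {0..1} (\<lambda>x. c)" for c :: complex
    by (rule abs_continuous_on_lipschitz[of 0]) auto
  have "amp1 \<alpha> f = (\<lambda>x. (\<alpha> + osc sinc f 1 / (2 * of_real w)) - (1 / of_real w) * osc sinc f x)"
    using w_pos by (auto simp: amp1_def fun_eq_iff field_simps)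
  then show "abs_continuous_on {0..1} (amp1 \<alpha> f)"
    by (simp only:) (intro abs_continuous_on_diff abs_continuous_on_cmult const osc_ac f trig_cont)
  have "amp2 \<beta> f = (\<lambda>x. (\<beta> - osc cosc f 1 / (2 * of_real w)) + (1 / of_real w) * osc cosc f x)"
    using w_pos by (auto simp: amp2_def fun_eq_iff field_simps)
  then show "abs_continuous_on {0..1} (amp2 \<beta> f)"
    by (simp only:) (intro abs_continuous_on_add abs_continuous_on_cmult const osc_ac f trig_cont)
qed

text \<open>These are the derivatives demanded by variation of parameters: they cancel in the first
  derivative of the solution and produce the potential term in the second.\<close>

lemma amp_deriv:
  assumes f: "continuous_on {0..1} f"
  obtains N where "negligible N"
    "\<And>x. x \<in> {0..1} - N \<Longrightarrow> (amp1 \<alpha> f has_vector_derivative - (of_real (p x - d) * f x * sinc x) / of_real w) (at x within {0..1})"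
    "\<And>x. x \<in> {0..1} - N \<Longrightarrow> (amp2 \<beta> f has_vector_derivative (of_real (p x - d) * f x * cosc x) / of_real w) (at x within {0..1})"
proof -
  have "\<exists>N. negligible N \<and> (\<forall>x\<in>{0..1} - N. (osc s f has_vector_derivative of_real (p x - d) * f x * s x) (at x within {0..1}))"
    if s: "continuous_on {0..1} s" for s
  proof -
    obtain N where "negligible N" "\<And>x. x \<in> {0..1} - N \<Longrightarrow>
        ((\<lambda>x. integral {0..x} (\<lambda>t. of_real (p t - d) * f t * s t)) has_vector_derivative of_real (p x - d) * f x * s x) (at x within {0..1})"
      using integral_has_vector_derivative_ae[OF osc_integrable'[OF f s order_refl order_refl]] by blast
    then show ?thesis unfolding osc_def[abs_def] by blast
  qed
  from this[OF trig_cont(2)] this[OF trig_cont(1)] obtain N1 N2 where N: "negligible N1" "negligible N2"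
    "\<And>x. x \<in> {0..1} - N1 \<Longrightarrow> (osc sinc f has_vector_derivative of_real (p x - d) * f x * sinc x) (at x within {0..1})"
    "\<And>x. x \<in> {0..1} - N2 \<Longrightarrow> (osc cosc f has_vector_derivative of_real (p x - d) * f x * cosc x) (at x within {0..1})"
    by blast
  show ?thesis
  proof
    show "negligible (N1 \<union> N2)" using N(1,2) by (rule negligible_Un)
    fix x assume x: "x \<in> {0..1} - (N1 \<union> N2)"
    have "((\<lambda>x. \<alpha> + (osc sinc f 1 - 2 * osc sinc f x) / (2 * of_real w)) has_vector_derivative
        0 + (0 - 2 * (of_real (p x - d) * f x * sinc x)) / (2 * of_real w)) (at x within {0..1})"
      using x by (intro has_vector_derivative_add has_vector_derivative_const has_vector_derivative_divide
          has_vector_derivative_diff has_vector_derivative_mult_right N) auto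
    then show "(amp1 \<alpha> f has_vector_derivative - (of_real (p x - d) * f x * sinc x) / of_real w) (at x within {0..1})"
      by (simp add: amp1_def[abs_def])
    have "((\<lambda>x. \<beta> - (osc cosc f 1 - 2 * osc cosc f x) / (2 * of_real w)) has_vector_derivative
        0 - (0 - 2 * (of_real (p x - d) * f x * cosc x)) / (2 * of_real w)) (at x within {0..1})"
      using x by (intro has_vector_derivative_const has_vector_derivative_divide
          has_vector_derivative_diff has_vector_derivative_mult_right N) auto
    then show "(amp2 \<beta> f has_vector_derivative (of_real (p x - d) * f x * cosc x) / of_real w) (at x within {0..1})"
      by (simp add: amp2_def[abs_def])
  qed
qed

lemma volterra_amp: "volterra \<alpha> \<beta> f x = amp1 \<alpha> f x * cosc x + amp2 \<beta> f x * sinc x"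
  by (simp add: volterra_def amp1_def amp2_def mult.commute)

lemma osc_at_0: "osc s f 0 = 0" by (simp add: osc_def)

text \<open>The amplitudes are differentiable only almost everywhere, whereas \<open>f\<close> has
  to be differentiable at every point. The candidate derivative \<open>v\<close> is continuous and
  integrates back to \<open>f\<close>, which repairs the exceptional points. The amplitudes at 0 and
  1 lie symmetrically around \<open>\<alpha>\<close> and \<open>\<beta>\<close>; hence the two
  midpoint relations.\<close>

lemma fixed_point_solves:
  assumes f: "continuous_on {0..1} f" and fixed: "\<And>x. x \<in> {0..1} \<Longrightarrow> f x = volterra \<alpha> \<beta> f x"
  shows "solves_schroedinger p (of_real (w\<^sup>2 + d)) f"
    and "f 0 + of_real (cos w) * f 1 = 2 * \<alpha>"
    and "unit_deriv f 0 + of_real (cos w) * unit_deriv f 1 = 2 * of_real w * \<beta>"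
proof -
  define v where "v x = of_real w * (amp2 \<beta> f x * cosc x - amp1 \<alpha> f x * sinc x)" for x
  obtain N where N: "negligible N"
    "\<And>x. x \<in> {0..1} - N \<Longrightarrow> (amp1 \<alpha> f has_vector_derivative - (of_real (p x - d) * f x * sinc x) / of_real w) (at x within {0..1})"
    "\<And>x. x \<in> {0..1} - N \<Longrightarrow> (amp2 \<beta> f has_vector_derivative (of_real (p x - d) * f x * cosc x) / of_real w) (at x within {0..1})"
    using amp_deriv[OF f] by blast
  have famp: "f x = amp1 \<alpha> f x * cosc x + amp2 \<beta> f x * sinc x" if "x \<in> {0..1}" for x
    using fixed[OF that] by (simp add: volterra_amp)
  have fac: "abs_continuous_on {0..1} (\<lambda>x. amp1 \<alpha> f x * cosc x + amp2 \<beta> f x * sinc x)"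
    by (intro abs_continuous_on_add abs_continuous_on_mult amp_ac f trig_ac)
  have vac: "abs_continuous_on {0..1} v"
    unfolding v_def by (intro abs_continuous_on_cmult abs_continuous_on_diff abs_continuous_on_mult amp_ac f trig_ac)
  have d1: "((\<lambda>x. amp1 \<alpha> f x * cosc x + amp2 \<beta> f x * sinc x) has_vector_derivative v x) (at x within {0..1})"
    if x: "x \<in> {0..1} - N" for x
  proof -
    have "((\<lambda>x. amp1 \<alpha> f x * cosc x + amp2 \<beta> f x * sinc x) has_vector_derivative
      (amp1 \<alpha> f x * (- of_real w * sinc x) + (- (of_real (p x - d) * f x * sinc x) / of_real w) * cosc x) +
      (amp2 \<beta> f x * (of_real w * cosc x) + ((of_real (p x - d) * f x * cosc x) / of_real w) * sinc x)) (at x within {0..1})"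
      by (intro has_vector_derivative_add has_vector_derivative_mult trig_deriv N x)
    moreover have "(amp1 \<alpha> f x * (- of_real w * sinc x) + (- (of_real (p x - d) * f x * sinc x) / of_real w) * cosc x) +
      (amp2 \<beta> f x * (of_real w * cosc x) + ((of_real (p x - d) * f x * cosc x) / of_real w) * sinc x) = v x"
      using w_pos by (simp add: v_def field_simps)
    ultimately show ?thesis by simp
  qed
  have vc: "continuous_on {0..1} v" by (rule abs_continuous_on_imp_continuous_on[OF vac])
  have fi: "f x = f 0 + integral {0..x} v" if x: "x \<in> {0..1}" for x
  proof -
    have "(v has_integral (amp1 \<alpha> f x * cosc x + amp2 \<beta> f x * sinc x) - (amp1 \<alpha> f 0 * cosc 0 + amp2 \<beta> f 0 * sinc 0)) {0..x}"
      using x by (intro abs_continuous_has_integral[OF _ abs_continuous_on_subset[OF fac] N(1)]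
          has_vector_derivative_within_subset[OF d1]) auto
    then have "integral {0..x} v = f x - f 0"
      using famp[OF x] famp[of 0] integral_unique by simp
    then show ?thesis by simp
  qed
  have der: "(f has_vector_derivative v x) (at x within {0..1})" if x: "x \<in> {0..1}" for x
  proof -
    have "((\<lambda>x. f 0 + integral {0..x} v) has_vector_derivative 0 + v x) (at x within {0..1})"
      by (intro has_vector_derivative_add has_vector_derivative_const integral_has_vector_derivative vc x)
    then show ?thesis
      using has_vector_derivative_transform[OF x fi] by simp
  qed
  have d2: "(v has_vector_derivative (of_real (p x) - of_real (w\<^sup>2 + d)) * f x) (at x within {0..1})" if x: "x \<in> {0..1} - N" for x
  proof -
    have "(v has_vector_derivative of_real w * (
      (amp2 \<beta> f x * (- of_real w * sinc x) + ((of_real (p x - d) * f x * cosc x) / of_real w) * cosc x) -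
      (amp1 \<alpha> f x * (of_real w * cosc x) + (- (of_real (p x - d) * f x * sinc x) / of_real w) * sinc x))) (at x within {0..1})"
      unfolding v_def
      by (intro has_vector_derivative_mult_right has_vector_derivative_diff has_vector_derivative_mult trig_deriv N x)
    moreover have "of_real w * (
      (amp2 \<beta> f x * (- of_real w * sinc x) + ((of_real (p x - d) * f x * cosc x) / of_real w) * cosc x) -
      (amp1 \<alpha> f x * (of_real w * cosc x) + (- (of_real (p x - d) * f x * sinc x) / of_real w) * sinc x)) =
      of_real (p x - d) * f x * (cosc x * cosc x + sinc x * sinc x) -
      of_real w * of_real w * (amp1 \<alpha> f x * cosc x + amp2 \<beta> f x * sinc x)"
      using w_pos by (simp add: field_simps)
    moreover have "\<dots> = (of_real (p x) - of_real (w\<^sup>2 + d)) * f x"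
      using famp[of x] x by (simp add: trig_sq algebra_simps power2_eq_square)
    ultimately show ?thesis by simp
  qed
  note * = solves_schroedingerI[OF der vac N(1) d2]
  show "solves_schroedinger p (of_real (w\<^sup>2 + d)) f" by (rule *(1))
  have u: "unit_deriv f x = v x" if "x \<in> {0..1}" for x by (rule *(2)[OF _ _ that])
  have cw: "of_real (cos w) * (z * of_real (cos w)) = z" for z :: complex
  proof -
    have "complex_of_real (cos w) * complex_of_real (cos w) = 1"
      using cos_w_sq by (metis of_real_1 of_real_mult)
    moreover have "of_real (cos w) * (z * of_real (cos w)) = complex_of_real (cos w) * complex_of_real (cos w) * z"
      by (simp only: mult_ac)
    ultimately show ?thesis by simp
  qed
  have a01: "amp1 \<alpha> f 0 + amp1 \<alpha> f 1 = 2 * \<alpha>" "amp2 \<beta> f 0 + amp2 \<beta> f 1 = 2 * \<beta>"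
    using w_pos by (auto simp: amp1_def amp2_def osc_at_0 field_simps)
  have "f 0 = amp1 \<alpha> f 0" "f 1 = amp1 \<alpha> f 1 * of_real (cos w)"
    using famp[of 0] famp[of 1] by (simp_all add: trig_values)
  then show "f 0 + of_real (cos w) * f 1 = 2 * \<alpha>"
    using a01(1) by (simp only: cw)
  have "unit_deriv f 0 = of_real w * amp2 \<beta> f 0" "unit_deriv f 1 = of_real w * amp2 \<beta> f 1 * of_real (cos w)"
    using u[of 0] u[of 1] by (simp_all add: trig_values v_def)
  then show "unit_deriv f 0 + of_real (cos w) * unit_deriv f 1 = 2 * of_real w * \<beta>"
    using a01(2) by (simp only: cw) (simp only: distrib_left[symmetric] mult.assoc mult.left_commute)
qed

text \<open>Rotating the pair of \<open>f\<close> and \<open>unit_deriv f / w\<close> back along the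
  free motion leaves only the effect of \<open>p - d\<close>, accumulated from 0 to
  \<open>x\<close>.\<close>

lemma solution_osc:
  assumes s: "solves_schroedinger p (of_real (w\<^sup>2 + d)) f" and x: "x \<in> {0..1}"
  shows "f x * cosc x - unit_deriv f x / of_real w * sinc x = f 0 - osc sinc f x / of_real w"
    and "f x * sinc x + unit_deriv f x / of_real w * cosc x = unit_deriv f 0 / of_real w + osc cosc f x / of_real w"
proof -
  obtain N where N: "negligible N" "\<forall>x\<in>{0..1} - N.
      (unit_deriv f has_vector_derivative (of_real (p x) - of_real (w\<^sup>2 + d)) * f x) (at x within {0..1})"
    using solves_schroedingerD(4)[OF s] by blast
  note fd = solves_schroedingerD(1)[OF s] and fac = solves_schroedingerD(2,3)[OF s]
  have fc: "continuous_on {0..1} f" by (rule abs_continuous_on_imp_continuous_on[OF fac(1)])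
  have dac: "abs_continuous_on {0..1} (\<lambda>x. unit_deriv f x / of_real w)"
    using abs_continuous_on_cmult[OF fac(2), of "1 / of_real w"] by simp
  have sub: "{0..x} \<subseteq> {0..1}" using x by auto
  have "((\<lambda>x. - (of_real (p x - d) * f x * sinc x) / of_real w) has_integral
      (f x * cosc x - unit_deriv f x / of_real w * sinc x) - (f 0 * cosc 0 - unit_deriv f 0 / of_real w * sinc 0)) {0..x}"
  proof (rule abs_continuous_has_integral[OF _ _ N(1), where f = "\<lambda>x. f x * cosc x - unit_deriv f x / of_real w * sinc x"])
    show "abs_continuous_on {0..x} (\<lambda>x. f x * cosc x - unit_deriv f x / of_real w * sinc x)"
      by (rule abs_continuous_on_subset[OF _ sub]) (intro abs_continuous_on_diff abs_continuous_on_mult fac dac trig_ac)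
    fix y assume y: "y \<in> {0..x} - N"
    have "((\<lambda>x. f x * cosc x - unit_deriv f x / of_real w * sinc x) has_vector_derivative
      (f y * (- of_real w * sinc y) + unit_deriv f y * cosc y) -
      (unit_deriv f y / of_real w * (of_real w * cosc y) + ((of_real (p y) - of_real (w\<^sup>2 + d)) * f y) / of_real w * sinc y)) (at y within {0..1})"
      using y sub N(2) by (intro has_vector_derivative_diff has_vector_derivative_mult has_vector_derivative_divide trig_deriv fd) auto
    moreover have "(f y * (- of_real w * sinc y) + unit_deriv f y * cosc y) -
      (unit_deriv f y / of_real w * (of_real w * cosc y) + ((of_real (p y) - of_real (w\<^sup>2 + d)) * f y) / of_real w * sinc y)
      = - (of_real (p y - d) * f y * sinc y) / of_real w"
      using w_pos by (simp add: field_simps power2_eq_square)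
    ultimately show "((\<lambda>x. f x * cosc x - unit_deriv f x / of_real w * sinc x) has_vector_derivative
      - (of_real (p y - d) * f y * sinc y) / of_real w) (at y within {0..x})"
      using has_vector_derivative_within_subset[OF _ sub] by simp
  qed (use x in auto)
  from integral_unique[OF this]
  have "(f x * cosc x - unit_deriv f x / of_real w * sinc x) - (f 0 * cosc 0 - unit_deriv f 0 / of_real w * sinc 0) =
      osc sinc f x * (- 1 / of_real w)"
    unfolding osc_def
    using Henstock_Kurzweil_Integration.integral_mult_left[of "{0..x}" "\<lambda>x. complex_of_real (p x - d) * f x * sinc x" "- 1 / complex_of_real w"]
    by simp
  then show "f x * cosc x - unit_deriv f x / of_real w * sinc x = f 0 - osc sinc f x / of_real w"
    by (simp add: trig_values algebra_simps)
  have "((\<lambda>x. (of_real (p x - d) * f x * cosc x) / of_real w) has_integral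
      (f x * sinc x + unit_deriv f x / of_real w * cosc x) - (f 0 * sinc 0 + unit_deriv f 0 / of_real w * cosc 0)) {0..x}"
  proof (rule abs_continuous_has_integral[OF _ _ N(1), where f = "\<lambda>x. f x * sinc x + unit_deriv f x / of_real w * cosc x"])
    show "abs_continuous_on {0..x} (\<lambda>x. f x * sinc x + unit_deriv f x / of_real w * cosc x)"
      by (rule abs_continuous_on_subset[OF _ sub]) (intro abs_continuous_on_add abs_continuous_on_mult fac dac trig_ac)
    fix y assume y: "y \<in> {0..x} - N"
    have "((\<lambda>x. f x * sinc x + unit_deriv f x / of_real w * cosc x) has_vector_derivative
      (f y * (of_real w * cosc y) + unit_deriv f y * sinc y) +
      (unit_deriv f y / of_real w * (- of_real w * sinc y) + ((of_real (p y) - of_real (w\<^sup>2 + d)) * f y) / of_real w * cosc y)) (at y within {0..1})"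
      using y sub N(2) by (intro has_vector_derivative_add has_vector_derivative_mult has_vector_derivative_divide trig_deriv fd) auto
    moreover have "(f y * (of_real w * cosc y) + unit_deriv f y * sinc y) +
      (unit_deriv f y / of_real w * (- of_real w * sinc y) + ((of_real (p y) - of_real (w\<^sup>2 + d)) * f y) / of_real w * cosc y)
      = (of_real (p y - d) * f y * cosc y) / of_real w"
      using w_pos by (simp add: field_simps power2_eq_square)
    ultimately show "((\<lambda>x. f x * sinc x + unit_deriv f x / of_real w * cosc x) has_vector_derivative
      (of_real (p y - d) * f y * cosc y) / of_real w) (at y within {0..x})"
      using has_vector_derivative_within_subset[OF _ sub] by simp
  qed (use x in auto)
  from integral_unique[OF this]
  have "(f x * sinc x + unit_deriv f x / of_real w * cosc x) - (f 0 * sinc 0 + unit_deriv f 0 / of_real w * cosc 0) =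
      osc cosc f x * (1 / of_real w)"
    unfolding osc_def
    using Henstock_Kurzweil_Integration.integral_mult_left[of "{0..x}" "\<lambda>x. complex_of_real (p x - d) * f x * cosc x" "1 / complex_of_real w"]
    by simp
  then show "f x * sinc x + unit_deriv f x / of_real w * cosc x = unit_deriv f 0 / of_real w + osc cosc f x / of_real w"
    by (simp add: trig_values algebra_simps)
qed

text \<open>At \<open>x = 1\<close> the sine terms drop out. Although the jump carries the factor
  \<open>w\<close>, it is thereby an integral of the same kind as the flux and stays bounded as
  \<open>w\<close> grows with fixed midpoints.\<close>

lemma solution_ends:
  assumes s: "solves_schroedinger p (of_real (w\<^sup>2 + d)) f"
  shows "of_real w * (f 0 - of_real (cos w) * f 1) = osc sinc f 1"
    and "of_real (cos w) * unit_deriv f 1 - unit_deriv f 0 = osc cosc f 1"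
  using solution_osc[OF s, of 1] w_pos by (simp_all add: trig_values field_simps)

text \<open>Half-sums and differences of the end data determine the initial data; inserted into
  \<open>solution_osc\<close> they give the two amplitudes.\<close>

lemma solution_volterra:
  assumes s: "solves_schroedinger p (of_real (w\<^sup>2 + d)) f" and x: "x \<in> {0..1}"
    and a: "f 0 + of_real (cos w) * f 1 = 2 * \<alpha>"
    and b: "unit_deriv f 0 + of_real (cos w) * unit_deriv f 1 = 2 * of_real w * \<beta>"
  shows "f x = volterra \<alpha> \<beta> f x"
proof -
  have w0: "complex_of_real w \<noteq> 0" using w_pos by simp
  have "2 * (of_real w * f 0) = of_real w * (f 0 - of_real (cos w) * f 1) + of_real w * (f 0 + of_real (cos w) * f 1)"
    by (simp add: algebra_simps)
  then have "f 0 = \<alpha> + osc sinc f 1 / (2 * of_real w)"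
    unfolding a solution_ends(1)[OF s] using w0 by (simp add: field_simps)
  then have A: "f x * cosc x - unit_deriv f x / of_real w * sinc x = amp1 \<alpha> f x"
    using solution_osc(1)[OF s x] w0 by (simp add: amp1_def diff_divide_distrib)
  have "2 * unit_deriv f 0 = (unit_deriv f 0 + of_real (cos w) * unit_deriv f 1) - (of_real (cos w) * unit_deriv f 1 - unit_deriv f 0)"
    by simp
  then have "unit_deriv f 0 / of_real w = \<beta> - osc cosc f 1 / (2 * of_real w)"
    unfolding b solution_ends(2)[OF s] using w0 by (simp add: field_simps)
  then have B: "f x * sinc x + unit_deriv f x / of_real w * cosc x = amp2 \<beta> f x"
    using solution_osc(2)[OF s x] w0 by (simp add: amp2_def diff_divide_distrib)
  have "volterra \<alpha> \<beta> f x = (f x * cosc x - unit_deriv f x / of_real w * sinc x) * cosc x +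
      (f x * sinc x + unit_deriv f x / of_real w * cosc x) * sinc x"
    unfolding volterra_amp A B ..
  also have "\<dots> = f x * (cosc x * cosc x + sinc x * sinc x)" by (simp add: algebra_simps)
  finally show ?thesis by (simp add: trig_sq)
qed

text \<open>At a maximum \<open>z\<close> of the modulus, the integral term is at most half of
  \<open>norm (f z)\<close> and can be absorbed, which explains the factor 2. For
  \<open>\<alpha> = \<beta> = 0\<close> the first bound forces \<open>f\<close> to vanish;
  uniqueness is obtained in this way.\<close>

lemma solution_bounds:
  assumes s: "solves_schroedinger p (of_real (w\<^sup>2 + d)) f"
    and a: "f 0 + of_real (cos w) * f 1 = 2 * \<alpha>"
    and b: "unit_deriv f 0 + of_real (cos w) * unit_deriv f 1 = 2 * of_real w * \<beta>"
    and x: "x \<in> {0..1}"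
  shows "norm (f x) \<le> 2 * (norm \<alpha> + norm \<beta>)"
    and "norm (f x - (\<alpha> * cosc x + \<beta> * sinc x)) \<le> 2 * L / w * (norm \<alpha> + norm \<beta>)"
proof -
  have fc: "continuous_on {0..1} f"
    by (rule abs_continuous_on_imp_continuous_on[OF solves_schroedingerD(2)[OF s]])
  obtain z where z: "z \<in> {0..1}" "\<And>x. x \<in> {0..1} \<Longrightarrow> norm (f x) \<le> norm (f z)"
    using continuous_attains_sup[of "{0..1::real}" "\<lambda>x. norm (f x)"] continuous_on_norm[OF fc] by auto
  have 1: "norm (f x - (\<alpha> * cosc x + \<beta> * sinc x)) \<le> L * norm (f z) / w" if x: "x \<in> {0..1}" for x
    using volterra_dist[OF fc continuous_on_const[of _ 0] _ x, of "norm (f z)" \<alpha> \<beta>] z(2)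
      solution_volterra[OF s x a b] by (simp add: volterra_zero)
  have y0: "norm (\<alpha> * cosc x + \<beta> * sinc x) \<le> norm \<alpha> + norm \<beta>" for x
  proof (rule norm_triangle_le, rule add_mono)
    show "norm (\<alpha> * cosc x) \<le> norm \<alpha>" "norm (\<beta> * sinc x) \<le> norm \<beta>"
      using trig_norm[of x] by (simp_all add: norm_mult mult_left_le)
  qed
  have half: "L * norm (f z) / w \<le> 1 / 2 * norm (f z)"
  proof -
    have "L / w \<le> 1 / 2" using L_small w_pos by (simp add: field_simps)
    then have "L / w * norm (f z) \<le> 1 / 2 * norm (f z)" by (rule mult_right_mono) simp
    then show ?thesis by simp
  qed
  have "norm (f z) \<le> norm (f z - (\<alpha> * cosc z + \<beta> * sinc z)) + norm (\<alpha> * cosc z + \<beta> * sinc z)"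
    using norm_triangle_ineq[of "f z - (\<alpha> * cosc z + \<beta> * sinc z)" "\<alpha> * cosc z + \<beta> * sinc z"] by simp
  also have "\<dots> \<le> 1 / 2 * norm (f z) + (norm \<alpha> + norm \<beta>)"
    by (intro add_mono order_trans[OF 1[OF z(1)] half] y0)
  finally have fz: "norm (f z) \<le> 2 * (norm \<alpha> + norm \<beta>)" by simp
  then show "norm (f x) \<le> 2 * (norm \<alpha> + norm \<beta>)" using z(2)[OF x] by simp
  have eq: "L * (2 * c) / w = 2 * L / w * c" for c :: real by simp
  have "L * norm (f z) / w \<le> L * (2 * (norm \<alpha> + norm \<beta>)) / w"
    using fz L_nonneg w_pos by (intro divide_right_mono mult_left_mono) auto
  then show "norm (f x - (\<alpha> * cosc x + \<beta> * sinc x)) \<le> 2 * L / w * (norm \<alpha> + norm \<beta>)"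
    unfolding eq by (rule order_trans[OF 1[OF x]])
qed

end

text \<open>Chosen for arbitrary parameters, outside the locale, since \<open>w\<close> and
  \<open>d\<close> are going to vary. The value 0 off the unit interval turns uniqueness into
  equality of functions.\<close>

definition edge_sol :: "(real \<Rightarrow> real) \<Rightarrow> real \<Rightarrow> real \<Rightarrow> complex \<Rightarrow> complex \<Rightarrow> real \<Rightarrow> complex" where
  "edge_sol p w d \<alpha> \<beta> = (SOME f. (\<forall>x. x \<notin> {0..1} \<longrightarrow> f x = 0) \<and>
     solves_schroedinger p (of_real (w\<^sup>2 + d)) f \<and>
     f 0 + of_real (cos w) * f 1 = 2 * \<alpha> \<and>
     unit_deriv f 0 + of_real (cos w) * unit_deriv f 1 = 2 * of_real w * \<beta>)"

text \<open>Flux and jump vanish for free waves: they measure the failure of the data at 0 to agree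
  with \<open>cos w\<close> times the data at 1. The factor \<open>w\<close> in
  \<open>edge_jump\<close> brings both to the same order.\<close>

definition edge_flux :: "(real \<Rightarrow> real) \<Rightarrow> real \<Rightarrow> real \<Rightarrow> complex \<Rightarrow> complex \<Rightarrow> complex" where
  "edge_flux p w d \<alpha> \<beta> = of_real (cos w) * unit_deriv (edge_sol p w d \<alpha> \<beta>) 1 - unit_deriv (edge_sol p w d \<alpha> \<beta>) 0"

definition edge_jump :: "(real \<Rightarrow> real) \<Rightarrow> real \<Rightarrow> real \<Rightarrow> complex \<Rightarrow> complex \<Rightarrow> complex" where
  "edge_jump p w d \<alpha> \<beta> = of_real w * (edge_sol p w d \<alpha> \<beta> 0 - of_real (cos w) * edge_sol p w d \<alpha> \<beta> 1)"

definition edge_form :: "(real \<Rightarrow> real) \<Rightarrow> real \<Rightarrow> real \<Rightarrow> complex \<Rightarrow> complex \<Rightarrow> complex \<Rightarrow> complex \<Rightarrow> complex" where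
  "edge_form p w d \<alpha> \<beta> \<gamma> \<delta> = edge_flux p w d \<alpha> \<beta> * cnj \<gamma> + edge_jump p w d \<alpha> \<beta> * cnj \<delta>"

section \<open>The solution map of an edge\<close>

context edge
begin

lemma edge_sol:
  shows edge_sol_outside: "\<And>x. x \<notin> {0..1} \<Longrightarrow> edge_sol p w d \<alpha> \<beta> x = 0"
    and edge_sol_solves: "solves_schroedinger p (of_real (w\<^sup>2 + d)) (edge_sol p w d \<alpha> \<beta>)"
    and edge_sol_mid: "edge_sol p w d \<alpha> \<beta> 0 + of_real (cos w) * edge_sol p w d \<alpha> \<beta> 1 = 2 * \<alpha>"
      "unit_deriv (edge_sol p w d \<alpha> \<beta>) 0 + of_real (cos w) * unit_deriv (edge_sol p w d \<alpha> \<beta>) 1 = 2 * of_real w * \<beta>"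
proof -
  obtain f where f: "continuous_on {0..1} f" "\<And>x. x \<notin> {0..1} \<Longrightarrow> f x = 0"
    "\<And>x. x \<in> {0..1} \<Longrightarrow> f x = volterra \<alpha> \<beta> f x"
    using volterra_fixed_point by blast
  have "(\<forall>x. x \<notin> {0..1} \<longrightarrow> edge_sol p w d \<alpha> \<beta> x = 0) \<and>
     solves_schroedinger p (of_real (w\<^sup>2 + d)) (edge_sol p w d \<alpha> \<beta>) \<and>
     edge_sol p w d \<alpha> \<beta> 0 + of_real (cos w) * edge_sol p w d \<alpha> \<beta> 1 = 2 * \<alpha> \<and>
     unit_deriv (edge_sol p w d \<alpha> \<beta>) 0 + of_real (cos w) * unit_deriv (edge_sol p w d \<alpha> \<beta>) 1 = 2 * of_real w * \<beta>"
    unfolding edge_sol_def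
    by (rule someI[of _ f]) (use f(2) fixed_point_solves[OF f(1,3)] in blast)
  then show "\<And>x. x \<notin> {0..1} \<Longrightarrow> edge_sol p w d \<alpha> \<beta> x = 0"
    "solves_schroedinger p (of_real (w\<^sup>2 + d)) (edge_sol p w d \<alpha> \<beta>)"
    "edge_sol p w d \<alpha> \<beta> 0 + of_real (cos w) * edge_sol p w d \<alpha> \<beta> 1 = 2 * \<alpha>"
    "unit_deriv (edge_sol p w d \<alpha> \<beta>) 0 + of_real (cos w) * unit_deriv (edge_sol p w d \<alpha> \<beta>) 1 = 2 * of_real w * \<beta>"
    by blast+
qed

lemma edge_sol_unique:
  assumes f: "\<And>x. x \<notin> {0..1} \<Longrightarrow> f x = 0" "solves_schroedinger p (of_real (w\<^sup>2 + d)) f"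
    and a: "f 0 + of_real (cos w) * f 1 = 2 * \<alpha>"
    and b: "unit_deriv f 0 + of_real (cos w) * unit_deriv f 1 = 2 * of_real w * \<beta>"
  shows "f = edge_sol p w d \<alpha> \<beta>"
proof
  fix x
  let ?h = "\<lambda>x. 1 * f x + (-1) * edge_sol p w d \<alpha> \<beta> x"
  note h = solves_schroedinger_lincomb[OF f(2) edge_sol_solves[of \<alpha> \<beta>], where c = 1 and e = "-1"]
  show "f x = edge_sol p w d \<alpha> \<beta> x"
  proof (cases "x \<in> {0..1}")
    case True
    have "?h 0 + of_real (cos w) * ?h 1 = 2 * 0"
      using a edge_sol_mid(1)[of \<alpha> \<beta>] by (simp add: algebra_simps)
    moreover have "unit_deriv ?h 0 + of_real (cos w) * unit_deriv ?h 1 = 2 * of_real w * 0"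
    proof -
      have "unit_deriv ?h 0 = unit_deriv f 0 - unit_deriv (edge_sol p w d \<alpha> \<beta>) 0"
        "unit_deriv ?h 1 = unit_deriv f 1 - unit_deriv (edge_sol p w d \<alpha> \<beta>) 1"
        using h(2)[of 0] h(2)[of 1] by auto
      then have "unit_deriv ?h 0 + of_real (cos w) * unit_deriv ?h 1 =
        (unit_deriv f 0 + of_real (cos w) * unit_deriv f 1) -
        (unit_deriv (edge_sol p w d \<alpha> \<beta>) 0 + of_real (cos w) * unit_deriv (edge_sol p w d \<alpha> \<beta>) 1)"
        by (simp only: right_diff_distrib) simp
      then show ?thesis unfolding b edge_sol_mid(2) by simp
    qed
    ultimately have "norm (?h x) \<le> 2 * (norm (0::complex) + norm (0::complex))"
      by (rule solution_bounds(1)[OF h(1) _ _ True])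
    then show ?thesis by simp
  qed (simp add: f(1) edge_sol_outside)
qed

lemma edge_sol_linear:
  "edge_sol p w d (c * \<alpha> + e * \<alpha>') (c * \<beta> + e * \<beta>') =
    (\<lambda>x. c * edge_sol p w d \<alpha> \<beta> x + e * edge_sol p w d \<alpha>' \<beta>' x)"
proof (rule edge_sol_unique[symmetric])
  note h = solves_schroedinger_lincomb[OF edge_sol_solves[of \<alpha> \<beta>] edge_sol_solves[of \<alpha>' \<beta>'], where c = c and e = e]
  show "solves_schroedinger p (of_real (w\<^sup>2 + d)) (\<lambda>x. c * edge_sol p w d \<alpha> \<beta> x + e * edge_sol p w d \<alpha>' \<beta>' x)"
    by (rule h(1))
  have "c * edge_sol p w d \<alpha> \<beta> 0 + e * edge_sol p w d \<alpha>' \<beta>' 0 +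
    of_real (cos w) * (c * edge_sol p w d \<alpha> \<beta> 1 + e * edge_sol p w d \<alpha>' \<beta>' 1) =
    c * (edge_sol p w d \<alpha> \<beta> 0 + of_real (cos w) * edge_sol p w d \<alpha> \<beta> 1) +
    e * (edge_sol p w d \<alpha>' \<beta>' 0 + of_real (cos w) * edge_sol p w d \<alpha>' \<beta>' 1)"
    by (simp add: algebra_simps)
  then show "c * edge_sol p w d \<alpha> \<beta> 0 + e * edge_sol p w d \<alpha>' \<beta>' 0 +
    of_real (cos w) * (c * edge_sol p w d \<alpha> \<beta> 1 + e * edge_sol p w d \<alpha>' \<beta>' 1) = 2 * (c * \<alpha> + e * \<alpha>')"
    unfolding edge_sol_mid by (simp add: algebra_simps)
  have "c * unit_deriv (edge_sol p w d \<alpha> \<beta>) 0 + e * unit_deriv (edge_sol p w d \<alpha>' \<beta>') 0 +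
    of_real (cos w) * (c * unit_deriv (edge_sol p w d \<alpha> \<beta>) 1 + e * unit_deriv (edge_sol p w d \<alpha>' \<beta>') 1) =
    c * (unit_deriv (edge_sol p w d \<alpha> \<beta>) 0 + of_real (cos w) * unit_deriv (edge_sol p w d \<alpha> \<beta>) 1) +
    e * (unit_deriv (edge_sol p w d \<alpha>' \<beta>') 0 + of_real (cos w) * unit_deriv (edge_sol p w d \<alpha>' \<beta>') 1)"
    by (simp add: algebra_simps)
  then show "unit_deriv (\<lambda>x. c * edge_sol p w d \<alpha> \<beta> x + e * edge_sol p w d \<alpha>' \<beta>' x) 0 +
    of_real (cos w) * unit_deriv (\<lambda>x. c * edge_sol p w d \<alpha> \<beta> x + e * edge_sol p w d \<alpha>' \<beta>' x) 1 =
    2 * of_real w * (c * \<beta> + e * \<beta>')"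
    unfolding h(2)[of 0, simplified] h(2)[of 1, simplified] edge_sol_mid by (simp add: algebra_simps)
qed (simp add: edge_sol_outside)

lemma edge_flux_linear:
  "edge_flux p w d (c * \<alpha> + e * \<alpha>') (c * \<beta> + e * \<beta>') = c * edge_flux p w d \<alpha> \<beta> + e * edge_flux p w d \<alpha>' \<beta>'"
proof -
  note h = solves_schroedinger_lincomb(2)[OF edge_sol_solves[of \<alpha> \<beta>] edge_sol_solves[of \<alpha>' \<beta>'], where c = c and e = e]
  show ?thesis
    unfolding edge_flux_def edge_sol_linear h[of 0, simplified] h[of 1, simplified]
    by (simp add: algebra_simps)
qed

lemma edge_jump_linear:
  "edge_jump p w d (c * \<alpha> + e * \<alpha>') (c * \<beta> + e * \<beta>') = c * edge_jump p w d \<alpha> \<beta> + e * edge_jump p w d \<alpha>' \<beta>'"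
  unfolding edge_jump_def edge_sol_linear by (simp add: algebra_simps)

lemma edge_form_linear:
  "edge_form p w d (c * \<alpha> + e * \<alpha>') (c * \<beta> + e * \<beta>') \<gamma> \<delta> =
    c * edge_form p w d \<alpha> \<beta> \<gamma> \<delta> + e * edge_form p w d \<alpha>' \<beta>' \<gamma> \<delta>"
  unfolding edge_form_def edge_flux_linear edge_jump_linear by (simp add: algebra_simps)

lemma edge_sol_values:
  "of_real w * (2 * edge_sol p w d \<alpha> \<beta> 0) = 2 * of_real w * \<alpha> + edge_jump p w d \<alpha> \<beta>"
  "of_real w * (2 * (of_real (cos w) * edge_sol p w d \<alpha> \<beta> 1)) = 2 * of_real w * \<alpha> - edge_jump p w d \<alpha> \<beta>"
  "2 * unit_deriv (edge_sol p w d \<alpha> \<beta>) 0 = 2 * of_real w * \<beta> - edge_flux p w d \<alpha> \<beta>"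
  "2 * (of_real (cos w) * unit_deriv (edge_sol p w d \<alpha> \<beta>) 1) = 2 * of_real w * \<beta> + edge_flux p w d \<alpha> \<beta>"
proof -
  let ?f = "edge_sol p w d \<alpha> \<beta>"
  have "2 * of_real w * \<alpha> = of_real w * (?f 0 + of_real (cos w) * ?f 1)"
    unfolding edge_sol_mid by simp
  then show "of_real w * (2 * ?f 0) = 2 * of_real w * \<alpha> + edge_jump p w d \<alpha> \<beta>"
    "of_real w * (2 * (of_real (cos w) * ?f 1)) = 2 * of_real w * \<alpha> - edge_jump p w d \<alpha> \<beta>"
    unfolding edge_jump_def by (simp_all add: algebra_simps)
  have mid2: "2 * of_real w * \<beta> = unit_deriv ?f 0 + of_real (cos w) * unit_deriv ?f 1"
    by (rule edge_sol_mid(2)[symmetric])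
  show "2 * unit_deriv ?f 0 = 2 * of_real w * \<beta> - edge_flux p w d \<alpha> \<beta>"
    "2 * (of_real (cos w) * unit_deriv ?f 1) = 2 * of_real w * \<beta> + edge_flux p w d \<alpha> \<beta>"
    unfolding edge_flux_def mid2 by simp_all
qed

end

text \<open>The algebra behind the choice of midpoints: with \<open>c\<close> equal to 1 or -1, the
  change of the Wronskian along an edge is an expression in half-sums and differences of the end
  data, antisymmetric under exchange of the two functions.\<close>

lemma boundary_form_identity:
  fixes c :: complex
  assumes "c * c = 1"
  shows "(c * u1 - u0) * (g0 + c * g1) + (f0 - c * f1) * (v0 + c * v1) -
    ((c * v1 - v0) * (f0 + c * f1) + (g0 - c * g1) * (u0 + c * u1)) =
    2 * ((f0 * v0 - u0 * g0) - (f1 * v1 - u1 * g1))"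
proof -
  have "(c * u1 - u0) * (g0 + c * g1) + (f0 - c * f1) * (v0 + c * v1) -
    ((c * v1 - v0) * (f0 + c * f1) + (g0 - c * g1) * (u0 + c * u1)) =
    2 * ((f0 * v0 - u0 * g0) - (c * c) * (f1 * v1 - u1 * g1))"
    by (simp add: algebra_simps)
  then show ?thesis using assms by simp
qed

text \<open>Serves two ends. For \<open>d = d'\<close> the integrand is 0 and the form is Hermitian;
  for different parameters an inner product of solutions measures how the form changes with
  \<open>d\<close>.\<close>

lemma edge_form_green:
  assumes e: "edge p w d" and e': "edge p w d'"
  shows "((\<lambda>x. of_real (d' - d) * (edge_sol p w d \<alpha> \<beta> x * cnj (edge_sol p w d' \<gamma> \<delta> x))) has_integral
    edge_form p w d \<alpha> \<beta> \<gamma> \<delta> - cnj (edge_form p w d' \<gamma> \<delta> \<alpha> \<beta>)) {0..1}"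
proof -
  let ?f = "edge_sol p w d \<alpha> \<beta>" and ?g = "edge_sol p w d' \<gamma> \<delta>"
  have w0: "complex_of_real w \<noteq> 0" using edge.w_pos[OF e] by simp
  have cc: "complex_of_real (cos w) * complex_of_real (cos w) = 1"
    using edge.cos_w_sq[OF e] by (metis of_real_1 of_real_mult)
  note f = edge.edge_sol_solves[OF e, of \<alpha> \<beta>] and g = edge.edge_sol_solves[OF e', of \<gamma> \<delta>]
  note g' = solves_schroedinger_cnj[OF g]
  have I: "((\<lambda>x. (of_real (w\<^sup>2 + d) - cnj (of_real (w\<^sup>2 + d'))) * (?f x * cnj (?g x))) has_integral
    (?f 1 * cnj (unit_deriv ?g 1) - unit_deriv ?f 1 * cnj (?g 1)) -
    (?f 0 * cnj (unit_deriv ?g 0) - unit_deriv ?f 0 * cnj (?g 0))) {0..1}"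
    using green_identity[OF f g'(1)] g'(2)[of 0] g'(2)[of 1] by simp
  have gam: "2 * cnj \<gamma> = cnj (?g 0) + of_real (cos w) * cnj (?g 1)"
    "2 * (of_real w * cnj \<delta>) = cnj (unit_deriv ?g 0) + of_real (cos w) * cnj (unit_deriv ?g 1)"
    using arg_cong[OF edge.edge_sol_mid(1)[OF e', of \<gamma> \<delta>], of cnj] arg_cong[OF edge.edge_sol_mid(2)[OF e', of \<gamma> \<delta>], of cnj]
    by (simp_all add: mult.assoc)
  have alp: "2 * \<alpha> = ?f 0 + of_real (cos w) * ?f 1" "2 * (of_real w * \<beta>) = unit_deriv ?f 0 + of_real (cos w) * unit_deriv ?f 1"
    using edge.edge_sol_mid[OF e, of \<alpha> \<beta>] by (simp_all add: mult.assoc)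
  have 1: "2 * edge_form p w d \<alpha> \<beta> \<gamma> \<delta> =
     (of_real (cos w) * unit_deriv ?f 1 - unit_deriv ?f 0) * (2 * cnj \<gamma>) +
     (?f 0 - of_real (cos w) * ?f 1) * (2 * (of_real w * cnj \<delta>))"
    by (simp add: edge_form_def edge_flux_def edge_jump_def algebra_simps)
  have 2: "2 * cnj (edge_form p w d' \<gamma> \<delta> \<alpha> \<beta>) =
     (of_real (cos w) * cnj (unit_deriv ?g 1) - cnj (unit_deriv ?g 0)) * (2 * \<alpha>) +
     (cnj (?g 0) - of_real (cos w) * cnj (?g 1)) * (2 * (of_real w * \<beta>))"
    by (simp add: edge_form_def edge_flux_def edge_jump_def algebra_simps)
  have two: "a = b" if "2 * a = 2 * b" for a b :: complex using that by simp
  have "2 * (edge_form p w d \<alpha> \<beta> \<gamma> \<delta> - cnj (edge_form p w d' \<gamma> \<delta> \<alpha> \<beta>)) =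
    2 * ((?f 0 * cnj (unit_deriv ?g 0) - unit_deriv ?f 0 * cnj (?g 0)) -
      (?f 1 * cnj (unit_deriv ?g 1) - unit_deriv ?f 1 * cnj (?g 1)))"
    unfolding right_diff_distrib[of 2] 1 2 unfolding gam alp
    using boundary_form_identity[OF cc] by (simp only: right_diff_distrib[of 2])
  then have "edge_form p w d \<alpha> \<beta> \<gamma> \<delta> - cnj (edge_form p w d' \<gamma> \<delta> \<alpha> \<beta>) =
    (?f 0 * cnj (unit_deriv ?g 0) - unit_deriv ?f 0 * cnj (?g 0)) -
      (?f 1 * cnj (unit_deriv ?g 1) - unit_deriv ?f 1 * cnj (?g 1))"
    by (rule two)
  then have "edge_form p w d \<alpha> \<beta> \<gamma> \<delta> - cnj (edge_form p w d' \<gamma> \<delta> \<alpha> \<beta>) =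
    - ((?f 1 * cnj (unit_deriv ?g 1) - unit_deriv ?f 1 * cnj (?g 1)) -
      (?f 0 * cnj (unit_deriv ?g 0) - unit_deriv ?f 0 * cnj (?g 0)))"
    by simp
  moreover have "(\<lambda>x. of_real (d' - d) * (?f x * cnj (?g x))) = (\<lambda>x. - ((of_real (w\<^sup>2 + d) - cnj (of_real (w\<^sup>2 + d'))) * (?f x * cnj (?g x))))"
    by (auto simp: algebra_simps)
  ultimately show ?thesis using has_integral_neg[OF I] by simp
qed

lemma edge_form_hermitian:
  assumes e: "edge p w d"
  shows "edge_form p w d \<gamma> \<delta> \<alpha> \<beta> = cnj (edge_form p w d \<alpha> \<beta> \<gamma> \<delta>)"
proof -
  have "((\<lambda>x. 0) has_integral edge_form p w d \<gamma> \<delta> \<alpha> \<beta> - cnj (edge_form p w d \<alpha> \<beta> \<gamma> \<delta>)) {0..1::real}"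
    using edge_form_green[OF e e, of \<gamma> \<delta> \<alpha> \<beta>] by simp
  from has_integral_unique[OF this has_integral_0] show ?thesis by simp
qed

lemma edge_form_difference:
  assumes e: "edge p w d" and e': "edge p w d'"
  shows "edge_form p w d \<alpha> \<beta> \<gamma> \<delta> - edge_form p w d' \<alpha> \<beta> \<gamma> \<delta> =
    of_real (d' - d) * integral {0..1} (\<lambda>x. edge_sol p w d \<alpha> \<beta> x * cnj (edge_sol p w d' \<gamma> \<delta> x))"
  using integral_unique[OF edge_form_green[OF e e', of \<alpha> \<beta> \<gamma> \<delta>]] edge_form_hermitian[OF e', of \<alpha> \<beta> \<gamma> \<delta>]
  by (simp del: of_real_diff)

lemma edge_sol_continuous:
  assumes e: "edge p w d"
  shows "continuous_on {0..1} (edge_sol p w d \<alpha> \<beta>)"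
  by (rule abs_continuous_on_imp_continuous_on[OF solves_schroedingerD(2)[OF edge.edge_sol_solves[OF e]]])

lemma edge_form_lipschitz:
  assumes e: "edge p w d" and e': "edge p w d'"
  shows "norm (edge_form p w d \<alpha> \<beta> \<gamma> \<delta> - edge_form p w d' \<alpha> \<beta> \<gamma> \<delta>) \<le>
    \<bar>d' - d\<bar> * (4 * (norm \<alpha> + norm \<beta>) * (norm \<gamma> + norm \<delta>))"
proof -
  let ?f = "edge_sol p w d \<alpha> \<beta>" and ?g = "edge_sol p w d' \<gamma> \<delta>"
  note bf = edge.solution_bounds(1)[OF e edge.edge_sol_solves[OF e] edge.edge_sol_mid[OF e], of _ \<alpha> \<beta>]
  note bg = edge.solution_bounds(1)[OF e' edge.edge_sol_solves[OF e'] edge.edge_sol_mid[OF e'], of _ \<gamma> \<delta>]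
  have "norm (integral {0..1} (\<lambda>x. ?f x * cnj (?g x))) \<le> (4 * (norm \<alpha> + norm \<beta>) * (norm \<gamma> + norm \<delta>)) * (1 - 0)"
  proof (rule integral_bound)
    show "continuous_on {0..1} (\<lambda>x. ?f x * cnj (?g x))"
      by (intro continuous_intros edge_sol_continuous e e')
    show "norm (?f x * cnj (?g x)) \<le> 4 * (norm \<alpha> + norm \<beta>) * (norm \<gamma> + norm \<delta>)" if "x \<in> {0..1}" for x
    proof -
      have "norm (?f x * cnj (?g x)) \<le> (2 * (norm \<alpha> + norm \<beta>)) * (2 * (norm \<gamma> + norm \<delta>))"
        unfolding norm_mult complex_mod_cnj using bf[OF that] bg[OF that] by (intro mult_mono) auto
      then show ?thesis by (simp add: algebra_simps)
    qed
  qed simp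
  then show ?thesis
    unfolding edge_form_difference[OF e e'] norm_mult norm_of_real by (intro mult_left_mono) auto
qed

section \<open>Decrease of the edge form in the spectral parameter\<close>

lemma integral_trig_squares:
  fixes w :: real
  assumes "w > 0" "sin w = 0"
  shows "((\<lambda>x. (cos (w * x))\<^sup>2) has_integral 1 / 2) {0..1}"
    and "((\<lambda>x. (sin (w * x))\<^sup>2) has_integral 1 / 2) {0..1}"
    and "((\<lambda>x. cos (w * x) * sin (w * x)) has_integral 0) {0..1}"
proof -
  have "((\<lambda>x. cos (2 * w * x)) has_integral sin (2 * w * 1) / (2 * w) - sin (2 * w * 0) / (2 * w)) {0..1}"
    using assms
    by (intro fundamental_theorem_of_calculus)
      (auto intro!: derivative_eq_intros simp: has_real_derivative_iff_has_vector_derivative[symmetric])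
  then have c2: "((\<lambda>x. cos (2 * w * x)) has_integral 0) {0..1}" using assms by (simp add: sin_double)
  have c1: "((\<lambda>x. 1 / 2 :: real) has_integral 1 / 2) {0..1::real}"
    using has_integral_const_real[of "1 / 2 :: real" 0 1] by simp
  have "(\<lambda>x. (cos (w * x))\<^sup>2) = (\<lambda>x. 1 / 2 + 1 / 2 * cos (2 * w * x))"
    by (simp add: cos_double_cos mult.assoc diff_divide_distrib)
  then show "((\<lambda>x. (cos (w * x))\<^sup>2) has_integral 1 / 2) {0..1}"
    using has_integral_add[OF c1 has_integral_mult_right[OF c2, of "1 / 2"]] by simp
  have "(\<lambda>x. (sin (w * x))\<^sup>2) = (\<lambda>x. 1 / 2 - 1 / 2 * cos (2 * w * x))"
    by (simp add: cos_double_sin mult.assoc diff_divide_distrib)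
  then show "((\<lambda>x. (sin (w * x))\<^sup>2) has_integral 1 / 2) {0..1}"
    using has_integral_diff[OF c1 has_integral_mult_right[OF c2, of "1 / 2"]] by simp
  have "((\<lambda>x. cos (w * x) * sin (w * x)) has_integral (sin (w * 1))\<^sup>2 / (2 * w) - (sin (w * 0))\<^sup>2 / (2 * w)) {0..1}"
    using assms
    by (intro fundamental_theorem_of_calculus)
      (auto intro!: derivative_eq_intros simp: has_real_derivative_iff_has_vector_derivative[symmetric] field_simps)
  then show "((\<lambda>x. cos (w * x) * sin (w * x)) has_integral 0) {0..1}" using assms by simp
qed

text \<open>The change of the form is \<open>d' - d\<close> times the inner product of two solutions
  close to the same free wave. Since \<open>sin w = 0\<close>, the squared norm of that wave is
  exactly half of \<open>(norm \<alpha>)^2 + (norm \<beta>)^2\<close>; the constant 64 keeps the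
  error small enough to leave an eighth.\<close>

lemma edge_form_decrease:
  assumes e: "edge p w d" and e': "edge p w d'" and "d < d'"
    and K: "64 * integral {0..1} (\<lambda>x. \<bar>p x - d\<bar>) \<le> w" "64 * integral {0..1} (\<lambda>x. \<bar>p x - d'\<bar>) \<le> w"
  shows "Re (edge_form p w d' \<alpha> \<beta> \<alpha> \<beta>) + (d' - d) / 8 * ((norm \<alpha>)\<^sup>2 + (norm \<beta>)\<^sup>2) \<le> Re (edge_form p w d \<alpha> \<beta> \<alpha> \<beta>)"
proof -
  let ?f = "edge_sol p w d \<alpha> \<beta>" and ?g = "edge_sol p w d' \<alpha> \<beta>"
  let ?c = "\<lambda>x. complex_of_real (cos (w * x))" and ?s = "\<lambda>x. complex_of_real (sin (w * x))"
  let ?y = "\<lambda>x. \<alpha> * ?c x + \<beta> * ?s x"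
  define n where "n = norm \<alpha> + norm \<beta>"
  have w: "w > 0" "sin w = 0" using edge.w_pos[OF e] edge.sin_w[OF e] .
  have n0: "n \<ge> 0" by (simp add: n_def)
  have near: "norm (edge_sol p w dd \<alpha> \<beta> x - ?y x) \<le> n / 32" "norm (edge_sol p w dd \<alpha> \<beta> x) \<le> 2 * n"
    if ed: "edge p w dd" and x: "x \<in> {0..1}" and K: "64 * integral {0..1} (\<lambda>x. \<bar>p x - dd\<bar>) \<le> w" for dd x
  proof -
    note b = edge.solution_bounds[OF ed edge.edge_sol_solves[OF ed] edge.edge_sol_mid[OF ed] x, of \<alpha> \<beta>]
    show "norm (edge_sol p w dd \<alpha> \<beta> x) \<le> 2 * n" using b(1) by (simp add: n_def)
    \<comment> \<open>\<open>solution_bounds\<close> allows a deviation of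
      \<open>2 * L / w * n\<close> from the free wave, and \<open>64 * L \<le> w\<close> makes this
      at most \<open>n / 32\<close>.\<close>
    have "2 * integral {0..1} (\<lambda>x. \<bar>p x - dd\<bar>) / w \<le> 1 / 32" using K w by (simp add: field_simps)
    then have "2 * integral {0..1} (\<lambda>x. \<bar>p x - dd\<bar>) / w * n \<le> 1 / 32 * n" using n0 by (rule mult_right_mono)
    then show "norm (edge_sol p w dd \<alpha> \<beta> x - ?y x) \<le> n / 32"
      using b(2) unfolding edge.L_def[OF ed] edge.cosc_def[OF ed] edge.sinc_def[OF ed] n_def by simp
  qed
  have y0: "norm (?y x) \<le> n" for x
    unfolding n_def by (intro norm_triangle_le add_mono) (simp_all add: norm_mult mult_left_le)
  have pw: "(cmod (?y x))\<^sup>2 - 3 / 32 * n\<^sup>2 \<le> Re (?f x * cnj (?g x))" if x: "x \<in> {0..1}" for x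
  proof -
    have "?f x * cnj (?g x) = ?y x * cnj (?y x) + (?y x * cnj (?g x - ?y x) + (?f x - ?y x) * cnj (?g x))"
      by (simp add: algebra_simps)
    then have "Re (?f x * cnj (?g x)) = Re (?y x * cnj (?y x)) + Re (?y x * cnj (?g x - ?y x) + (?f x - ?y x) * cnj (?g x))"
      by (metis plus_complex.sel(1))
    moreover have "Re (?y x * cnj (?y x)) = (cmod (?y x))\<^sup>2" by (metis complex_norm_square Re_complex_of_real)
    moreover have "norm (?y x * cnj (?g x - ?y x) + (?f x - ?y x) * cnj (?g x)) \<le> n * (n / 32) + n / 32 * (2 * n)"
      unfolding norm_mult[of "?y x"]
      by (intro norm_triangle_le add_mono; unfold norm_mult complex_mod_cnj;
          intro mult_mono y0 near x e e' K norm_ge_zero n0 divide_nonneg_nonneg; simp)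
    moreover have "n * (n / 32) + n / 32 * (2 * n) = 3 / 32 * n\<^sup>2" by (simp add: power2_eq_square)
    ultimately show ?thesis
      using abs_Re_le_cmod[of "?y x * cnj (?g x - ?y x) + (?f x - ?y x) * cnj (?g x)"] by linarith
  qed
  have yy: "((\<lambda>x. (cmod (?y x))\<^sup>2) has_integral ((norm \<alpha>)\<^sup>2 + (norm \<beta>)\<^sup>2) / 2) {0..1}"
  proof -
    have "(cmod (?y x))\<^sup>2 = (norm \<alpha>)\<^sup>2 * (cos (w * x))\<^sup>2 + (norm \<beta>)\<^sup>2 * (sin (w * x))\<^sup>2 + 2 * Re (\<alpha> * cnj \<beta>) * (cos (w * x) * sin (w * x))" for x
      unfolding cmod_power2 by (simp add: power2_eq_square algebra_simps)
    moreover have "((\<lambda>x. (norm \<alpha>)\<^sup>2 * (cos (w * x))\<^sup>2 + (norm \<beta>)\<^sup>2 * (sin (w * x))\<^sup>2 + 2 * Re (\<alpha> * cnj \<beta>) * (cos (w * x) * sin (w * x))) has_integral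
        (norm \<alpha>)\<^sup>2 * (1 / 2) + (norm \<beta>)\<^sup>2 * (1 / 2) + 2 * Re (\<alpha> * cnj \<beta>) * 0) {0..1}"
      by (intro has_integral_add has_integral_mult_right integral_trig_squares w)
    ultimately show ?thesis by (simp add: field_simps)
  qed
  have fgi: "((\<lambda>x. ?f x * cnj (?g x)) has_integral integral {0..1} (\<lambda>x. ?f x * cnj (?g x))) {0..1}"
    by (intro integrable_integral integrable_continuous_real continuous_intros edge_sol_continuous e e')
  have fgr: "((\<lambda>x. Re (?f x * cnj (?g x))) has_integral Re (integral {0..1} (\<lambda>x. ?f x * cnj (?g x)))) {0..1}"
    using has_integral_linear[OF fgi bounded_linear_Re] by (simp add: o_def)
  have "((\<lambda>x. (cmod (?y x))\<^sup>2 - 3 / 32 * n\<^sup>2) has_integral ((norm \<alpha>)\<^sup>2 + (norm \<beta>)\<^sup>2) / 2 - 3 / 32 * n\<^sup>2) {0..1}"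
    using has_integral_diff[OF yy has_integral_const_real[of "3 / 32 * n\<^sup>2" 0 1]] by simp
  from has_integral_le[OF this fgr] pw
  have "((norm \<alpha>)\<^sup>2 + (norm \<beta>)\<^sup>2) / 2 - 3 / 32 * n\<^sup>2 \<le> Re (integral {0..1} (\<lambda>x. ?f x * cnj (?g x)))" by blast
  moreover have "n\<^sup>2 \<le> 2 * ((norm \<alpha>)\<^sup>2 + (norm \<beta>)\<^sup>2)"
    unfolding n_def using sum_squares_bound[of "norm \<alpha>" "norm \<beta>"] by (simp add: power2_sum)
  moreover have "0 \<le> (norm \<alpha>)\<^sup>2 + (norm \<beta>)\<^sup>2" by simp
  note facts = calculation this
  \<comment> \<open>With \<open>N \<le> 2 * m\<close> the error is at most
    \<open>3 / 16 * m\<close>, so \<open>5 / 16 * m\<close> remains of \<open>m / 2\<close>.\<close>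
  have arith: "m / 8 \<le> I" if "m / 2 - 3 / 32 * N \<le> I" "N \<le> 2 * m" "0 \<le> m" for m N I :: real
    using that by linarith
  from facts have "((norm \<alpha>)\<^sup>2 + (norm \<beta>)\<^sup>2) / 8 \<le> Re (integral {0..1} (\<lambda>x. ?f x * cnj (?g x)))" 
    by (rule arith)
  then have "(d' - d) * (((norm \<alpha>)\<^sup>2 + (norm \<beta>)\<^sup>2) / 8) \<le> (d' - d) * Re (integral {0..1} (\<lambda>x. ?f x * cnj (?g x)))"
    using \<open>d < d'\<close> by (intro mult_left_mono) auto
  moreover have "Re (edge_form p w d \<alpha> \<beta> \<alpha> \<beta>) - Re (edge_form p w d' \<alpha> \<beta> \<alpha> \<beta>) = (d' - d) * Re (integral {0..1} (\<lambda>x. ?f x * cnj (?g x)))"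
    using arg_cong[OF edge_form_difference[OF e e', of \<alpha> \<beta> \<alpha> \<beta>], of Re] by (simp del: of_real_diff)
  ultimately show ?thesis by simp
qed

section \<open>Asymptotics of the edge form\<close>

context edge
begin

lemma trig_double:
  "cosc t * cosc t = (1 + of_real (cos (2 * w * t))) / 2"
  "sinc t * sinc t = (1 - of_real (cos (2 * w * t))) / 2"
  "sinc t * cosc t = of_real (sin (2 * w * t)) / 2"
proof -
  have "cos (w * t) * cos (w * t) = (1 + cos (2 * w * t)) / 2"
    by (simp add: cos_double_cos mult.assoc power2_eq_square)
  then show "cosc t * cosc t = (1 + of_real (cos (2 * w * t))) / 2"
    unfolding cosc_def by (metis of_real_1 of_real_add of_real_divide of_real_mult of_real_numeral)
  have "sin (w * t) * sin (w * t) = (1 - cos (2 * w * t)) / 2"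
    by (simp add: cos_double_sin mult.assoc power2_eq_square)
  then show "sinc t * sinc t = (1 - of_real (cos (2 * w * t))) / 2"
    unfolding sinc_def by (metis of_real_1 of_real_diff of_real_divide of_real_mult of_real_numeral)
  have "sin (w * t) * cos (w * t) = sin (2 * w * t) / 2"
    by (simp add: sin_double mult.assoc)
  then show "sinc t * cosc t = of_real (sin (2 * w * t)) / 2"
    unfolding sinc_def cosc_def by (metis of_real_divide of_real_mult of_real_numeral)
qed

text \<open>Double-angle formulas split the products into a constant part and a part of frequency
  \<open>2 * w\<close>. The mean of \<open>p - d\<close> survives; the rest consists of the real and
  imaginary parts of the single Fourier coefficient \<open>Z\<close>, which tends to 0 by
  Riemann-Lebesgue.\<close>

lemma osc_main:
  fixes \<alpha> \<beta> :: complex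
  defines "Z \<equiv> integral {0..1} (\<lambda>t. complex_of_real (p t - d) * cis (2 * w * t))"
    and "I \<equiv> integral {0..1} (\<lambda>t. p t - d)"
  shows "osc cosc (\<lambda>x. \<alpha> * cosc x + \<beta> * sinc x) 1 = of_real I * (\<alpha> / 2) + of_real (Re Z) * (\<alpha> / 2) + of_real (Im Z) * (\<beta> / 2)"
    and "osc sinc (\<lambda>x. \<alpha> * cosc x + \<beta> * sinc x) 1 = of_real I * (\<beta> / 2) + of_real (Im Z) * (\<alpha> / 2) - of_real (Re Z) * (\<beta> / 2)"
proof -
  have i: "(\<lambda>t. p t - d) integrable_on {0..1}" using pd set_lebesgue_integral_eq_integral(1) by blast
  have 0: "((\<lambda>t. complex_of_real (p t - d)) has_integral of_real I) {0..1}"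
    using has_integral_linear[OF integrable_integral[OF i] bounded_linear_of_real] unfolding o_def I_def .
  have "continuous_on {0..1} (\<lambda>t. cis (2 * w * t))" by (intro continuous_intros)
  then have "(\<lambda>t. complex_of_real (p t - d) * cis (2 * w * t)) integrable_on {0..1}"
    using absolutely_integrable_mult_continuous[OF absolutely_integrable_of_real[OF pd]] set_lebesgue_integral_eq_integral(1) by blast
  then have z: "((\<lambda>t. complex_of_real (p t - d) * cis (2 * w * t)) has_integral Z) {0..1}"
    unfolding Z_def by (rule integrable_integral)
  have 1: "((\<lambda>t. complex_of_real ((p t - d) * cos (2 * w * t))) has_integral of_real (Re Z)) {0..1}"
    using has_integral_linear[OF has_integral_linear[OF z bounded_linear_Re] bounded_linear_of_real] by (simp add: o_def)
  have 2: "((\<lambda>t. complex_of_real ((p t - d) * sin (2 * w * t))) has_integral of_real (Im Z)) {0..1}"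
    using has_integral_linear[OF has_integral_linear[OF z bounded_linear_Im] bounded_linear_of_real] by (simp add: o_def)
  have "complex_of_real (p t - d) * (\<alpha> / 2) + complex_of_real ((p t - d) * cos (2 * w * t)) * (\<alpha> / 2) + complex_of_real ((p t - d) * sin (2 * w * t)) * (\<beta> / 2) =
      complex_of_real (p t - d) * (\<alpha> * cosc t + \<beta> * sinc t) * cosc t" for t
  proof -
    have "complex_of_real (p t - d) * (\<alpha> * cosc t + \<beta> * sinc t) * cosc t =
      complex_of_real (p t - d) * (\<alpha> * (cosc t * cosc t) + \<beta> * (sinc t * cosc t))"
      by (simp only: ring_distribs mult.assoc)
    then show ?thesis unfolding trig_double of_real_mult
      by (simp add: add_divide_distrib ring_distribs mult_ac del: of_real_diff)
  qed
  then have "((\<lambda>t. complex_of_real (p t - d) * (\<alpha> * cosc t + \<beta> * sinc t) * cosc t) has_integral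
      of_real I * (\<alpha> / 2) + of_real (Re Z) * (\<alpha> / 2) + of_real (Im Z) * (\<beta> / 2)) {0..1}"
    using has_integral_add[OF has_integral_add[OF has_integral_mult_left[OF 0, of "\<alpha> / 2"] has_integral_mult_left[OF 1, of "\<alpha> / 2"]]
      has_integral_mult_left[OF 2, of "\<beta> / 2"]] by (simp only:)
  then show "osc cosc (\<lambda>x. \<alpha> * cosc x + \<beta> * sinc x) 1 = of_real I * (\<alpha> / 2) + of_real (Re Z) * (\<alpha> / 2) + of_real (Im Z) * (\<beta> / 2)"
    unfolding osc_def by (rule integral_unique)
  have "complex_of_real (p t - d) * (\<beta> / 2) + complex_of_real ((p t - d) * sin (2 * w * t)) * (\<alpha> / 2) - complex_of_real ((p t - d) * cos (2 * w * t)) * (\<beta> / 2) =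
      complex_of_real (p t - d) * (\<alpha> * cosc t + \<beta> * sinc t) * sinc t" for t
  proof -
    have "complex_of_real (p t - d) * (\<alpha> * cosc t + \<beta> * sinc t) * sinc t =
      complex_of_real (p t - d) * (\<alpha> * (sinc t * cosc t) + \<beta> * (sinc t * sinc t))"
      by (simp only: ring_distribs mult_ac)
    then show ?thesis unfolding trig_double of_real_mult
      by (simp add: add_divide_distrib diff_divide_distrib ring_distribs mult_ac del: of_real_diff)
  qed
  then have "((\<lambda>t. complex_of_real (p t - d) * (\<alpha> * cosc t + \<beta> * sinc t) * sinc t) has_integral
      of_real I * (\<beta> / 2) + of_real (Im Z) * (\<alpha> / 2) - of_real (Re Z) * (\<beta> / 2)) {0..1}"
    using has_integral_diff[OF has_integral_add[OF has_integral_mult_left[OF 0, of "\<beta> / 2"] has_integral_mult_left[OF 2, of "\<alpha> / 2"]]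
      has_integral_mult_left[OF 1, of "\<beta> / 2"]] by (simp only:)
  then show "osc sinc (\<lambda>x. \<alpha> * cosc x + \<beta> * sinc x) 1 = of_real I * (\<beta> / 2) + of_real (Im Z) * (\<alpha> / 2) - of_real (Re Z) * (\<beta> / 2)"
    unfolding osc_def by (rule integral_unique)
qed

text \<open>Replacing the solution by its free wave changes it by order \<open>L / w\<close>, inside
  an integral of total weight \<open>L\<close>.\<close>

lemma edge_approx:
  "norm (edge_flux p w d \<alpha> \<beta> - osc cosc (\<lambda>x. \<alpha> * cosc x + \<beta> * sinc x) 1) \<le> L * (2 * L * (norm \<alpha> + norm \<beta>)) / w"
  "norm (edge_jump p w d \<alpha> \<beta> - osc sinc (\<lambda>x. \<alpha> * cosc x + \<beta> * sinc x) 1) \<le> L * (2 * L * (norm \<alpha> + norm \<beta>)) / w"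
proof -
  let ?f = "edge_sol p w d \<alpha> \<beta>" and ?y = "\<lambda>x. \<alpha> * cosc x + \<beta> * sinc x"
  have fc: "continuous_on {0..1} ?f"
    by (rule abs_continuous_on_imp_continuous_on[OF solves_schroedingerD(2)[OF edge_sol_solves]])
  have yc: "continuous_on {0..1} ?y" by (intro continuous_intros trig_cont)
  have *: "norm (osc s ?f 1 - osc s ?y 1) \<le> L * (2 * L * (norm \<alpha> + norm \<beta>)) / w"
    if s: "continuous_on {0..1} s" "\<And>x. norm (s x) \<le> 1" for s
  proof -
    have "norm (osc s (\<lambda>t. ?f t - ?y t) 1 - 2 * osc s (\<lambda>t. ?f t - ?y t) 0) \<le> L * (2 * L / w * (norm \<alpha> + norm \<beta>))"
      by (rule osc_bound[OF continuous_on_diff[OF fc yc] s(1) solution_bounds(2)[OF edge_sol_solves edge_sol_mid] s(2)]) auto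
    then show ?thesis using osc_diff[OF fc yc s(1), of 1] by (simp add: osc_at_0)
  qed
  show "norm (edge_flux p w d \<alpha> \<beta> - osc cosc ?y 1) \<le> L * (2 * L * (norm \<alpha> + norm \<beta>)) / w"
    unfolding edge_flux_def solution_ends(2)[OF edge_sol_solves] by (rule *[OF trig_cont(1) trig_norm(1)])
  show "norm (edge_jump p w d \<alpha> \<beta> - osc sinc ?y 1) \<le> L * (2 * L * (norm \<alpha> + norm \<beta>)) / w"
    unfolding edge_jump_def solution_ends(1)[OF edge_sol_solves] by (rule *[OF trig_cont(2) trig_norm(2)])
qed

end

lemma edge_form_tendsto:
  fixes p :: "real \<Rightarrow> real" and w :: "'k \<Rightarrow> real"
  assumes p: "p absolutely_integrable_on {0..1}" and w: "filterlim w at_top F"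
    and sin: "\<And>k. sin (w k) = 0"
  shows "((\<lambda>k. edge_form p (w k) d \<alpha> \<beta> \<gamma> \<delta>) \<longlongrightarrow>
    of_real ((integral {0..1} p - d) / 2) * (\<alpha> * cnj \<gamma> + \<beta> * cnj \<delta>)) F"
proof -
  define L where "L = integral {0..1} (\<lambda>x. \<bar>p x - d\<bar>)"
  define I where "I = integral {0..1} (\<lambda>t. p t - d)"
  define Z where "Z k = integral {0..1} (\<lambda>t. complex_of_real (p t - d) * cis (2 * w k * t))" for k
  have pd: "(\<lambda>x. p x - d) absolutely_integrable_on {0..1}"
    by (intro set_integral_diff(1) p absolutely_integrable_continuous_real) auto
  have I: "I = integral {0..1} p - d"
    unfolding I_def using p set_lebesgue_integral_eq_integral(1)
    by (subst integral_diff) auto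
  have "filterlim (\<lambda>k. 2 * w k) at_top F"
    by (rule filterlim_tendsto_pos_mult_at_top[OF tendsto_const _ w]) simp
  from riemann_lebesgue[OF absolutely_integrable_of_real[OF pd] this]
  have Z0: "(Z \<longlongrightarrow> 0) F" unfolding Z_def .
  have Re0: "((\<lambda>k. complex_of_real (Re (Z k))) \<longlongrightarrow> 0) F" and Im0: "((\<lambda>k. complex_of_real (Im (Z k))) \<longlongrightarrow> 0) F"
    using tendsto_of_real[OF tendsto_Re[OF Z0]] tendsto_of_real[OF tendsto_Im[OF Z0]] by simp_all
  have ev: "\<forall>\<^sub>F k in F. edge p (w k) d"
  proof -
    have "\<forall>\<^sub>F k in F. w k > 0" "\<forall>\<^sub>F k in F. w k > 2 * L"
      using w by (simp_all add: filterlim_at_top_dense)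
    then show ?thesis
      by eventually_elim (auto simp: edge_def p sin L_def)
  qed
  have inv: "((\<lambda>k. L * (2 * L * (norm \<alpha> + norm \<beta>)) / w k) \<longlongrightarrow> 0) F"
    by (rule real_tendsto_divide_at_top[OF tendsto_const w])
  have flux: "((\<lambda>k. edge_flux p (w k) d \<alpha> \<beta>) \<longlongrightarrow> of_real I * (\<alpha> / 2)) F"
  proof -
    have "((\<lambda>k. edge_flux p (w k) d \<alpha> \<beta> - (of_real I * (\<alpha> / 2) + of_real (Re (Z k)) * (\<alpha> / 2) + of_real (Im (Z k)) * (\<beta> / 2))) \<longlongrightarrow> 0) F"
    proof (rule tendsto_norm_zero_cancel, rule tendsto_sandwich[OF _ _ tendsto_const inv])
      show "\<forall>\<^sub>F k in F. norm (edge_flux p (w k) d \<alpha> \<beta> - (of_real I * (\<alpha> / 2) + of_real (Re (Z k)) * (\<alpha> / 2) + of_real (Im (Z k)) * (\<beta> / 2)))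
          \<le> L * (2 * L * (norm \<alpha> + norm \<beta>)) / w k"
        using ev
      proof eventually_elim
        case (elim k)
        show ?case
          using edge.edge_approx(1)[OF elim, of \<alpha> \<beta>]
          unfolding edge.osc_main(1)[OF elim] edge.L_def[OF elim] I_def Z_def L_def .
      qed
    qed auto
    moreover have "((\<lambda>k. of_real I * (\<alpha> / 2) + of_real (Re (Z k)) * (\<alpha> / 2) + of_real (Im (Z k)) * (\<beta> / 2)) \<longlongrightarrow>
        of_real I * (\<alpha> / 2) + 0 * (\<alpha> / 2) + 0 * (\<beta> / 2)) F"
      by (intro tendsto_intros Re0 Im0)
    ultimately show ?thesis using tendsto_add by fastforce
  qed
  have jump: "((\<lambda>k. edge_jump p (w k) d \<alpha> \<beta>) \<longlongrightarrow> of_real I * (\<beta> / 2)) F"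
  proof -
    have "((\<lambda>k. edge_jump p (w k) d \<alpha> \<beta> - (of_real I * (\<beta> / 2) + of_real (Im (Z k)) * (\<alpha> / 2) - of_real (Re (Z k)) * (\<beta> / 2))) \<longlongrightarrow> 0) F"
    proof (rule tendsto_norm_zero_cancel, rule tendsto_sandwich[OF _ _ tendsto_const inv])
      show "\<forall>\<^sub>F k in F. norm (edge_jump p (w k) d \<alpha> \<beta> - (of_real I * (\<beta> / 2) + of_real (Im (Z k)) * (\<alpha> / 2) - of_real (Re (Z k)) * (\<beta> / 2)))
          \<le> L * (2 * L * (norm \<alpha> + norm \<beta>)) / w k"
        using ev
      proof eventually_elim
        case (elim k)
        show ?case
          using edge.edge_approx(2)[OF elim, of \<alpha> \<beta>]
          unfolding edge.osc_main(2)[OF elim] edge.L_def[OF elim] I_def Z_def L_def .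
      qed
    qed auto
    moreover have "((\<lambda>k. of_real I * (\<beta> / 2) + of_real (Im (Z k)) * (\<alpha> / 2) - of_real (Re (Z k)) * (\<beta> / 2)) \<longlongrightarrow>
        of_real I * (\<beta> / 2) + 0 * (\<alpha> / 2) - 0 * (\<beta> / 2)) F"
      by (intro tendsto_intros Re0 Im0)
    ultimately show ?thesis using tendsto_add by fastforce
  qed
  have "((\<lambda>k. edge_form p (w k) d \<alpha> \<beta> \<gamma> \<delta>) \<longlongrightarrow> of_real I * (\<alpha> / 2) * cnj \<gamma> + of_real I * (\<beta> / 2) * cnj \<delta>) F"
    unfolding edge_form_def by (intro tendsto_intros flux jump)
  moreover have "of_real I * (\<alpha> / 2) * cnj \<gamma> + of_real I * (\<beta> / 2) * cnj \<delta> =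
      of_real ((integral {0..1} p - d) / 2) * (\<alpha> * cnj \<gamma> + \<beta> * cnj \<delta>)"
    unfolding I[symmetric] by (simp add: algebra_simps)
  ultimately show ?thesis by (simp only:)
qed

section \<open>Forms on vertex values and edge flows\<close>

definition vscale :: "complex \<Rightarrow> ('i \<Rightarrow> complex) \<Rightarrow> 'i \<Rightarrow> complex" where
  "vscale c x = (\<lambda>i. c * x i)"

interpretation cvec: complex_space "vscale :: complex \<Rightarrow> ('i \<Rightarrow> complex) \<Rightarrow> 'i \<Rightarrow> complex"
  by unfold_locales (auto simp: vscale_def fun_eq_iff algebra_simps)

lemma vscale_at: "vscale c x i = c * x i"
  by (simp add: vscale_def)

lemma sum_fun_at: "(\<Sum>b\<in>S. f b) i = (\<Sum>b\<in>S. f b i)" for f :: "'a \<Rightarrow> 'i \<Rightarrow> complex"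
  by (induction S rule: infinite_finite_induct) auto

text \<open>Evaluation at \<open>c j\<close> is dual to \<open>f j\<close> and so reads off its
  coefficient in any linear relation.\<close>

lemma cvec_independent_family:
  fixes f :: "'j \<Rightarrow> 'i \<Rightarrow> complex"
  assumes "finite J" and f: "\<And>j j'. j \<in> J \<Longrightarrow> j' \<in> J \<Longrightarrow> f j (c j') = (if j = j' then 1 else 0)"
  shows "cvec.independent (f ` J)" and "inj_on f J"
proof -
  show inj: "inj_on f J"
    by (rule inj_onI) (metis f zero_neq_one)
  show "cvec.independent (f ` J)"
  proof (rule cvec.independent_if_scalars_zero)
    fix u v assume 0: "(\<Sum>x\<in>f ` J. vscale (u x) x) = 0" and "v \<in> f ` J"
    then obtain j where j: "j \<in> J" "v = f j" by auto
    have "0 = (\<Sum>x\<in>f ` J. vscale (u x) x) (c j)" using 0 by simp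
    also have "\<dots> = (\<Sum>i\<in>J. u (f i) * f i (c j))"
      by (simp add: sum.reindex[OF inj] sum_fun_at vscale_at)
    also have "\<dots> = (\<Sum>i\<in>J. if i = j then u (f j) else 0)"
      using f j by (intro sum.cong) auto
    also have "\<dots> = u v" using j assms(1) by (subst sum.delta) auto
    finally show "u v = 0" by simp
  qed (use assms in auto)
qed

definition unit_vec :: "'i \<Rightarrow> 'i \<Rightarrow> complex" where
  "unit_vec i = (\<lambda>j. if j = i then 1 else 0)"

section \<open>The graph, its coordinates and its three forms\<close>

locale metric_graph = fin_digraph G for G :: "('v, 'e) pre_digraph" +
  fixes q :: "'e \<Rightarrow> real \<Rightarrow> real"
  assumes conn: "Digraph_Component.connected G" and arcs_ne: "arcs G \<noteq> {}"
    and q: "\<And>e. e \<in> arcs G \<Longrightarrow> q e absolutely_integrable_on {0..1}"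
begin

text \<open>A vector \<open>x\<close> carries vertex values \<open>x (Inl v)\<close> and one flow value \<open>x (Inr e)\<close> per edge:
  the midpoints of the cosine and sine amplitudes on \<open>e\<close> are \<open>avg x e\<close> and \<open>x (Inr e)\<close>.\<close>

definition index_set :: "('v + 'e) set" where "index_set = Inl ` verts G \<union> Inr ` arcs G"

definition space :: "('v + 'e \<Rightarrow> complex) set" where "space = {x. \<forall>i. i \<notin> index_set \<longrightarrow> x i = 0}"

definition diff :: "('v + 'e \<Rightarrow> complex) \<Rightarrow> 'e \<Rightarrow> complex" where
  "diff x e = x (Inl (head G e)) - x (Inl (tail G e))"

definition avg :: "('v + 'e \<Rightarrow> complex) \<Rightarrow> 'e \<Rightarrow> complex" where
  "avg x e = (x (Inl (tail G e)) + x (Inl (head G e))) / 2"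

definition Q :: "'e \<Rightarrow> real" where "Q e = integral {0..1} (q e)"

definition B :: "('v + 'e \<Rightarrow> complex) \<Rightarrow> ('v + 'e \<Rightarrow> complex) \<Rightarrow> complex" where
  "B x y = (\<Sum>e\<in>arcs G. diff x e * cnj (y (Inr e)) + x (Inr e) * cnj (diff y e))"

definition M :: "real \<Rightarrow> ('v + 'e \<Rightarrow> complex) \<Rightarrow> ('v + 'e \<Rightarrow> complex) \<Rightarrow> complex" where
  "M d x y = (\<Sum>e\<in>arcs G. of_real ((Q e - d) / 2) * (avg x e * cnj (avg y e) + x (Inr e) * cnj (y (Inr e))))"

definition H :: "real \<Rightarrow> real \<Rightarrow> ('v + 'e \<Rightarrow> complex) \<Rightarrow> ('v + 'e \<Rightarrow> complex) \<Rightarrow> complex" where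
  "H w d x y = of_real w * B x y +
     (\<Sum>e\<in>arcs G. edge_form (q e) w d (avg x e) (x (Inr e)) (avg y e) (y (Inr e)))"

lemma connected_induct:
  assumes "u \<in> verts G" "v \<in> verts G" "P u"
    and "\<And>e. e \<in> arcs G \<Longrightarrow> P (tail G e) \<Longrightarrow> P (head G e)"
    and "\<And>e. e \<in> arcs G \<Longrightarrow> P (head G e) \<Longrightarrow> P (tail G e)"
  shows "P v"
proof -
  have "(u, v) \<in> rtrancl_on (verts G) (parcs (mk_symmetric G))"
    using conn assms(1,2)
    by (auto simp: Digraph_Component.connected_def strongly_connected_def reachable_def)
  then show ?thesis
  proof (induction rule: rtrancl_on_induct)
    case (step y z)
    then show ?case using assms(4,5) by (auto simp: parcs_mk_symmetric)
  qed (use assms in auto)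
qed

lemma diff_zero_const:
  assumes "\<And>e. e \<in> arcs G \<Longrightarrow> diff x e = 0" "u \<in> verts G" "v \<in> verts G"
  shows "x (Inl u) = x (Inl v)"
  using assms(2,3) by (rule connected_induct[where P = "\<lambda>v. x (Inl u) = x (Inl v)"]) (use assms(1) in \<open>auto simp: diff_def\<close>)

text \<open>Connectedness by itself permits a single bare vertex; once one edge exists, the property
  of being an end point spreads to all vertices.\<close>

lemma endpoint_exists:
  assumes "v \<in> verts G"
  obtains e where "e \<in> arcs G" "tail G e = v \<or> head G e = v"
proof -
  obtain e0 where e0: "e0 \<in> arcs G" using arcs_ne by auto
  have "\<exists>e\<in>arcs G. tail G e = v \<or> head G e = v"
    by (rule connected_induct[of "tail G e0" v "\<lambda>v. \<exists>e\<in>arcs G. tail G e = v \<or> head G e = v"])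
      (use e0 assms in auto)
  then show ?thesis using that by blast
qed

lemma verts_ne: "verts G \<noteq> {}"
  using arcs_ne tail_in_verts by fastforce

lemma fin_index: "finite index_set" by (simp add: index_set_def)

lemma card_index: "card index_set = card (verts G) + card (arcs G)"
  unfolding index_set_def by (subst card_Un_disjoint) (auto simp: card_image)

lemma space_subspace: "cvec.subspace space"
  by (auto simp: cvec.subspace_def space_def vscale_at)

lemma unit_family:
  "cvec.independent (unit_vec ` index_set)" "inj_on unit_vec index_set"
  by (rule cvec_independent_family[OF fin_index, of _ id]; auto simp: unit_vec_def)+

lemma unit_in_space: "i \<in> index_set \<Longrightarrow> unit_vec i \<in> space"
  by (auto simp: space_def unit_vec_def)

lemma space_eq_span: "space = cvec.span (unit_vec ` index_set)"
proof
  show "cvec.span (unit_vec ` index_set) \<subseteq> space"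
    by (rule cvec.span_minimal[OF _ space_subspace]) (use unit_in_space in auto)
  show "space \<subseteq> cvec.span (unit_vec ` index_set)"
  proof
    fix x assume x: "x \<in> space"
    have "x = (\<Sum>i\<in>index_set. vscale (x i) (unit_vec i))"
    proof
      fix j
      have "(\<Sum>i\<in>index_set. vscale (x i) (unit_vec i)) j = (\<Sum>i\<in>index_set. if i = j then x j else 0)"
        unfolding sum_fun_at by (intro sum.cong) (auto simp: vscale_at unit_vec_def)
      also have "\<dots> = x j" using x fin_index by (simp add: space_def)
      finally show "x j = (\<Sum>i\<in>index_set. vscale (x i) (unit_vec i)) j" by simp
    qed
    moreover have "(\<Sum>i\<in>index_set. vscale (x i) (unit_vec i)) \<in> cvec.span (unit_vec ` index_set)"
      by (intro cvec.span_sum cvec.span_scale cvec.span_base) auto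
    ultimately show "x \<in> cvec.span (unit_vec ` index_set)" by simp
  qed
qed

lemma space_sub: "space \<subseteq> cvec.span (unit_vec ` index_set)" "finite (unit_vec ` index_set)"
  using space_eq_span fin_index by auto

lemma dim_space: "cvec.dim space = card (verts G) + card (arcs G)"
  unfolding space_eq_span cvec.dim_span_eq_card_independent[OF unit_family(1)]
    card_image[OF unit_family(2)] card_index ..

lemma coord_linear:
  "diff (x + y) e = diff x e + diff y e" "diff (vscale c x) e = c * diff x e"
  "avg (x + y) e = avg x e + avg y e" "avg (vscale c x) e = c * avg x e"
  "diff 0 e = 0" "avg 0 e = 0"
  by (simp_all add: diff_def avg_def vscale_at algebra_simps add_divide_distrib)

lemma B_hermitian: "cvec.hermitian B"
  unfolding cvec.hermitian_def
proof (intro conjI allI)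
  show "B (x + y) z = B x z + B y z" for x y z
    unfolding B_def by (simp add: coord_linear sum.distrib[symmetric] algebra_simps)
  show "B (vscale c x) y = c * B x y" for c x y
    unfolding B_def sum_distrib_left by (intro sum.cong) (simp_all add: coord_linear vscale_at algebra_simps)
  show "B y x = cnj (B x y)" for x y
    unfolding B_def cnj_sum by (intro sum.cong) auto
qed

lemma M_hermitian: "cvec.hermitian (M d)"
  unfolding cvec.hermitian_def
proof (intro conjI allI)
  show "M d (x + y) z = M d x z + M d y z" for x y z
    unfolding M_def sum.distrib[symmetric] by (intro sum.cong) (simp_all add: coord_linear algebra_simps)
  show "M d (vscale c x) y = c * M d x y" for c x y
    unfolding M_def sum_distrib_left by (intro sum.cong) (simp_all add: coord_linear vscale_at algebra_simps)
  show "M d y x = cnj (M d x y)" for x y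
    unfolding M_def cnj_sum by (intro sum.cong) auto
qed

lemma H_hermitian:
  assumes "\<And>e. e \<in> arcs G \<Longrightarrow> edge (q e) w d"
  shows "cvec.hermitian (H w d)"
  unfolding cvec.hermitian_def
proof (intro conjI allI)
  note lin = edge.edge_form_linear[OF assms]
  show "H w d (x + y) z = H w d x z + H w d y z" for x y z
  proof -
    have "(\<Sum>e\<in>arcs G. edge_form (q e) w d (avg (x + y) e) ((x + y) (Inr e)) (avg z e) (z (Inr e))) =
      (\<Sum>e\<in>arcs G. edge_form (q e) w d (avg x e) (x (Inr e)) (avg z e) (z (Inr e)) +
        edge_form (q e) w d (avg y e) (y (Inr e)) (avg z e) (z (Inr e)))"
      using lin[where c = 1 and e = 1] by (intro sum.cong) (simp_all add: coord_linear)
    then show ?thesis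
      unfolding H_def sum.distrib cvec.hermitian_add_left[OF B_hermitian] by (simp add: algebra_simps)
  qed
  show "H w d (vscale c x) y = c * H w d x y" for c x y
  proof -
    have "(\<Sum>e\<in>arcs G. edge_form (q e) w d (avg (vscale c x) e) ((vscale c x) (Inr e)) (avg y e) (y (Inr e))) =
      (\<Sum>e\<in>arcs G. c * edge_form (q e) w d (avg x e) (x (Inr e)) (avg y e) (y (Inr e)))"
      using lin[where c = c and e = 0] by (intro sum.cong) (simp_all add: coord_linear vscale_at)
    then show ?thesis
      unfolding H_def cvec.hermitian_scale_left[OF B_hermitian] sum_distrib_left[symmetric] by (simp add: algebra_simps)
  qed
  show "H w d y x = cnj (H w d x y)" for x y
  proof -
    have "(\<Sum>e\<in>arcs G. edge_form (q e) w d (avg y e) (y (Inr e)) (avg x e) (x (Inr e))) =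
      cnj (\<Sum>e\<in>arcs G. edge_form (q e) w d (avg x e) (x (Inr e)) (avg y e) (y (Inr e)))"
      unfolding cnj_sum by (intro sum.cong edge_form_hermitian assms) auto
    then show ?thesis unfolding H_def using cvec.hermitian_sym[OF B_hermitian, of y x] by simp
  qed
qed

section \<open>Signature of the pairing of differences and flows\<close>

definition cut_vec :: "real \<Rightarrow> 'v \<Rightarrow> 'v + 'e \<Rightarrow> complex" where
  "cut_vec \<sigma> v = (\<lambda>i. case i of Inl u \<Rightarrow> if u = v then 1 else 0
     | Inr e \<Rightarrow> if e \<in> arcs G then of_real \<sigma> * ((if head G e = v then 1 else 0) - (if tail G e = v then 1 else 0)) else 0)"

text \<open>On the span, the flow is \<open>\<sigma>\<close> times the potential difference, so
  \<open>\<sigma> * B x x\<close> is \<open>2 * \<sigma>^2\<close> times the sum of the squared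
  differences. Omitting one vertex removes the constants, which by connectedness are the only
  potentials without differences. \<open>\<sigma> = 1\<close> serves the positive part and
  \<open>\<sigma> = -1\<close> the negative one.\<close>

lemma cut_positive:
  assumes "v0 \<in> verts G" and \<sigma>: "\<sigma> \<noteq> 0"
  shows "cvec.positive_on (\<lambda>x y. of_real \<sigma> * B x y) (cvec.span (cut_vec \<sigma> ` (verts G - {v0})))"
    and "cvec.independent (cut_vec \<sigma> ` (verts G - {v0}))"
    and "card (cut_vec \<sigma> ` (verts G - {v0})) = card (verts G) - 1"
    and "cut_vec \<sigma> ` (verts G - {v0}) \<subseteq> space"
proof -
  have fam: "cut_vec \<sigma> j (Inl j') = (if j = j' then 1 else 0)" for j j' by (auto simp: cut_vec_def)
  show "cvec.independent (cut_vec \<sigma> ` (verts G - {v0}))"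
    by (rule cvec_independent_family(1)[where c = Inl]) (use fam in auto)
  have "inj_on (cut_vec \<sigma>) (verts G - {v0})"
    by (rule cvec_independent_family(2)[where c = Inl]) (use fam in auto)
  then show "card (cut_vec \<sigma> ` (verts G - {v0})) = card (verts G) - 1"
    using assms by (simp add: card_image)
  show sp: "cut_vec \<sigma> ` (verts G - {v0}) \<subseteq> space"
    by (auto simp: space_def cut_vec_def index_set_def split: sum.splits)
  define S where "S = {x \<in> space. x (Inl v0) = 0 \<and> (\<forall>e\<in>arcs G. x (Inr e) = of_real \<sigma> * diff x e)}"
  have "cvec.subspace S"
    using space_subspace unfolding S_def cvec.subspace_def
    by (auto simp: coord_linear vscale_at algebra_simps)
  moreover have "cut_vec \<sigma> ` (verts G - {v0}) \<subseteq> S"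
    using sp by (auto simp: S_def diff_def cut_vec_def)
  ultimately have sub: "cvec.span (cut_vec \<sigma> ` (verts G - {v0})) \<subseteq> S"
    by (intro cvec.span_minimal)
  show "cvec.positive_on (\<lambda>x y. of_real \<sigma> * B x y) (cvec.span (cut_vec \<sigma> ` (verts G - {v0})))"
    unfolding cvec.positive_on_def
  proof (intro ballI impI)
    fix x assume x: "x \<in> cvec.span (cut_vec \<sigma> ` (verts G - {v0}))" "x \<noteq> 0"
    then have xS: "x \<in> S" using sub by auto
    have "of_real \<sigma> * B x x = (\<Sum>e\<in>arcs G. of_real (2 * \<sigma>\<^sup>2 * (cmod (diff x e))\<^sup>2))"
      unfolding B_def sum_distrib_left
    proof (intro sum.cong refl)
      fix e assume "e \<in> arcs G"
      then have f: "x (Inr e) = of_real \<sigma> * diff x e" using xS by (simp add: S_def)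
      have "of_real \<sigma> * (diff x e * cnj (x (Inr e)) + x (Inr e) * cnj (diff x e)) =
        of_real (2 * \<sigma>\<^sup>2) * (diff x e * cnj (diff x e))"
        unfolding f by (simp add: algebra_simps power2_eq_square)
      then show "of_real \<sigma> * (diff x e * cnj (x (Inr e)) + x (Inr e) * cnj (diff x e)) = of_real (2 * \<sigma>\<^sup>2 * (cmod (diff x e))\<^sup>2)"
        by (simp only: of_real_mult complex_norm_square)
    qed
    then have eq: "Re (of_real \<sigma> * B x x) = (\<Sum>e\<in>arcs G. 2 * \<sigma>\<^sup>2 * (cmod (diff x e))\<^sup>2)"
      by (simp only: Re_sum Re_complex_of_real)
    have "\<exists>e\<in>arcs G. diff x e \<noteq> 0"
    proof (rule ccontr)
      assume "\<not> ?thesis"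
      then have d0: "\<And>e. e \<in> arcs G \<Longrightarrow> diff x e = 0" by blast
      have "x i = 0" for i
      proof (cases "i \<in> index_set")
        case True
        then show ?thesis
          using diff_zero_const[OF d0 _ assms(1)] xS d0 by (auto simp: index_set_def S_def)
      qed (use xS in \<open>auto simp: S_def space_def\<close>)
      then show False using x(2) by (auto simp: fun_eq_iff)
    qed
    then obtain e where "e \<in> arcs G" "diff x e \<noteq> 0" by blast
    then show "0 < Re (of_real \<sigma> * B x x)"
      unfolding eq using \<sigma> by (intro sum_pos2[of _ e]) auto
  qed
qed

definition const_vec :: "'v + 'e \<Rightarrow> complex" where
  "const_vec = (\<lambda>i. case i of Inl u \<Rightarrow> if u \<in> verts G then 1 else 0 | Inr e \<Rightarrow> 0)"

lemma const_vec_coords: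
  "e \<in> arcs G \<Longrightarrow> diff const_vec e = 0" "e \<in> arcs G \<Longrightarrow> avg const_vec e = 1"
  "const_vec (Inr e) = 0" "const_vec \<in> space"
  by (auto simp: const_vec_def diff_def avg_def space_def index_set_def split: sum.splits)

text \<open>Cut vectors bound both indices from below by |V| - 1. The constants and all flows
  together span an isotropic space of dimension |E| + 1; it meets positive and negative subspaces
  only in 0 and so gives the same bound from above. What is left over is the radical.\<close>

lemma B_sylvester:
  obtains P Z N where "cvec.sylvester B space P Z N" "card P = card (verts G) - 1"
    "card N = card (verts G) - 1" "card Z + card (verts G) = card (arcs G) + 2"
proof -
  obtain P Z N where s: "cvec.sylvester B space P Z N"
    using cvec.sylvester_exists[OF B_hermitian space_subspace space_sub] .
  note Bs = B_hermitian s
  obtain v0 where v0: "v0 \<in> verts G" using verts_ne by auto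
  have V1: "card (verts G) \<ge> 1" using v0 by (simp add: Suc_le_eq card_gt_0_iff verts_ne)
  note cp = cut_positive[OF v0, of 1, simplified] and cn = cut_positive[OF v0, of "-1", simplified]
  have P: "card (verts G) - 1 \<le> card P"
    using cvec.sylvester_positive_le[OF Bs cp(2,4,1)] cp(3) by simp
  have N: "card (verts G) - 1 \<le> card N"
    using cvec.sylvester_negative_le[OF Bs cn(2,4,1)] cn(3) by simp
  define f where "f j = (case j of None \<Rightarrow> const_vec | Some e \<Rightarrow> unit_vec (Inr e))" for j :: "'e option"
  define J where "J = insert None (Some ` arcs G)"
  define T where "T = f ` J"
  \<comment> \<open>Coordinates dual to the family \<open>f\<close>: the value at one fixed vertex
    for the constants, the flow on \<open>e\<close> for the unit flow of \<open>e\<close>.\<close>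
  define c :: "'e option \<Rightarrow> 'v + 'e" where "c j = (case j of None \<Rightarrow> Inl v0 | Some e \<Rightarrow> Inr e)" for j
  have fam: "f j (c j') = (if j = j' then 1 else 0)" for j j'
    using v0 by (auto simp: f_def c_def const_vec_def unit_vec_def split: option.splits)
  have finJ: "finite J" by (simp add: J_def)
  have T: "cvec.independent T" unfolding T_def by (rule cvec_independent_family(1)[where f = f and c = c, OF finJ fam])
  have cT: "card T = card (arcs G) + 1"
    unfolding T_def using cvec_independent_family(2)[where f = f and c = c, OF finJ fam]
    by (subst card_image) (auto simp: J_def card_image)
  have Tsp: "T \<subseteq> space"
    by (auto simp: T_def J_def f_def const_vec_coords intro!: unit_in_space) (simp add: index_set_def)
  define S where "S = {x. \<forall>e\<in>arcs G. diff x e = 0}"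
  have "cvec.subspace S"
    unfolding S_def cvec.subspace_def by (auto simp: coord_linear)
  moreover have "T \<subseteq> S"
    by (auto simp: T_def J_def f_def S_def const_vec_coords) (simp add: diff_def unit_vec_def)
  ultimately have "cvec.span T \<subseteq> S" by (intro cvec.span_minimal)
  then have iso: "B x x = 0" if "x \<in> cvec.span T" for x
    using that unfolding B_def S_def by (intro sum.neutral) auto
  have dimle: "cvec.dim (cvec.span (unit_vec ` index_set)) \<le> card (verts G) + card (arcs G)"
    using dim_space space_eq_span by simp
  have "card P + card T \<le> card (verts G) + card (arcs G)"
  proof (rule cvec.card_add_le_dim[OF _ T _ _ _ space_sub(2) dimle])
    show "cvec.span P \<inter> cvec.span T \<subseteq> {0}"
      using cvec.sylvester_positive[OF Bs] iso by (force simp: cvec.positive_on_def)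
  qed (use cvec.sylvester_indep[OF Bs] cvec.sylvester_sub[OF Bs] Tsp space_eq_span in auto)
  moreover have "card N + card T \<le> card (verts G) + card (arcs G)"
  proof (rule cvec.card_add_le_dim[OF _ T _ _ _ space_sub(2) dimle])
    show "cvec.span N \<inter> cvec.span T \<subseteq> {0}"
      using cvec.sylvester_positive[OF cvec.hermitian_uminus[OF B_hermitian] cvec.sylvester_uminus[OF Bs]] iso
      by (force simp: cvec.positive_on_def)
  qed (use cvec.sylvester_indep[OF Bs] cvec.sylvester_sub[OF Bs] Tsp space_eq_span in auto)
  ultimately have "card P = card (verts G) - 1" "card N = card (verts G) - 1"
    using P N cT by linarith+
  moreover from this have "card Z + card (verts G) = card (arcs G) + 2"
    using cvec.sylvester_dim[OF Bs] dim_space V1 by linarith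
  ultimately show ?thesis using that[OF s] by blast
qed

lemma B_radical_diff:
  assumes "x \<in> cvec.radical B space" "e \<in> arcs G"
  shows "diff x e = 0"
proof -
  have "unit_vec (Inr e) \<in> space" using assms(2) by (intro unit_in_space) (simp add: index_set_def)
  then have "0 = B x (unit_vec (Inr e))" using assms(1) by (simp add: cvec.radical_def)
  also have "\<dots> = (\<Sum>e'\<in>arcs G. if e' = e then diff x e else 0)"
    unfolding B_def by (intro sum.cong) (auto simp: diff_def unit_vec_def)
  also have "\<dots> = diff x e" using assms(2) by simp
  finally show ?thesis by simp
qed

text \<open>Difference and average on an edge determine both of its end values, and every vertex is
  the end of some edge.\<close>

lemma space_eq_zero:
  assumes x: "x \<in> space" and "\<And>e. e \<in> arcs G \<Longrightarrow> diff x e = 0"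
    and "\<And>e. e \<in> arcs G \<Longrightarrow> avg x e = 0" and "\<And>e. e \<in> arcs G \<Longrightarrow> x (Inr e) = 0"
  shows "x = 0"
proof
  fix i
  have v: "x (Inl v) = 0" if "v \<in> verts G" for v
  proof -
    obtain e where e: "e \<in> arcs G" "tail G e = v \<or> head G e = v" using endpoint_exists[OF \<open>v \<in> verts G\<close>] .
    then show ?thesis using assms(2,3)[OF e(1)] by (auto simp: diff_def avg_def)
  qed
  show "x i = 0 i"
  proof (cases "i \<in> index_set")
    case True
    then show ?thesis using v assms(4) by (auto simp: index_set_def)
  qed (use x in \<open>auto simp: space_def\<close>)
qed

text \<open>In general only the square of a seminorm: vertex values alternating in sign along every
  edge have all averages 0. On the radical of \<open>B\<close> a nonzero vector cannot do this,
  which is the content of \<open>mass_pos\<close>.\<close>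

definition mass :: "('v + 'e \<Rightarrow> complex) \<Rightarrow> real" where
  "mass x = (\<Sum>e\<in>arcs G. (cmod (avg x e))\<^sup>2 + (cmod (x (Inr e)))\<^sup>2)"

lemma mass_nonneg: "0 \<le> mass x"
  unfolding mass_def by (intro sum_nonneg) auto

lemma mass_zero:
  assumes "mass x = 0" "e \<in> arcs G"
  shows "avg x e = 0" "x (Inr e) = 0"
proof -
  have "\<forall>e\<in>arcs G. (cmod (avg x e))\<^sup>2 + (cmod (x (Inr e)))\<^sup>2 = 0"
    using assms(1) unfolding mass_def by (subst (asm) sum_nonneg_eq_0_iff) auto
  then have "(cmod (avg x e))\<^sup>2 + (cmod (x (Inr e)))\<^sup>2 = 0" using assms(2) by blast
  then show "avg x e = 0" "x (Inr e) = 0"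
    by (simp_all add: sum_power2_eq_zero_iff)
qed

lemma mass_pos:
  assumes "x \<in> cvec.radical B space" "x \<noteq> 0"
  shows "0 < mass x"
proof -
  have "mass x \<noteq> 0"
    using space_eq_zero[of x] mass_zero[of x] B_radical_diff[OF assms(1)] assms by (auto simp: cvec.radical_def)
  then show ?thesis using mass_nonneg[of x] by simp
qed

section \<open>The limiting form and the mean potential\<close>

lemma M_diag: "Re (M d x x) = (\<Sum>e\<in>arcs G. (Q e - d) / 2 * ((cmod (avg x e))\<^sup>2 + (cmod (x (Inr e)))\<^sup>2))"
proof -
  have "avg x e * cnj (avg x e) + x (Inr e) * cnj (x (Inr e)) = of_real ((cmod (avg x e))\<^sup>2 + (cmod (x (Inr e)))\<^sup>2)" for e
    by (simp only: of_real_add complex_norm_square)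
  then have "M d x x = of_real (\<Sum>e\<in>arcs G. (Q e - d) / 2 * ((cmod (avg x e))\<^sup>2 + (cmod (x (Inr e)))\<^sup>2))"
    unfolding M_def by (simp only: of_real_mult of_real_sum)
  then show ?thesis by simp
qed

lemma M_shift: "Re (M d' x x) = Re (M d x x) + (d - d') / 2 * mass x"
  unfolding M_diag mass_def sum_distrib_left sum.distrib[symmetric]
  by (intro sum.cong) (auto simp: field_simps)

lemma M_bound:
  assumes "\<And>e. e \<in> arcs G \<Longrightarrow> \<bar>Q e\<bar> \<le> K"
  shows "\<bar>Re (M 0 x x)\<bar> \<le> K / 2 * mass x"
proof -
  have "\<bar>Re (M 0 x x)\<bar> \<le> (\<Sum>e\<in>arcs G. \<bar>(Q e - 0) / 2 * ((cmod (avg x e))\<^sup>2 + (cmod (x (Inr e)))\<^sup>2)\<bar>)"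
    unfolding M_diag by (rule sum_abs)
  also have "\<dots> \<le> (\<Sum>e\<in>arcs G. K / 2 * ((cmod (avg x e))\<^sup>2 + (cmod (x (Inr e)))\<^sup>2))"
    using assms by (intro sum_mono) (auto simp: abs_mult intro!: mult_right_mono)
  finally show ?thesis by (simp add: mass_def sum_distrib_left)
qed

definition mean where "mean = (\<Sum>e\<in>arcs G. Q e) / card (arcs G)"

lemma const_vec_radical: "const_vec \<in> cvec.radical B space"
  unfolding cvec.radical_def B_def using const_vec_coords by auto

lemma const_vec_ne: "const_vec \<noteq> 0"
proof
  assume 0: "const_vec = 0"
  obtain e where "e \<in> arcs G" using arcs_ne by auto
  then show False using const_vec_coords(2)[of e] unfolding 0 by (simp add: avg_def)
qed

text \<open>Vectors in the radical of \<open>B\<close> have constant vertex values, so pairing them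
  with \<open>const_vec\<close> gives a multiple of the sum of \<open>Q e - mean\<close>. The mean
  is the value of \<open>d\<close> that annihilates this sum.\<close>

lemma const_vec_M_radical: "const_vec \<in> cvec.radical (M mean) (cvec.radical B space)"
  unfolding cvec.radical_def[of "M mean"]
proof (intro CollectI conjI const_vec_radical ballI)
  fix x assume x: "x \<in> cvec.radical B space"
  obtain v0 where v0: "v0 \<in> verts G" using verts_ne by auto
  have avg: "avg x e = x (Inl v0)" if "e \<in> arcs G" for e
    using diff_zero_const[OF B_radical_diff[OF x] _ v0, of "tail G e"] diff_zero_const[OF B_radical_diff[OF x] _ v0, of "head G e"] that
    by (simp add: avg_def)
  have "M mean const_vec x = (\<Sum>e\<in>arcs G. of_real ((Q e - mean) / 2) * cnj (x (Inl v0)))"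
    unfolding M_def by (intro sum.cong) (auto simp: const_vec_coords avg)
  also have "\<dots> = of_real ((\<Sum>e\<in>arcs G. Q e - mean) / 2) * cnj (x (Inl v0))"
    by (simp only: sum_distrib_right[symmetric] of_real_sum[symmetric] sum_divide_distrib)
  also have "(\<Sum>e\<in>arcs G. Q e - mean) = 0"
    using arcs_ne by (simp add: sum_subtractf mean_def)
  finally show "M mean const_vec x = 0" by simp
qed

end

section \<open>Eigenfunctions and radicals\<close>

lemma solves_schroedinger_scale:
  assumes "solves_schroedinger p \<mu> f"
  shows "solves_schroedinger p \<mu> (\<lambda>x. c * f x)"
    and "\<And>x. x \<in> {0..1} \<Longrightarrow> unit_deriv (\<lambda>x. c * f x) x = c * unit_deriv f x"
  using solves_schroedinger_lincomb[OF assms assms, where c = c and e = 0] by simp_all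

context metric_graph
begin

lemma sum_by_head: "(\<Sum>e\<in>arcs G. f e) = (\<Sum>v\<in>verts G. \<Sum>e\<in>in_arcs G v. f e)" for f :: "'e \<Rightarrow> complex"
  unfolding in_arcs_def by (rule sum.group[symmetric]) auto

lemma sum_by_tail: "(\<Sum>e\<in>arcs G. f e) = (\<Sum>v\<in>verts G. \<Sum>e\<in>out_arcs G v. f e)" for f :: "'e \<Rightarrow> complex"
  unfolding out_arcs_def by (rule sum.group[symmetric]) auto

lemma vertex_values:
  assumes "standard_matching G y"
  obtains val where "\<And>e. e \<in> arcs G \<Longrightarrow> y e 0 = val (tail G e)" "\<And>e. e \<in> arcs G \<Longrightarrow> y e 1 = val (head G e)"
proof -
  define val where "val v = (SOME a. a \<in> boundary_values G y v)" for v
  have val: "a = val v" if "v \<in> verts G" "a \<in> boundary_values G y v" for v a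
  proof -
    have "val v \<in> boundary_values G y v" unfolding val_def using that(2) by (rule someI)
    then show ?thesis using assms that unfolding standard_matching_def by blast
  qed
  show ?thesis
  proof
    fix e assume e: "e \<in> arcs G"
    show "y e 0 = val (tail G e)"
      using e by (intro val) (auto simp: boundary_values_def out_arcs_def)
    show "y e 1 = val (head G e)"
      using e by (intro val) (auto simp: boundary_values_def in_arcs_def)
  qed
qed

text \<open>Self-adjointness: Green's formula against the conjugate function leaves end terms, which
  regroup by vertices and cancel by continuity and the Kirchhoff condition. The squared norm,
  multiplied by \<open>\<mu> - cnj \<mu>\<close>, must then be 0.\<close>

lemma eigenspace_nonreal:
  assumes "Im \<mu> \<noteq> 0" and y: "y \<in> eigenspace G q \<mu>"
  shows "y = 0"
proof -
  have m: "standard_matching G y" and s: "\<And>e. e \<in> arcs G \<Longrightarrow> solves_schroedinger (q e) \<mu> (y e)"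
    and out: "\<And>e x. e \<notin> arcs G \<or> x \<notin> {0..1} \<Longrightarrow> y e x = 0"
    using y by (auto simp: eigenspace_def)
  obtain val where val: "\<And>e. e \<in> arcs G \<Longrightarrow> y e 0 = val (tail G e)" "\<And>e. e \<in> arcs G \<Longrightarrow> y e 1 = val (head G e)"
    using vertex_values[OF m] by blast
  have kir: "(\<Sum>e\<in>out_arcs G v. unit_deriv (y e) 0) = (\<Sum>e\<in>in_arcs G v. unit_deriv (y e) 1)" if "v \<in> verts G" for v
    using m that by (simp add: standard_matching_def)
  define D where "D e = y e 1 * cnj (unit_deriv (y e) 1) - y e 0 * cnj (unit_deriv (y e) 0)" for e
  have "(\<Sum>e\<in>arcs G. D e) = (\<Sum>e\<in>arcs G. val (head G e) * cnj (unit_deriv (y e) 1)) - (\<Sum>e\<in>arcs G. val (tail G e) * cnj (unit_deriv (y e) 0))"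
    unfolding D_def sum_subtractf using val by simp
  also have "(\<Sum>e\<in>arcs G. val (head G e) * cnj (unit_deriv (y e) 1)) = (\<Sum>v\<in>verts G. val v * cnj (\<Sum>e\<in>in_arcs G v. unit_deriv (y e) 1))"
    unfolding sum_by_head cnj_sum sum_distrib_left by (intro sum.cong) (auto simp: in_arcs_def)
  also have "(\<Sum>e\<in>arcs G. val (tail G e) * cnj (unit_deriv (y e) 0)) = (\<Sum>v\<in>verts G. val v * cnj (\<Sum>e\<in>out_arcs G v. unit_deriv (y e) 0))"
    unfolding sum_by_tail cnj_sum sum_distrib_left by (intro sum.cong) (auto simp: out_arcs_def)
  also have "(\<Sum>v\<in>verts G. val v * cnj (\<Sum>e\<in>out_arcs G v. unit_deriv (y e) 0)) = (\<Sum>v\<in>verts G. val v * cnj (\<Sum>e\<in>in_arcs G v. unit_deriv (y e) 1))"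
    using kir by (intro sum.cong) auto
  finally have D0: "(\<Sum>e\<in>arcs G. D e) = 0" by simp
  define N where "N e = integral {0..1} (\<lambda>x. (cmod (y e x))\<^sup>2)" for e
  have cont: "continuous_on {0..1} (y e)" if "e \<in> arcs G" for e
    by (rule abs_continuous_on_imp_continuous_on[OF solves_schroedingerD(2)[OF s[OF that]]])
  have N: "(\<mu> - cnj \<mu>) * of_real (N e) = D e - cnj (D e)" if e: "e \<in> arcs G" for e
  proof -
    note c = solves_schroedinger_cnj[OF s[OF e]]
    have "((\<lambda>x. (\<mu> - cnj \<mu>) * (y e x * cnj (y e x))) has_integral D e - cnj (D e)) {0..1}"
      using green_identity[OF s[OF e] c(1)] c(2)[of 0] c(2)[of 1]
      by (simp add: D_def algebra_simps)
    moreover have "((\<lambda>x. (cmod (y e x))\<^sup>2) has_integral N e) {0..1}"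
      unfolding N_def by (intro integrable_integral integrable_continuous_real continuous_intros cont e)
    from has_integral_mult_right[OF has_integral_linear[OF this bounded_linear_of_real], of "\<mu> - cnj \<mu>"]
    have "((\<lambda>x. (\<mu> - cnj \<mu>) * complex_of_real ((cmod (y e x))\<^sup>2)) has_integral (\<mu> - cnj \<mu>) * of_real (N e)) {0..1}"
      unfolding o_def .
    then have "((\<lambda>x. (\<mu> - cnj \<mu>) * (y e x * cnj (y e x))) has_integral (\<mu> - cnj \<mu>) * of_real (N e)) {0..1}"
      unfolding complex_norm_square .
    ultimately show ?thesis using has_integral_unique by blast
  qed
  have "(\<mu> - cnj \<mu>) * of_real (\<Sum>e\<in>arcs G. N e) = (\<Sum>e\<in>arcs G. D e) - cnj (\<Sum>e\<in>arcs G. D e)"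
    unfolding of_real_sum sum_distrib_left cnj_sum sum_subtractf[symmetric] using N by (intro sum.cong) auto
  moreover have "\<mu> - cnj \<mu> \<noteq> 0" using assms(1) by (auto simp: complex_eq_iff)
  ultimately have sN: "(\<Sum>e\<in>arcs G. N e) = 0" unfolding D0 by (metis complex_cnj_zero diff_self mult_eq_0_iff of_real_eq_0_iff)
  have N0: "N e \<ge> 0" if "e \<in> arcs G" for e
    unfolding N_def by (intro integral_nonneg integrable_continuous_real continuous_intros cont that) auto
  have "y e x = 0" if e: "e \<in> arcs G" and x: "x \<in> {0..1}" for e x
  proof -
    have "N e = 0" using sN N0 e sum_nonneg_eq_0_iff[of "arcs G" N] by auto
    moreover have "continuous_on {0..1} (\<lambda>x. (cmod (y e x))\<^sup>2)" by (intro continuous_intros cont e)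
    ultimately have "\<forall>x\<in>{0..1}. (cmod (y e x))\<^sup>2 = 0"
      using integral_eq_0_iff[of 0 1 "\<lambda>x. (cmod (y e x))\<^sup>2"] by (simp add: N_def)
    then show ?thesis using x by simp
  qed
  then show ?thesis using out by (intro ext) (metis zero_fun_apply)
qed

end

text \<open>Here \<open>cos w\<close> is \<open>1\<close> or \<open>-1\<close>; in the second case the signs \<open>\<sigma>\<close> form a two-colouring of the graph.\<close>

locale graph_frequency = metric_graph G q for G :: "('v, 'e) pre_digraph" and q +
  fixes w d :: real and \<sigma> :: "'v \<Rightarrow> real"
  assumes edges: "\<And>e. e \<in> arcs G \<Longrightarrow> edge (q e) w d"
    and sign: "\<And>v. \<sigma> v * \<sigma> v = 1"
    and sign_edge: "\<And>e. e \<in> arcs G \<Longrightarrow> \<sigma> (head G e) = cos w * \<sigma> (tail G e)"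
begin

definition flux where "flux x e = edge_flux (q e) w d (avg x e) (x (Inr e))"

definition jump where "jump x e = edge_jump (q e) w d (avg x e) (x (Inr e))"

text \<open>The Kirchhoff defect at \<open>v\<close>: by \<open>sol_ends\<close> the summands are
  the end derivatives of the edge solutions, with the factor \<open>cos w\<close> at heads.\<close>

definition vertex_sum :: "('v + 'e \<Rightarrow> complex) \<Rightarrow> 'v \<Rightarrow> complex" where
  "vertex_sum x v = (\<Sum>e\<in>in_arcs G v. of_real w * x (Inr e) + flux x e / 2) -
     (\<Sum>e\<in>out_arcs G v. of_real w * x (Inr e) - flux x e / 2)"

text \<open>The sign at the tail absorbs \<open>cos w\<close>. For \<open>x\<close> in the radical,
  the lifted function then takes the common value \<open>\<sigma> v * x (Inl v)\<close> at
  \<open>v\<close>, even when free waves change sign along every edge.\<close>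

definition lift :: "('v + 'e \<Rightarrow> complex) \<Rightarrow> 'e \<Rightarrow> real \<Rightarrow> complex" where
  "lift x e = (if e \<in> arcs G
     then (\<lambda>t. of_real (\<sigma> (tail G e)) * edge_sol (q e) w d (avg x e) (x (Inr e)) t) else (\<lambda>t. 0))"

lemma w_pos: "w > 0" and cos_sq: "cos w * cos w = 1"
proof -
  obtain e where "e \<in> arcs G" using arcs_ne by auto
  then show "w > 0" "cos w * cos w = 1" using edge.w_pos[OF edges] edge.cos_w_sq[OF edges] by blast+
qed

lemma signs:
  "complex_of_real (\<sigma> v) * (of_real (\<sigma> v) * z) = z"
  "complex_of_real (cos w) * (of_real (cos w) * z) = z"
  using sign[of v] cos_sq by (metis mult.assoc mult_1 of_real_1 of_real_mult)+

text \<open>Summation by parts: differences and averages of \<open>y\<close> are resolved into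
  vertex values, which exhibits the coefficient of each single coordinate of
  \<open>y\<close>.\<close>

lemma H_split:
  "H w d x y = (\<Sum>e\<in>arcs G. (of_real w * diff x e + jump x e) * cnj (y (Inr e))) +
     (\<Sum>v\<in>verts G. vertex_sum x v * cnj (y (Inl v)))"
proof -
  have "H w d x y = (\<Sum>e\<in>arcs G. of_real w * (diff x e * cnj (y (Inr e)) + x (Inr e) * cnj (diff y e)) +
      (flux x e * cnj (avg y e) + jump x e * cnj (y (Inr e))))"
    unfolding H_def B_def edge_form_def flux_def[symmetric] jump_def[symmetric] sum_distrib_left
    by (rule sum.distrib[symmetric])
  also have "\<dots> = (\<Sum>e\<in>arcs G. (of_real w * diff x e + jump x e) * cnj (y (Inr e)) +
      ((of_real w * x (Inr e) + flux x e / 2) * cnj (y (Inl (head G e))) -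
       (of_real w * x (Inr e) - flux x e / 2) * cnj (y (Inl (tail G e)))))"
    by (intro sum.cong refl) (simp add: diff_def[of y] avg_def[of y] field_simps)
  also have "\<dots> = (\<Sum>e\<in>arcs G. (of_real w * diff x e + jump x e) * cnj (y (Inr e))) +
      ((\<Sum>e\<in>arcs G. (of_real w * x (Inr e) + flux x e / 2) * cnj (y (Inl (head G e)))) -
       (\<Sum>e\<in>arcs G. (of_real w * x (Inr e) - flux x e / 2) * cnj (y (Inl (tail G e)))))"
    unfolding sum.distrib sum_subtractf ..
  also have "(\<Sum>e\<in>arcs G. (of_real w * x (Inr e) + flux x e / 2) * cnj (y (Inl (head G e)))) =
      (\<Sum>v\<in>verts G. (\<Sum>e\<in>in_arcs G v. of_real w * x (Inr e) + flux x e / 2) * cnj (y (Inl v)))"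
    unfolding sum_by_head sum_distrib_right by (intro sum.cong) (auto simp: in_arcs_def)
  also have "(\<Sum>e\<in>arcs G. (of_real w * x (Inr e) - flux x e / 2) * cnj (y (Inl (tail G e)))) =
      (\<Sum>v\<in>verts G. (\<Sum>e\<in>out_arcs G v. of_real w * x (Inr e) - flux x e / 2) * cnj (y (Inl v)))"
    unfolding sum_by_tail sum_distrib_right by (intro sum.cong) (auto simp: out_arcs_def)
  finally show ?thesis
    unfolding vertex_sum_def left_diff_distrib sum_subtractf .
qed

text \<open>Unit vectors as test vectors isolate the coefficients of \<open>H_split\<close>. The
  edge condition says that the edge solution attains the prescribed vertex values (up to
  \<open>cos w\<close> at the head), the vertex condition is the Kirchhoff law.\<close>

lemma radical_iff:
  "x \<in> cvec.radical (H w d) space \<longleftrightarrow> x \<in> space \<and>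
     (\<forall>e\<in>arcs G. of_real w * diff x e + jump x e = 0) \<and> (\<forall>v\<in>verts G. vertex_sum x v = 0)"
proof
  assume x: "x \<in> cvec.radical (H w d) space"
  have "of_real w * diff x e + jump x e = 0" if e: "e \<in> arcs G" for e
  proof -
    have "0 = H w d x (unit_vec (Inr e))"
      using x e unit_in_space[of "Inr e"] by (simp add: cvec.radical_def index_set_def)
    also have "\<dots> = (\<Sum>e'\<in>arcs G. if e' = e then of_real w * diff x e + jump x e else 0) + (\<Sum>v\<in>verts G. 0)"
      unfolding H_split by (intro arg_cong2[where f = "(+)"] sum.cong) (auto simp: unit_vec_def)
    also have "\<dots> = of_real w * diff x e + jump x e" using e by simp
    finally show ?thesis by simp
  qed
  moreover have "vertex_sum x v = 0" if v: "v \<in> verts G" for v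
  proof -
    have "0 = H w d x (unit_vec (Inl v))"
      using x v unit_in_space[of "Inl v"] by (simp add: cvec.radical_def index_set_def)
    also have "\<dots> = (\<Sum>e'\<in>arcs G. 0) + (\<Sum>v'\<in>verts G. if v' = v then vertex_sum x v else 0)"
      unfolding H_split by (intro arg_cong2[where f = "(+)"] sum.cong) (auto simp: unit_vec_def)
    also have "\<dots> = vertex_sum x v" using v by simp
    finally show ?thesis by simp
  qed
  ultimately show "x \<in> space \<and> (\<forall>e\<in>arcs G. of_real w * diff x e + jump x e = 0) \<and> (\<forall>v\<in>verts G. vertex_sum x v = 0)"
    using x by (simp add: cvec.radical_def)
next
  assume "x \<in> space \<and> (\<forall>e\<in>arcs G. of_real w * diff x e + jump x e = 0) \<and> (\<forall>v\<in>verts G. vertex_sum x v = 0)"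
  then show "x \<in> cvec.radical (H w d) space" by (simp add: cvec.radical_def H_split)
qed

section \<open>The isomorphism between radical and eigenspace\<close>

lemma lift_linear: "Vector_Spaces.linear vscale fun_scale lift"
proof -
  have add: "lift (x + y) = lift x + lift y" for x y
  proof
    fix e show "lift (x + y) e = (lift x + lift y) e"
      using edge.edge_sol_linear[OF edges, of e 1 "avg x e" 1 "avg y e" "x (Inr e)" "y (Inr e)"]
      by (auto simp: lift_def coord_linear fun_eq_iff algebra_simps)
  qed
  have scale: "lift (vscale c x) = fun_scale c (lift x)" for c x
  proof
    fix e show "lift (vscale c x) e = fun_scale c (lift x) e"
      using edge.edge_sol_linear[OF edges, of e c "avg x e" 0 0 "x (Inr e)" 0]
      by (auto simp: lift_def coord_linear vscale_at fun_scale_def fun_eq_iff algebra_simps)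
  qed
  show ?thesis
    unfolding Vector_Spaces.linear_iff
    by (intro conjI allI cvec.vector_space_axioms cfun.vector_space_axioms add scale)
qed

text \<open>End data are midpoint plus or minus half of the jump or flux. The edge condition turns
  the jump into \<open>- w * diff x e\<close>, and the average plus or minus half the difference are
  the two vertex values.\<close>

lemma sol_ends:
  fixes x :: "'v + 'e \<Rightarrow> complex"
  assumes e: "e \<in> arcs G"
  defines "f \<equiv> edge_sol (q e) w d (avg x e) (x (Inr e))"
  shows "unit_deriv f 0 = of_real w * x (Inr e) - flux x e / 2"
    and "of_real (cos w) * unit_deriv f 1 = of_real w * x (Inr e) + flux x e / 2"
    and "of_real w * diff x e + jump x e = 0 \<Longrightarrow> f 0 = x (Inl (tail G e))"
    and "of_real w * diff x e + jump x e = 0 \<Longrightarrow> of_real (cos w) * f 1 = x (Inl (head G e))"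
proof -
  note v = edge.edge_sol_values[OF edges[OF e], of "avg x e" "x (Inr e)", folded f_def flux_def jump_def]
  have w0: "complex_of_real w \<noteq> 0" using w_pos by simp
  show "unit_deriv f 0 = of_real w * x (Inr e) - flux x e / 2"
    using v(3) by (simp add: field_simps)
  show "of_real (cos w) * unit_deriv f 1 = of_real w * x (Inr e) + flux x e / 2"
    using v(4) by (simp add: field_simps)
  assume "of_real w * diff x e + jump x e = 0"
  then have j: "jump x e = - (of_real w * diff x e)" by (simp add: eq_neg_iff_add_eq_0 add.commute)
  have "of_real w * (2 * f 0) = of_real w * (2 * avg x e - diff x e)"
    unfolding v(1) j by (simp add: algebra_simps)
  then have "2 * f 0 = 2 * avg x e - diff x e" using w0 by simp
  moreover have "2 * avg x e - diff x e = 2 * x (Inl (tail G e))" by (simp add: avg_def diff_def field_simps)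
  ultimately show "f 0 = x (Inl (tail G e))" by simp
  have "of_real w * (2 * (of_real (cos w) * f 1)) = of_real w * (2 * avg x e + diff x e)"
    unfolding v(2) j by (simp add: algebra_simps)
  then have "2 * (of_real (cos w) * f 1) = 2 * avg x e + diff x e" using w0 by (simp only: mult_cancel_left) simp
  moreover have "2 * avg x e + diff x e = 2 * x (Inl (head G e))" by (simp add: avg_def diff_def field_simps)
  ultimately show "of_real (cos w) * f 1 = x (Inl (head G e))" by simp
qed

lemma lift_in_eigenspace:
  assumes "x \<in> cvec.radical (H w d) space"
  shows "lift x \<in> eigenspace G q (of_real (w\<^sup>2 + d))"
proof -
  have x: "\<And>e. e \<in> arcs G \<Longrightarrow> of_real w * diff x e + jump x e = 0" "\<And>v. v \<in> verts G \<Longrightarrow> vertex_sum x v = 0"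
    using assms unfolding radical_iff by blast+
  note sol = edge.edge_sol_solves[OF edges]
  have l0: "lift x e 0 = of_real (\<sigma> (tail G e)) * x (Inl (tail G e))"
    and l1: "lift x e 1 = of_real (\<sigma> (head G e)) * x (Inl (head G e))"
    and d0: "unit_deriv (lift x e) 0 = of_real (\<sigma> (tail G e)) * (of_real w * x (Inr e) - flux x e / 2)"
    and d1: "unit_deriv (lift x e) 1 = of_real (\<sigma> (head G e)) * (of_real w * x (Inr e) + flux x e / 2)"
    if e: "e \<in> arcs G" for e
  proof -
    note s = sol_ends[OF e, of x]
    show "lift x e 0 = of_real (\<sigma> (tail G e)) * x (Inl (tail G e))"
      using e s(3)[OF x(1)[OF e]] by (simp add: lift_def)
    \<comment> \<open>\<open>\<sigma> (head G e)\<close> already contains one factor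
      \<open>cos w\<close>, and the second one cancels it.\<close>
    have ht: "complex_of_real (\<sigma> (head G e)) * (of_real (cos w) * z) = of_real (\<sigma> (tail G e)) * z" for z
      using sign_edge[OF e] signs(2)[of "of_real (\<sigma> (tail G e)) * z"] by (simp add: mult_ac)
    show "lift x e 1 = of_real (\<sigma> (head G e)) * x (Inl (head G e))"
      unfolding s(4)[OF x(1)[OF e], symmetric] ht using e by (simp add: lift_def)
    note sc = solves_schroedinger_scale(2)[OF sol[OF e, of "avg x e" "x (Inr e)"], where c = "of_real (\<sigma> (tail G e))"]
    show "unit_deriv (lift x e) 0 = of_real (\<sigma> (tail G e)) * (of_real w * x (Inr e) - flux x e / 2)"
      unfolding s(1)[symmetric] using e sc[of 0] by (simp add: lift_def)
    show "unit_deriv (lift x e) 1 = of_real (\<sigma> (head G e)) * (of_real w * x (Inr e) + flux x e / 2)"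
      unfolding s(2)[symmetric] ht using e sc[of 1] by (simp add: lift_def)
  qed
  have "standard_matching G (lift x)"
    unfolding standard_matching_def
  proof (intro conjI ballI)
    fix v a b assume "v \<in> verts G" "a \<in> boundary_values G (lift x) v" "b \<in> boundary_values G (lift x) v"
    moreover have "c = of_real (\<sigma> v) * x (Inl v)" if "c \<in> boundary_values G (lift x) v" for c
      using that l0 l1 by (auto simp: boundary_values_def in_arcs_def out_arcs_def)
    ultimately show "a = b" by metis
  next
    fix v assume v: "v \<in> verts G"
    have "(\<Sum>e\<in>out_arcs G v. unit_deriv (lift x e) 0) = of_real (\<sigma> v) * (\<Sum>e\<in>out_arcs G v. of_real w * x (Inr e) - flux x e / 2)"
      unfolding sum_distrib_left by (intro sum.cong) (auto simp: out_arcs_def d0)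
    also have "\<dots> = of_real (\<sigma> v) * (\<Sum>e\<in>in_arcs G v. of_real w * x (Inr e) + flux x e / 2)"
      using x(2)[OF v] unfolding vertex_sum_def by simp
    also have "\<dots> = (\<Sum>e\<in>in_arcs G v. unit_deriv (lift x e) 1)"
      unfolding sum_distrib_left by (intro sum.cong) (auto simp: in_arcs_def d1)
    finally show "(\<Sum>e\<in>out_arcs G v. unit_deriv (lift x e) 0) = (\<Sum>e\<in>in_arcs G v. unit_deriv (lift x e) 1)" .
  qed
  moreover have "solves_schroedinger (q e) (of_real (w\<^sup>2 + d)) (lift x e)" if "e \<in> arcs G" for e
    using solves_schroedinger_scale(1)[OF sol[OF that]] that by (simp add: lift_def)
  moreover have "lift x e t = 0" if "e \<notin> arcs G \<or> t \<notin> {0..1}" for e t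
  proof (cases "e \<in> arcs G")
    case True
    then show ?thesis using that edge.edge_sol_outside[OF edges[OF True], of t] unfolding lift_def by simp
  qed (simp add: lift_def)
  ultimately show ?thesis unfolding eigenspace_def by blast
qed

lemma eigenspace_is_lift:
  assumes y: "y \<in> eigenspace G q (of_real (w\<^sup>2 + d))"
  obtains x where "x \<in> cvec.radical (H w d) space" "y = lift x"
proof -
  have m: "standard_matching G y" and s: "\<And>e. e \<in> arcs G \<Longrightarrow> solves_schroedinger (q e) (of_real (w\<^sup>2 + d)) (y e)"
    and out: "\<And>e x. e \<notin> arcs G \<or> x \<notin> {0..1} \<Longrightarrow> y e x = 0"
    using y by (auto simp: eigenspace_def)
  obtain val where val: "\<And>e. e \<in> arcs G \<Longrightarrow> y e 0 = val (tail G e)" "\<And>e. e \<in> arcs G \<Longrightarrow> y e 1 = val (head G e)"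
    using vertex_values[OF m] by blast
  have w0: "complex_of_real w \<noteq> 0" using w_pos by simp
  \<comment> \<open>The inverse of the lift: vertex values are stripped of their sign, and the flow
    is the midpoint of the sine amplitude, computed from the two end derivatives.\<close>
  define x where "x i = (case i of Inl v \<Rightarrow> if v \<in> verts G then of_real (\<sigma> v) * val v else 0
    | Inr e \<Rightarrow> if e \<in> arcs G then of_real (\<sigma> (tail G e)) *
        (unit_deriv (y e) 0 + of_real (cos w) * unit_deriv (y e) 1) / (2 * of_real w) else 0)" for i
  have xsp: "x \<in> space" by (auto simp: space_def x_def index_set_def split: sum.splits)
  define f where "f e = (\<lambda>t. of_real (\<sigma> (tail G e)) * y e t)" for e
  have f0: "f e 0 = x (Inl (tail G e))" and f1: "of_real (cos w) * f e 1 = x (Inl (head G e))"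
    and feq: "f e = edge_sol (q e) w d (avg x e) (x (Inr e))"
    and fd: "unit_deriv (f e) 0 = of_real (\<sigma> (tail G e)) * unit_deriv (y e) 0"
      "of_real (cos w) * unit_deriv (f e) 1 = of_real (\<sigma> (head G e)) * unit_deriv (y e) 1"
    if e: "e \<in> arcs G" for e
  proof -
    show f0: "f e 0 = x (Inl (tail G e))" using e by (simp add: f_def x_def val)
    show f1: "of_real (cos w) * f e 1 = x (Inl (head G e))"
      using e sign_edge[OF e] by (simp add: f_def x_def val)
    note sc = solves_schroedinger_scale[OF s[OF e], where c = "of_real (\<sigma> (tail G e))", folded f_def]
    show d0: "unit_deriv (f e) 0 = of_real (\<sigma> (tail G e)) * unit_deriv (y e) 0"
      using sc(2)[of 0] by simp
    have d1: "unit_deriv (f e) 1 = of_real (\<sigma> (tail G e)) * unit_deriv (y e) 1" using sc(2)[of 1] by simp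
    show "of_real (cos w) * unit_deriv (f e) 1 = of_real (\<sigma> (head G e)) * unit_deriv (y e) 1"
      unfolding d1 sign_edge[OF e] by simp
    show "f e = edge_sol (q e) w d (avg x e) (x (Inr e))"
    proof (rule edge.edge_sol_unique[OF edges[OF e] _ sc(1)])
      show "f e t = 0" if "t \<notin> {0..1}" for t using out[of e t] that unfolding f_def by simp
      show "f e 0 + of_real (cos w) * f e 1 = 2 * avg x e" unfolding f0 f1 by (simp add: avg_def)
      show "unit_deriv (f e) 0 + of_real (cos w) * unit_deriv (f e) 1 = 2 * of_real w * x (Inr e)"
        unfolding d0 d1 using e w0 by (simp add: x_def field_simps)
    qed
  qed
  have "y = lift x"
  proof (intro ext)
    fix e t show "y e t = lift x e t"
    proof (cases "e \<in> arcs G")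
      case True
      have "lift x e t = of_real (\<sigma> (tail G e)) * f e t" using True by (simp add: lift_def feq)
      then show ?thesis using signs(1)[of "tail G e" "y e t"] by (simp add: f_def)
    qed (simp add: lift_def out)
  qed
  moreover have "x \<in> cvec.radical (H w d) space"
    unfolding radical_iff
  proof (intro conjI ballI xsp)
    fix e assume e: "e \<in> arcs G"
    have "jump x e = of_real w * (f e 0 - of_real (cos w) * f e 1)"
      unfolding jump_def edge_jump_def feq[OF e] ..
    then show "of_real w * diff x e + jump x e = 0"
      unfolding f0[OF e] f1[OF e] by (simp add: diff_def algebra_simps)
  next
    fix v assume v: "v \<in> verts G"
    have i: "(\<Sum>e\<in>in_arcs G v. of_real w * x (Inr e) + flux x e / 2) = of_real (\<sigma> v) * (\<Sum>e\<in>in_arcs G v. unit_deriv (y e) 1)"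
      unfolding sum_distrib_left
    proof (intro sum.cong refl)
      fix e assume "e \<in> in_arcs G v"
      then have e: "e \<in> arcs G" "head G e = v" by (auto simp: in_arcs_def)
      show "of_real w * x (Inr e) + flux x e / 2 = of_real (\<sigma> v) * unit_deriv (y e) 1"
        using sol_ends(2)[OF e(1), of x] fd(2)[OF e(1)] unfolding feq[OF e(1), symmetric] e(2) by simp
    qed
    have o: "(\<Sum>e\<in>out_arcs G v. of_real w * x (Inr e) - flux x e / 2) = of_real (\<sigma> v) * (\<Sum>e\<in>out_arcs G v. unit_deriv (y e) 0)"
      unfolding sum_distrib_left
    proof (intro sum.cong refl)
      fix e assume "e \<in> out_arcs G v"
      then have e: "e \<in> arcs G" "tail G e = v" by (auto simp: out_arcs_def)
      show "of_real w * x (Inr e) - flux x e / 2 = of_real (\<sigma> v) * unit_deriv (y e) 0"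
        using sol_ends(1)[OF e(1), of x] fd(1)[OF e(1)] unfolding feq[OF e(1), symmetric] e(2) by simp
    qed
    show "vertex_sum x v = 0"
      unfolding vertex_sum_def i o using m v by (simp add: standard_matching_def)
  qed
  ultimately show ?thesis using that by blast
qed

text \<open>A vanishing lift has zero midpoints and zero jump on every edge; the edge condition then
  makes the differences vanish too.\<close>

lemma lift_inj:
  assumes x: "x \<in> cvec.radical (H w d) space" and "lift x = 0"
  shows "x = 0"
proof -
  have r: "x \<in> space" "\<And>e. e \<in> arcs G \<Longrightarrow> of_real w * diff x e + jump x e = 0"
    using x unfolding radical_iff by blast+
  have w0: "complex_of_real w \<noteq> 0" using w_pos by simp
  have z: "avg x e = 0 \<and> x (Inr e) = 0 \<and> diff x e = 0" if e: "e \<in> arcs G" for e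
  proof -
    define f where "f = edge_sol (q e) w d (avg x e) (x (Inr e))"
    have f: "f = (\<lambda>t. 0)"
    proof
      fix t
      have "of_real (\<sigma> (tail G e)) * f t = 0"
        using fun_cong[OF fun_cong[OF assms(2), of e], of t] e by (simp add: lift_def f_def)
      then show "f t = 0" using sign[of "tail G e"] by auto
    qed
    have u: "unit_deriv f t = 0" if "t \<in> {0..1}" for t
      unfolding f using that by (intro unit_deriv_eq) auto
    have "avg x e = 0" using edge.edge_sol_mid(1)[OF edges[OF e], of "avg x e" "x (Inr e)", folded f_def] by (simp add: f)
    moreover have "x (Inr e) = 0"
      using edge.edge_sol_mid(2)[OF edges[OF e], of "avg x e" "x (Inr e)", folded f_def] u[of 0] u[of 1] w0 by simp
    moreover have "jump x e = 0" unfolding jump_def edge_jump_def f_def[symmetric] by (simp add: f)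
    ultimately show ?thesis using r(2)[OF e] w0 by simp
  qed
  show ?thesis by (rule space_eq_zero[OF r(1)]) (use z in auto)
qed

text \<open>The lift maps the radical isomorphically onto the eigenspace, so it carries the null
  part \<open>Z\<close> of a Sylvester basis to a basis. The image of \<open>Z\<close> is also the
  finite spanning set that the counting predicate asks for.\<close>

lemma eigenspace_dim:
  shows "eigenvalue_mult G q (of_real (w\<^sup>2 + d)) = cvec.dim (cvec.radical (H w d) space)"
    and "\<exists>F. finite F \<and> eigenspace G q (of_real (w\<^sup>2 + d)) \<subseteq> cfun.span F"
    and "is_eigenvalue G q (of_real (w\<^sup>2 + d)) \<longleftrightarrow> cvec.dim (cvec.radical (H w d) space) \<noteq> 0"
proof -
  have herm: "cvec.hermitian (H w d)" by (rule H_hermitian[OF edges])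
  obtain P Z N where s: "cvec.sylvester (H w d) space P Z N"
    using cvec.sylvester_exists[OF herm space_subspace space_sub] .
  note hs = herm s
  interpret lift: Vector_Spaces.linear vscale fun_scale lift by (rule lift_linear)
  have rad: "cvec.span Z = cvec.radical (H w d) space" by (rule cvec.sylvester_radical[OF hs])
  have im: "lift ` cvec.radical (H w d) space = eigenspace G q (of_real (w\<^sup>2 + d))"
    using lift_in_eigenspace eigenspace_is_lift by (metis (no_types, lifting) image_eqI subsetI subset_antisym image_subsetI)
  have inj: "inj_on lift (cvec.span Z)"
  proof (rule inj_onI)
    fix a b assume ab: "a \<in> cvec.span Z" "b \<in> cvec.span Z" "lift a = lift b"
    then have "lift (a - b) = 0" "a - b \<in> cvec.radical (H w d) space"
      using rad cvec.span_diff[of a Z b] by (simp_all add: lift.diff)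
    then show "a = b" using lift_inj by force
  qed
  have span: "cfun.span (lift ` Z) = eigenspace G q (of_real (w\<^sup>2 + d))"
    unfolding lift.span_image rad im ..
  have ind: "cfun.independent (lift ` Z)"
    by (rule lift.independent_injective_image[OF cvec.sylvester_indep(2)[OF hs] inj])
  have "cfun.dim (eigenspace G q (of_real (w\<^sup>2 + d))) = card (lift ` Z)"
    unfolding span[symmetric] by (rule cfun.dim_span_eq_card_independent[OF ind])
  also have "\<dots> = card Z" using inj_on_subset[OF inj cvec.span_superset] by (rule card_image)
  also have dimZ: "\<dots> = cvec.dim (cvec.radical (H w d) space)"
    using cvec.sylvester_dim_radical[OF hs] by simp
  finally show "eigenvalue_mult G q (of_real (w\<^sup>2 + d)) = cvec.dim (cvec.radical (H w d) space)"
    by (simp add: eigenvalue_mult_def)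
  show "\<exists>F. finite F \<and> eigenspace G q (of_real (w\<^sup>2 + d)) \<subseteq> cfun.span F"
    using span cvec.sylvester_fin(2)[OF hs] by (intro exI[of _ "lift ` Z"]) auto
  have "is_eigenvalue G q (of_real (w\<^sup>2 + d)) \<longleftrightarrow> Z \<noteq> {}"
  proof
    assume "is_eigenvalue G q (of_real (w\<^sup>2 + d))"
    then obtain y where "y \<in> cfun.span (lift ` Z)" "y \<noteq> 0" unfolding is_eigenvalue_def span[symmetric] by blast
    then show "Z \<noteq> {}" by auto
  next
    assume "Z \<noteq> {}"
    then obtain z where z: "z \<in> Z" by auto
    then have "lift z \<in> lift ` Z" by auto
    moreover from this have "lift z \<noteq> 0" using ind cfun.dependent_zero by metis
    ultimately show "is_eigenvalue G q (of_real (w\<^sup>2 + d))"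
      unfolding is_eigenvalue_def span[symmetric] by (intro bexI[of _ "lift z"] cfun.span_base)
  qed
  then show "is_eigenvalue G q (of_real (w\<^sup>2 + d)) \<longleftrightarrow> cvec.dim (cvec.radical (H w d) space) \<noteq> 0"
    unfolding dimZ[symmetric] using cvec.sylvester_fin(2)[OF hs] by simp
qed

end

section \<open>Counting the eigenvalues\<close>

text \<open>One sequence that is almost optimal for every \<open>k\<close> serves all
  \<open>\<epsilon>\<close> at once and avoids a diagonal choice. The slack \<open>1 / Suc k\<close>
  is there because the infimal distance may not be attained.\<close>

lemma eventually_choose_tendsto:
  fixes m :: "'a::metric_space"
  assumes near: "\<And>\<epsilon>. 0 < \<epsilon> \<Longrightarrow> \<forall>\<^sub>F k in sequentially. \<exists>x. dist x m \<le> \<epsilon> \<and> P k x"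
  obtains l where "\<forall>\<^sub>F k in sequentially. P k (l k)" "l \<longlonglongrightarrow> m"
proof -
  define r where "r k = infdist m {x. P k x}" for k
  define l where "l k = (SOME x. P k x \<and> dist x m < r k + 1 / Suc k)" for k
  have l: "P k (l k) \<and> dist (l k) m < r k + 1 / Suc k" if "\<exists>x. P k x" for k
  proof -
    have ne: "{x. P k x} \<noteq> {}" using that by blast
    have "r k < r k + 1 / Suc k" by simp
    then have "Inf (dist m ` {x. P k x}) < r k + 1 / Suc k"
      using ne unfolding r_def by (simp add: infdist_notempty)
    then obtain x where "P k x" "dist m x < r k + 1 / Suc k"
      using cInf_lessD[of "dist m ` {x. P k x}" "r k + 1 / Suc k"] ne by auto
    then have "\<exists>x. P k x \<and> dist x m < r k + 1 / Suc k" by (auto simp: dist_commute)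
    then show ?thesis unfolding l_def by (rule someI_ex)
  qed
  show ?thesis
  proof
    show "\<forall>\<^sub>F k in sequentially. P k (l k)"
      by (rule eventually_mono[OF near[OF zero_less_one]]) (use l in auto)
    show "l \<longlonglongrightarrow> m"
    proof (rule tendstoI)
      fix e :: real assume e: "e > 0"
      have "\<forall>\<^sub>F k in sequentially. 1 / real (Suc k) < e / 2"
        using order_tendstoD(2)[OF LIMSEQ_inverse_real_of_nat, of "e / 2"] e by (simp add: inverse_eq_divide)
      moreover have "\<forall>\<^sub>F k in sequentially. \<exists>x. dist x m \<le> e / 2 \<and> P k x" using near[of "e / 2"] e by simp
      ultimately show "\<forall>\<^sub>F k in sequentially. dist (l k) m < e"
      proof eventually_elim
        case (elim k)
        then obtain x where x: "dist x m \<le> e / 2" "P k x" by blast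
        have "r k \<le> dist m x" unfolding r_def using x(2) by (intro infdist_le) auto
        moreover have "dist (l k) m < r k + 1 / Suc k" using l x(2) by blast
        ultimately show ?case using x(1) elim(1) by (simp add: dist_commute)
      qed
    qed
  qed
qed

lemma (in complex_space) radical_uminus: "radical (\<lambda>x y. - h x y) U = radical h U"
  by (simp add: radical_def)

section \<open>Dependence of the full form on the spectral parameter\<close>

context metric_graph
begin

text \<open>Uniform over the whole window of \<open>d\<close>, so that one \<open>w\<close> serves
  for the entire family of forms. The constant 64 is the one demanded by
  \<open>edge_form_decrease\<close>.\<close>

definition admissible :: "real \<Rightarrow> real \<Rightarrow> bool" where
  "admissible C w \<longleftrightarrow> (\<forall>e\<in>arcs G. \<forall>d\<in>{-C..C}. edge (q e) w d \<and> 64 * integral {0..1} (\<lambda>x. \<bar>q e x - d\<bar>) \<le> w)"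

lemma eventually_admissible:
  assumes w: "filterlim w at_top F" and sin: "\<And>k. sin (w k) = 0"
  shows "\<forall>\<^sub>F k in F. admissible C (w k)"
proof -
  define K where "K = (\<Sum>e\<in>arcs G. integral {0..1} (\<lambda>x. \<bar>q e x\<bar>)) + \<bar>C\<bar>"
  have qi: "(\<lambda>x. \<bar>q e x\<bar>) integrable_on {0..1}" if "e \<in> arcs G" for e
    using q[OF that] unfolding absolutely_integrable_on_def by simp
  have K: "integral {0..1} (\<lambda>x. \<bar>q e x - d\<bar>) \<le> K" if e: "e \<in> arcs G" and d: "d \<in> {-C..C}" for e d
  proof -
    have "(\<lambda>x. q e x - d) absolutely_integrable_on {0..1}"
      by (intro set_integral_diff(1) q e absolutely_integrable_continuous_real) auto
    then have "(\<lambda>x. \<bar>q e x - d\<bar>) integrable_on {0..1}"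
      unfolding absolutely_integrable_on_def by simp
    then have "integral {0..1} (\<lambda>x. \<bar>q e x - d\<bar>) \<le> integral {0..1} (\<lambda>x. \<bar>q e x\<bar> + \<bar>C\<bar>)"
      using d by (intro integral_le integrable_add qi e) auto
    also have "\<dots> = integral {0..1} (\<lambda>x. \<bar>q e x\<bar>) + \<bar>C\<bar>"
      by (subst integral_add[OF qi[OF e]]) auto
    also have "integral {0..1} (\<lambda>x. \<bar>q e x\<bar>) \<le> (\<Sum>e\<in>arcs G. integral {0..1} (\<lambda>x. \<bar>q e x\<bar>))"
      using e by (intro member_le_sum integral_nonneg qi) auto
    finally show ?thesis by (simp add: K_def)
  qed
  have K0: "0 \<le> K" unfolding K_def by (intro add_nonneg_nonneg sum_nonneg integral_nonneg qi) auto
  have "\<forall>\<^sub>F k in F. w k > 64 * K" using w by (simp add: filterlim_at_top_dense)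
  then show ?thesis
  proof eventually_elim
    case (elim k)
    show ?case unfolding admissible_def
    proof (intro ballI conjI)
      fix e d assume e: "e \<in> arcs G" and d: "d \<in> {-C..C}"
      show "64 * integral {0..1} (\<lambda>x. \<bar>q e x - d\<bar>) \<le> w k" using K[OF e d] elim by simp
      show "edge (q e) (w k) d"
        unfolding edge_def using q[OF e] sin[of k] K[OF e d] elim K0 by auto
    qed
  qed
qed

lemma H_decrease:
  assumes adm: "admissible C w" and d: "-C \<le> d" "d < d'" "d' \<le> C"
  shows "Re (H w d' x x) + (d' - d) / 8 * mass x \<le> Re (H w d x x)"
proof -
  have "(\<Sum>e\<in>arcs G. Re (edge_form (q e) w d' (avg x e) (x (Inr e)) (avg x e) (x (Inr e))) +
      (d' - d) / 8 * ((norm (avg x e))\<^sup>2 + (norm (x (Inr e)))\<^sup>2)) \<le>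
    (\<Sum>e\<in>arcs G. Re (edge_form (q e) w d (avg x e) (x (Inr e)) (avg x e) (x (Inr e))))"
    using adm d unfolding admissible_def by (intro sum_mono edge_form_decrease) auto
  moreover have "(d' - d) / 8 * mass x = (\<Sum>e\<in>arcs G. (d' - d) / 8 * ((norm (avg x e))\<^sup>2 + (norm (x (Inr e)))\<^sup>2))"
    unfolding mass_def by (rule sum_distrib_left)
  ultimately show ?thesis
    unfolding H_def by (simp add: sum.distrib Re_sum)
qed

text \<open>If the mass of \<open>x\<close> were 0, all its edge forms would vanish and
  \<open>H\<close> would reduce to \<open>w * B\<close>; then \<open>x\<close> would lie in the
  radical of \<open>B\<close>, where nonzero vectors have positive mass. So the value at
  \<open>d\<close> strictly exceeds the value 0 at \<open>d'\<close>.\<close>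

lemma H_strict:
  assumes adm: "admissible C w" and d: "-C \<le> d" "d < d'" "d' \<le> C"
    and x: "x \<in> cvec.radical (H w d') space" "x \<noteq> 0"
  shows "0 < Re (H w d x x)"
proof -
  have edges: "edge (q e) w d'" if "e \<in> arcs G" for e
    using adm d that unfolding admissible_def by auto
  have xs: "x \<in> space" "H w d' x y = 0" if "y \<in> space" for y
    using x(1) that by (auto simp: cvec.radical_def)
  have x0: "x \<in> space" using x(1) by (simp add: cvec.radical_def)
  have "mass x \<noteq> 0"
  proof
    assume m: "mass x = 0"
    have "edge_form (q e) w d' (avg x e) (x (Inr e)) \<gamma> \<delta> = 0" if e: "e \<in> arcs G" for e \<gamma> \<delta>
      using edge.edge_form_linear[OF edges[OF e], of 0 0 0 0 0 0 \<gamma> \<delta>] mass_zero[OF m e] by simp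
    then have "H w d' x y = of_real w * B x y" for y unfolding H_def by simp
    moreover obtain e where "e \<in> arcs G" using arcs_ne by auto
    ultimately have "B x y = 0" if "y \<in> space" for y
      using xs(2)[OF that] edge.w_pos[OF edges] by auto
    then have "x \<in> cvec.radical B space" using x0 by (simp add: cvec.radical_def)
    then show False using mass_pos[OF _ x(2)] m by simp
  qed
  then have "0 < (d' - d) / 8 * mass x" using mass_nonneg[of x] d by simp
  then show ?thesis using H_decrease[OF adm d, of x] xs(2)[OF x0] by simp
qed

lemma H_continuous:
  assumes adm: "admissible C w"
  shows "continuous_on {-C..C} (\<lambda>d. H w d x y)"
  unfolding H_def
proof (intro continuous_intros)
  fix e assume e: "e \<in> arcs G"
  let ?K = "4 * (norm (avg x e) + norm (x (Inr e))) * (norm (avg y e) + norm (y (Inr e)))"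
  have "?K-lipschitz_on {-C..C} (\<lambda>d. edge_form (q e) w d (avg x e) (x (Inr e)) (avg y e) (y (Inr e)))"
  proof (rule lipschitz_onI)
    fix d d' assume "d \<in> {-C..C}" "d' \<in> {-C..C}"
    then have "edge (q e) w d" "edge (q e) w d'" using adm e by (auto simp: admissible_def)
    from edge_form_lipschitz[OF this, of "avg x e" "x (Inr e)" "avg y e" "y (Inr e)"]
    show "dist (edge_form (q e) w d (avg x e) (x (Inr e)) (avg y e) (y (Inr e)))
      (edge_form (q e) w d' (avg x e) (x (Inr e)) (avg y e) (y (Inr e))) \<le> ?K * dist d d'"
      by (simp add: dist_norm abs_minus_commute mult.commute)
  qed simp
  then show "continuous_on {-C..C} (\<lambda>d. edge_form (q e) w d (avg x e) (x (Inr e)) (avg y e) (y (Inr e)))"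
    by (rule lipschitz_on_continuous_on)
qed

lemma H_tendsto:
  assumes w: "filterlim w at_top F" and sin: "\<And>k. sin (w k) = 0"
  shows "((\<lambda>k. H (w k) d x y - of_real (w k) * B x y) \<longlongrightarrow> M d x y) F"
proof -
  have "(\<lambda>k. H (w k) d x y - of_real (w k) * B x y) =
      (\<lambda>k. \<Sum>e\<in>arcs G. edge_form (q e) (w k) d (avg x e) (x (Inr e)) (avg y e) (y (Inr e)))"
    by (simp add: H_def)
  then show ?thesis
    unfolding M_def Q_def by (simp only:) (intro tendsto_sum edge_form_tendsto q w sin)
qed

lemma H_drop:
  assumes adm: "admissible C w" and ab: "-C \<le> a" "a \<le> b" "b \<le> C"
  shows "finite {d\<in>{a<..b}. cvec.dim (cvec.radical (H w d) space) \<noteq> 0} \<and>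
    cvec.positive_index (H w a) space = cvec.positive_index (H w b) space +
      (\<Sum>d | d \<in> {a<..b} \<and> cvec.dim (cvec.radical (H w d) space) \<noteq> 0. cvec.dim (cvec.radical (H w d) space))"
proof (rule cvec.positive_index_drop[OF ab(2) space_subspace space_sub])
  show "cvec.hermitian (H w d)" if "d \<in> {a..b}" for d
    using adm ab that by (intro H_hermitian) (auto simp: admissible_def)
  show "continuous_on {a..b} (\<lambda>d. H w d x y)" for x y
    using H_continuous[OF adm] by (rule continuous_on_subset) (use ab in auto)
  show "Re (H w d' x x) \<le> Re (H w d x x)" if "a \<le> d" "d < d'" "d' \<le> b" for d d' x
  proof -
    have "0 \<le> (d' - d) / 8 * mass x" using mass_nonneg[of x] that by simp
    then show ?thesis using H_decrease[OF adm, of d d' x] that ab by simp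
  qed
  show "0 < Re (H w d x x)" if "a \<le> d" "d < d'" "d' \<le> b" "x \<in> cvec.radical (H w d') space" "x \<noteq> 0" for d d' x
    using H_strict[OF adm _ that(2) _ that(4,5)] that ab by simp
qed

section \<open>Signatures and eigenvalue counts at large frequency\<close>

context
  fixes w :: "nat \<Rightarrow> real"
  assumes w: "filterlim w at_top sequentially" and sin: "\<And>k. sin (w k) = 0"
begin

lemma eventually_H_hermitian: "\<forall>\<^sub>F k in sequentially. cvec.hermitian (H (w k) d)"
  using eventually_admissible[OF w sin, of "\<bar>d\<bar>"]
proof eventually_elim
  case (elim k)
  have "d \<in> {- \<bar>d\<bar>..\<bar>d\<bar>}" by auto
  then have "edge (q e) (w k) d" if "e \<in> arcs G" for e
    using elim that unfolding admissible_def by blast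
  then show ?case by (rule H_hermitian)
qed

text \<open>The positive part of \<open>B\<close> and a part of its radical on which
  \<open>M\<close> is positive survive together once the frequency is large.\<close>

lemma index_lower:
  assumes S: "finite S" "cvec.independent S" "S \<subseteq> cvec.radical B space" "cvec.positive_on (M d) (cvec.span S)"
  shows "\<forall>\<^sub>F k in sequentially. card (verts G) - 1 + card S \<le> cvec.positive_index (H (w k) d) space"
proof -
  obtain P Z N where s: "cvec.sylvester B space P Z N" and P: "card P = card (verts G) - 1"
    using B_sylvester by blast
  obtain T where T: "cvec.independent T" "T \<subseteq> space" "card T = card P + card S"
    "\<forall>\<^sub>F k in sequentially. cvec.positive_on (H (w k) d) (cvec.span T)"
    using cvec.eventually_positive_family[OF B_hermitian s M_hermitian S eventually_H_hermitian w H_tendsto[OF w sin]] by blast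
  show ?thesis
    using T(4) eventually_H_hermitian[of d]
  proof eventually_elim
    case (elim k)
    then show ?case
      using cvec.positive_index_ge[OF elim(2) space_subspace space_sub T(1,2) elim(1)] T(3) P by simp
  qed
qed

text \<open>The counterpart of \<open>index_lower\<close> for \<open>- H\<close>. The dimension of
  the radical is kept in the inequality because it has to be shown to vanish at the left end of the
  window.\<close>

lemma index_upper:
  assumes S: "finite S" "cvec.independent S" "S \<subseteq> cvec.radical B space" "cvec.positive_on (\<lambda>x y. - M d x y) (cvec.span S)"
  shows "\<forall>\<^sub>F k in sequentially. cvec.positive_index (H (w k) d) space + cvec.dim (cvec.radical (H (w k) d) space) +
    (card (verts G) - 1 + card S) \<le> card (verts G) + card (arcs G)"
proof -
  obtain P Z N where s: "cvec.sylvester B space P Z N" and N: "card N = card (verts G) - 1"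
    using B_sylvester by blast
  have h: "\<forall>\<^sub>F k in sequentially. cvec.hermitian (\<lambda>x y. - H (w k) d x y)"
    using eventually_H_hermitian by eventually_elim (rule cvec.hermitian_uminus)
  have lim: "((\<lambda>k. - H (w k) d x y - of_real (w k) * - B x y) \<longlongrightarrow> - M d x y) sequentially" for x y
    using tendsto_minus[OF H_tendsto[OF w sin, of d x y]] by simp
  have S': "S \<subseteq> cvec.radical (\<lambda>x y. - B x y) space" using S(3) by (simp add: cvec.radical_uminus)
  obtain T where T: "cvec.independent T" "T \<subseteq> space" "card T = card N + card S"
    "\<forall>\<^sub>F k in sequentially. cvec.positive_on (\<lambda>x y. - H (w k) d x y) (cvec.span T)"
    using cvec.eventually_positive_family[OF cvec.hermitian_uminus[OF B_hermitian] cvec.sylvester_uminus[OF B_hermitian s]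
      cvec.hermitian_uminus[OF M_hermitian] S(1,2) S' S(4) h w lim] by blast
  show ?thesis
    using T(4) eventually_H_hermitian[of d]
  proof eventually_elim
    case (elim k)
    then show ?case
      using cvec.positive_index_le[OF elim(2) space_subspace space_sub T(1,2) elim(1)] T(3) N dim_space by simp
  qed
qed

text \<open>For \<open>C\<close> beyond the sum of all \<open>\<bar>Q e\<bar>\<close>, on the
  radical of \<open>B\<close> the form \<open>M\<close> is positive at \<open>-C\<close> and
  negative at \<open>C\<close>. Lower and upper bounds then coincide: the index is |E| + 1 at
  \<open>-C\<close> and |V| - 1 at \<open>C\<close>. The drop counts the half-open window, and the
  trivial radical at \<open>-C\<close> closes it.\<close>

lemma eventually_count:
  assumes C: "(\<Sum>e\<in>arcs G. \<bar>Q e\<bar>) < C"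
  shows "\<forall>\<^sub>F k in sequentially. finite {d\<in>{-C<..C}. cvec.dim (cvec.radical (H (w k) d) space) \<noteq> 0} \<and>
    (\<Sum>d | d \<in> {-C<..C} \<and> cvec.dim (cvec.radical (H (w k) d) space) \<noteq> 0. cvec.dim (cvec.radical (H (w k) d) space)) + card (verts G)
      = card (arcs G) + 2 \<and>
    cvec.dim (cvec.radical (H (w k) (-C)) space) = 0"
proof -
  obtain P Z N where s: "cvec.sylvester B space P Z N" and Z: "card Z + card (verts G) = card (arcs G) + 2"
    using B_sylvester by blast
  note rad = cvec.sylvester_radical[OF B_hermitian s]
  have Zr: "finite Z" "cvec.independent Z" "Z \<subseteq> cvec.radical B space"
    using cvec.sylvester_fin[OF B_hermitian s] cvec.sylvester_indep[OF B_hermitian s] cvec.span_superset[of Z] rad by auto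
  have Qle: "\<bar>Q e\<bar> \<le> (\<Sum>e\<in>arcs G. \<bar>Q e\<bar>)" if "e \<in> arcs G" for e
    using that by (intro member_le_sum) auto
  have Mb: "\<bar>Re (M 0 x x)\<bar> < C / 2 * mass x" if "x \<in> cvec.span Z" "x \<noteq> 0" for x
  proof -
    have m: "0 < mass x" using mass_pos that rad by simp
    have "\<bar>Re (M 0 x x)\<bar> \<le> (\<Sum>e\<in>arcs G. \<bar>Q e\<bar>) / 2 * mass x" by (rule M_bound[OF Qle])
    also have "\<dots> < C / 2 * mass x" using C m by (intro mult_strict_right_mono) auto
    finally show ?thesis .
  qed
  have pos: "cvec.positive_on (M (-C)) (cvec.span Z)"
    unfolding cvec.positive_on_def
  proof (intro ballI impI)
    fix x assume "x \<in> cvec.span Z" "x \<noteq> 0"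
    then show "0 < Re (M (-C) x x)" using Mb[of x] M_shift[of "-C" x 0] by simp
  qed
  have neg: "cvec.positive_on (\<lambda>x y. - M C x y) (cvec.span Z)"
    unfolding cvec.positive_on_def
  proof (intro ballI impI)
    fix x assume "x \<in> cvec.span Z" "x \<noteq> 0"
    then show "0 < Re (- M C x x)" using Mb[of x] M_shift[of C x 0] by simp
  qed
  \<comment> \<open>The empty family is enough for the two opposite bounds: \<open>B\<close> alone
    already provides |V| - 1 positive and as many negative squares.\<close>
  have e: "finite {}" "cvec.independent {}" "{} \<subseteq> cvec.radical B space"
    "cvec.positive_on (M C) (cvec.span {})" "cvec.positive_on (\<lambda>x y. - M (-C) x y) (cvec.span {})"
    using cvec.independent_empty by (auto simp: cvec.positive_on_def)
  have V1: "card (verts G) \<ge> 1" using verts_ne by (simp add: Suc_le_eq card_gt_0_iff)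
  have C0: "0 \<le> C" 
  proof -
    have "0 \<le> (\<Sum>e\<in>arcs G. \<bar>Q e\<bar>)" by (intro sum_nonneg) auto
    then show ?thesis using C by linarith
  qed
  show ?thesis
    using index_lower[OF Zr pos] index_upper[OF e(1,2,3,5)] index_lower[OF e(1,2,3,4)] index_upper[OF Zr neg]
      eventually_admissible[OF w sin, of C]
  proof eventually_elim
    case (elim k)
    note drop = H_drop[OF elim(5) order_refl _ order_refl]
    have "-C \<le> C" using C0 by simp
    note drop = drop[OF this]
    have 1: "cvec.positive_index (H (w k) (-C)) space + card (verts G) = card (verts G) + card (arcs G) + 1"
      "cvec.dim (cvec.radical (H (w k) (-C)) space) = 0"
      using elim(1,2) Z V1 by simp_all
    have 2: "cvec.positive_index (H (w k) C) space = card (verts G) - 1"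
      using elim(3,4) Z V1 by simp
    show ?case using drop 1 2 V1 by simp
  qed
qed

text \<open>Let \<open>P'\<close>, \<open>Z'\<close>, \<open>N'\<close> be the signature of
  \<open>M mean\<close> on the radical of \<open>B\<close>. Shifting \<open>d\<close> by
  \<open>\<epsilon>\<close> makes the null part positive on one side and negative on the other, so
  the index drops by at least \<open>card Z'\<close>; the constants keep \<open>Z'\<close>
  nonempty.\<close>

lemma eventually_near_mean:
  assumes "0 < \<epsilon>"
  shows "\<forall>\<^sub>F k in sequentially. \<exists>d. dist d mean \<le> \<epsilon> \<and> cvec.dim (cvec.radical (H (w k) d) space) \<noteq> 0"
proof -
  obtain P Z N where s: "cvec.sylvester B space P Z N" and Z: "card Z + card (verts G) = card (arcs G) + 2"
    using B_sylvester by blast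
  note rad = cvec.sylvester_radical[OF B_hermitian s]
  have W: "cvec.subspace (cvec.radical B space)" "cvec.radical B space \<subseteq> cvec.span (unit_vec ` index_set)"
    using rad cvec.subspace_span[of Z] space_eq_span by (auto simp: cvec.radical_def)
  obtain P' Z' N' where s': "cvec.sylvester (M mean) (cvec.radical B space) P' Z' N'"
    using cvec.sylvester_exists[OF M_hermitian W space_sub(2)] .
  note ms = M_hermitian s'
  note fin = cvec.sylvester_fin[OF ms] and ind = cvec.sylvester_indep[OF ms] and sub = cvec.sylvester_sub[OF ms]
    and dis = cvec.sylvester_disjoint[OF ms] and orth = cvec.sylvester_orthogonal[OF ms]
    and orth' = cvec.sylvester_orthogonal[OF cvec.hermitian_uminus[OF M_hermitian] cvec.sylvester_uminus[OF ms]]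
  have "Z' \<noteq> {}"
    using cvec.sylvester_radical[OF ms] const_vec_M_radical const_vec_ne by auto
  then have Z'1: "card Z' \<ge> 1" using fin(2) by (simp add: Suc_le_eq card_gt_0_iff)
  have dimW: "card P' + card Z' + card N' = card Z"
    using cvec.sylvester_dim[OF ms] cvec.sylvester_dim_radical[OF B_hermitian s] by simp
  have sgn: "\<And>b. b \<in> P' \<Longrightarrow> 0 < Re (M mean b b)" "\<And>b. b \<in> Z' \<Longrightarrow> M mean b b = 0" "\<And>b. b \<in> N' \<Longrightarrow> Re (M mean b b) < 0"
    using s' by (auto simp: cvec.sylvester_def)
  have span_rad: "cvec.span T \<subseteq> cvec.radical B space" if "T \<subseteq> cvec.radical B space" for T
    using cvec.span_minimal[OF that W(1)] .
  have pos: "cvec.positive_on (M (mean - \<epsilon>)) (cvec.span (P' \<union> Z'))"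
    unfolding cvec.positive_on_def
  proof (intro ballI impI)
    fix x assume x: "x \<in> cvec.span (P' \<union> Z')" "x \<noteq> 0"
    \<comment> \<open>Semidefinite only; the strict sign comes from the mass term in
      \<open>M_shift\<close>.\<close>
    have "Re (- M mean x x) \<le> 0"
      by (rule cvec.nonpositive_orthogonal[OF cvec.hermitian_uminus[OF M_hermitian] _ _ _ x(1)])
        (use fin sgn orth'(4) in \<open>auto simp: Un_commute less_imp_le\<close>)
    moreover have "0 < mass x" using mass_pos x span_rad[of "P' \<union> Z'"] sub by auto
    then have "0 < \<epsilon> / 2 * mass x" using assms by simp
    ultimately show "0 < Re (M (mean - \<epsilon>) x x)" using M_shift[of "mean - \<epsilon>" x mean] by simp
  qed
  have neg: "cvec.positive_on (\<lambda>x y. - M (mean + \<epsilon>) x y) (cvec.span (N' \<union> Z'))"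
    unfolding cvec.positive_on_def
  proof (intro ballI impI)
    fix x assume x: "x \<in> cvec.span (N' \<union> Z')" "x \<noteq> 0"
    have "Re (M mean x x) \<le> 0"
      by (rule cvec.nonpositive_orthogonal[OF M_hermitian _ _ _ x(1)])
        (use fin sgn orth(4) in \<open>auto simp: Un_commute less_imp_le\<close>)
    moreover have "0 < mass x" using mass_pos x span_rad[of "N' \<union> Z'"] sub by auto
    then have "0 < \<epsilon> / 2 * mass x" using assms by simp
    ultimately show "0 < Re (- M (mean + \<epsilon>) x x)" using M_shift[of "mean + \<epsilon>" x mean] by simp
  qed
  have V1: "card (verts G) \<ge> 1" using verts_ne by (simp add: Suc_le_eq card_gt_0_iff)
  have c1: "card (P' \<union> Z') = card P' + card Z'" "card (N' \<union> Z') = card N' + card Z'"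
    using fin dis by (auto simp: card_Un_disjoint Int_commute)
  define C where "C = \<bar>mean\<bar> + \<epsilon>"
  have PZ: "finite (P' \<union> Z')" "P' \<union> Z' \<subseteq> cvec.radical B space"
    and NZ: "finite (N' \<union> Z')" "N' \<union> Z' \<subseteq> cvec.radical B space"
    using fin sub by auto
  show ?thesis
    using index_lower[OF PZ(1) ind(4) PZ(2) pos] index_upper[OF NZ(1) ind(5) NZ(2) neg] eventually_admissible[OF w sin, of C]
  proof eventually_elim
    case (elim k)
    have "-C \<le> mean - \<epsilon>" "mean - \<epsilon> \<le> mean + \<epsilon>" "mean + \<epsilon> \<le> C" using assms by (auto simp: C_def)
    note drop = H_drop[OF elim(3) this]
    let ?D = "{d\<in>{mean - \<epsilon><..mean + \<epsilon>}. cvec.dim (cvec.radical (H (w k) d) space) \<noteq> 0}"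
    have "(\<Sum>d\<in>?D. cvec.dim (cvec.radical (H (w k) d) space)) \<noteq> 0"
    proof
      assume z: "(\<Sum>d\<in>?D. cvec.dim (cvec.radical (H (w k) d) space)) = 0"
      have "cvec.positive_index (H (w k) (mean - \<epsilon>)) space = cvec.positive_index (H (w k) (mean + \<epsilon>)) space"
        using conjunct2[OF drop] unfolding z add_0_right .
      then show False using elim(1,2) c1 dimW Z Z'1 V1 by linarith
    qed
    then obtain d where "d \<in> ?D" by (rule sum.not_neutral_contains_not_neutral)
    then have "dist d mean \<le> \<epsilon> \<and> cvec.dim (cvec.radical (H (w k) d) space) \<noteq> 0"
      by (auto simp: dist_real_def)
    then show ?case by (rule exI)
  qed
qed

text \<open>Common to both parts of the theorem, which differ only in the frequencies and the signs.
  The signs may depend on \<open>k\<close>, since \<open>cos (w k)\<close> alternates when the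
  frequencies are all multiples of \<open>pi\<close>.\<close>

lemma eventually_eigenvalues:
  fixes \<sigma> :: "nat \<Rightarrow> 'v \<Rightarrow> real"
  assumes sign: "\<And>k v. \<sigma> k v * \<sigma> k v = 1"
    and sign_edge: "\<And>k e. e \<in> arcs G \<Longrightarrow> \<sigma> k (head G e) = cos (w k) * \<sigma> k (tail G e)"
    and mean: "mean_potential G q = mean"
  shows "\<exists>C0::real. (\<forall>C\<ge>C0. \<forall>\<^sub>F k in sequentially.
       eigenvalue_count_in G q (cball (complex_of_real ((w k)\<^sup>2)) C) (int (card (arcs G)) - int (card (verts G)) + 2)) \<and>
     (\<exists>l :: nat \<Rightarrow> complex.
       (\<forall>C\<ge>C0. \<forall>\<^sub>F k in sequentially. is_eigenvalue G q (l k) \<and> l k \<in> cball (complex_of_real ((w k)\<^sup>2)) C) \<and>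
       (\<lambda>k. l k - complex_of_real ((w k)\<^sup>2 + mean_potential G q)) \<in> o(\<lambda>k. 1))"
proof -
  define K where "K = (\<Sum>e\<in>arcs G. \<bar>Q e\<bar>)"
  have K0: "0 \<le> K" unfolding K_def by (intro sum_nonneg) auto
  have freq: "graph_frequency G q (w k) d (\<sigma> k)" if "admissible C (w k)" "d \<in> {-C..C}" for k d C
  proof (intro graph_frequency.intro graph_frequency_axioms.intro metric_graph_axioms)
    show "edge (q e) (w k) d" if "e \<in> arcs G" for e
      using \<open>admissible C (w k)\<close> \<open>d \<in> {-C..C}\<close> that unfolding admissible_def by blast
  qed (fact sign sign_edge)+
  have count: "\<forall>\<^sub>F k in sequentially. eigenvalue_count_in G q (cball (complex_of_real ((w k)\<^sup>2)) C)
      (int (card (arcs G)) - int (card (verts G)) + 2)" if "K + 1 \<le> C" for C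
  proof -
    have "(\<Sum>e\<in>arcs G. \<bar>Q e\<bar>) < C" using that by (simp add: K_def)
    from eventually_count[OF this] eventually_admissible[OF w sin, of C] show ?thesis
    proof eventually_elim
      case (elim k)
      define z where "z d = cvec.dim (cvec.radical (H (w k) d) space)" for d
      define \<phi> where "\<phi> d = complex_of_real ((w k)\<^sup>2 + d)" for d
      have inj: "inj \<phi>" by (rule injI) (simp add: \<phi>_def del: of_real_add)
      have cb: "\<phi> d \<in> cball (complex_of_real ((w k)\<^sup>2)) C \<longleftrightarrow> d \<in> {-C..C}" for d

      proof -
        have "dist (complex_of_real ((w k)\<^sup>2)) (\<phi> d) = \<bar>d\<bar>" by (simp add: \<phi>_def dist_norm)
        then show ?thesis by (simp only: mem_cball) auto
      qed
      have real: "\<exists>d. \<mu> = \<phi> d" if "Im \<mu> = 0" for \<mu>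
        using that by (intro exI[of _ "Re \<mu> - (w k)\<^sup>2"]) (simp add: \<phi>_def complex_eq_iff)
      note gf = freq[OF elim(2)]
      have mult: "eigenvalue_mult G q (\<phi> d) = z d" and ev: "is_eigenvalue G q (\<phi> d) \<longleftrightarrow> z d \<noteq> 0"
        if "d \<in> {-C..C}" for d
        using graph_frequency.eigenspace_dim(1,3)[OF gf[OF that]] by (simp_all only: \<phi>_def z_def)
      \<comment> \<open>The disc contains both end points of the window, whereas the count runs over
        \<open>{-C<..C}\<close>.\<close>
      have z0: "z (-C) = 0" using elim(1) by (simp add: z_def)
      have set: "{\<mu> \<in> cball (complex_of_real ((w k)\<^sup>2)) C. is_eigenvalue G q \<mu>} = \<phi> ` {d\<in>{-C<..C}. z d \<noteq> 0}"
      proof (intro subset_antisym subsetI)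
        fix \<mu> assume \<mu>: "\<mu> \<in> {\<mu> \<in> cball (complex_of_real ((w k)\<^sup>2)) C. is_eigenvalue G q \<mu>}"
        then have "Im \<mu> = 0" using eigenspace_nonreal unfolding is_eigenvalue_def by blast
        then obtain d where d: "\<mu> = \<phi> d" using real by blast
        then have "d \<in> {-C..C}" "z d \<noteq> 0" using \<mu> cb ev by auto
        moreover from this have "d \<noteq> -C" using z0 by auto
        ultimately show "\<mu> \<in> \<phi> ` {d\<in>{-C<..C}. z d \<noteq> 0}" using d by auto
      next
        fix \<mu> assume "\<mu> \<in> \<phi> ` {d\<in>{-C<..C}. z d \<noteq> 0}"
        then obtain d where "\<mu> = \<phi> d" "d \<in> {-C..C}" "z d \<noteq> 0" by auto
        then show "\<mu> \<in> {\<mu> \<in> cball (complex_of_real ((w k)\<^sup>2)) C. is_eigenvalue G q \<mu>}"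
          using cb ev by auto
      qed
      have fin: "finite {d\<in>{-C<..C}. z d \<noteq> 0}" using elim(1) by (simp only: z_def)
      have span: "\<exists>F. finite F \<and> eigenspace G q \<mu> \<subseteq> cfun.span F" if "\<mu> \<in> cball (complex_of_real ((w k)\<^sup>2)) C" for \<mu>
      proof (cases "Im \<mu> = 0")
        case True
        then obtain d where d: "\<mu> = \<phi> d" using real by blast
        then show ?thesis
          using graph_frequency.eigenspace_dim(2)[OF gf, of d] that cb[of d] unfolding d \<phi>_def by blast
      next
        case False
        then have "eigenspace G q \<mu> \<subseteq> {0}" using eigenspace_nonreal by blast
        then show ?thesis by (intro exI[of _ "{}"]) simp
      qed
      have "(\<Sum>\<mu>\<in>{\<mu> \<in> cball (complex_of_real ((w k)\<^sup>2)) C. is_eigenvalue G q \<mu>}. eigenvalue_mult G q \<mu>) =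
          (\<Sum>d\<in>{d\<in>{-C<..C}. z d \<noteq> 0}. eigenvalue_mult G q (\<phi> d))"
        unfolding set by (subst sum.reindex) (auto intro: inj_on_subset[OF inj])
      also have "\<dots> = (\<Sum>d\<in>{d\<in>{-C<..C}. z d \<noteq> 0}. z d)"
        using mult by (intro sum.cong) auto
      finally have sum: "(\<Sum>\<mu>\<in>{\<mu> \<in> cball (complex_of_real ((w k)\<^sup>2)) C. is_eigenvalue G q \<mu>}. eigenvalue_mult G q \<mu>) + card (verts G)
          = card (arcs G) + 2"
        using elim(1) by (simp only: z_def)
      then have "int (\<Sum>\<mu>\<in>{\<mu> \<in> cball (complex_of_real ((w k)\<^sup>2)) C. is_eigenvalue G q \<mu>}. eigenvalue_mult G q \<mu>) =
          int (card (arcs G)) - int (card (verts G)) + 2"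
        by linarith
      moreover have "finite {\<mu> \<in> cball (complex_of_real ((w k)\<^sup>2)) C. is_eigenvalue G q \<mu>}"
        unfolding set using fin by (rule finite_imageI)
      ultimately show ?case
        unfolding eigenvalue_count_in_def using span by blast
    qed
  qed
  obtain l0 where l0: "\<forall>\<^sub>F k in sequentially. cvec.dim (cvec.radical (H (w k) (l0 k)) space) \<noteq> 0" "l0 \<longlonglongrightarrow> mean"
    using eventually_choose_tendsto[of mean "\<lambda>k d. cvec.dim (cvec.radical (H (w k) d) space) \<noteq> 0"] eventually_near_mean by blast
  define l where "l k = complex_of_real ((w k)\<^sup>2 + l0 k)" for k
  \<comment> \<open>With the margin of 1 this keeps \<open>l0 k\<close> eventually within
    \<open>K + 1\<close>, so the same constant serves the count and the distinguished
    eigenvalue.\<close>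
  have "\<bar>mean\<bar> \<le> K"
  proof -
    have "\<bar>\<Sum>e\<in>arcs G. Q e\<bar> \<le> K" unfolding K_def by (rule sum_abs)
    moreover have "real (card (arcs G)) \<ge> 1" using arcs_ne by (simp add: Suc_le_eq card_gt_0_iff)
    moreover from this have "K * 1 \<le> K * real (card (arcs G))" using K0 by (intro mult_left_mono)
    ultimately have "\<bar>\<Sum>e\<in>arcs G. Q e\<bar> \<le> K * real (card (arcs G))" "0 < real (card (arcs G))" by linarith+
    then show ?thesis
      unfolding mean_def by (simp add: abs_mult pos_divide_le_eq)
  qed
  then have "\<forall>\<^sub>F k in sequentially. l0 k < K + 1" "\<forall>\<^sub>F k in sequentially. - (K + 1) < l0 k"
    using order_tendstoD[OF l0(2)] by auto
  with l0(1) eventually_admissible[OF w sin, of "K + 1"]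
  have lev: "\<forall>\<^sub>F k in sequentially. is_eigenvalue G q (l k) \<and> \<bar>l0 k\<bar> \<le> K + 1"
  proof eventually_elim
    case (elim k)
    then have d: "l0 k \<in> {-(K + 1)..K + 1}" by auto
    show ?case
      using graph_frequency.eigenspace_dim(3)[OF freq[OF elim(2) d]] elim(1) d unfolding l_def by auto
  qed
  have "\<forall>\<^sub>F k in sequentially. is_eigenvalue G q (l k) \<and> l k \<in> cball (complex_of_real ((w k)\<^sup>2)) C" if "K + 1 \<le> C" for C
    using lev
  proof eventually_elim
    case (elim k)
    have "dist (complex_of_real ((w k)\<^sup>2)) (l k) = \<bar>l0 k\<bar>"
      by (simp add: l_def dist_norm)
    then show ?case using elim that by simp
  qed
  moreover have "(\<lambda>k. l k - complex_of_real ((w k)\<^sup>2 + mean_potential G q)) \<in> o(\<lambda>k. 1)"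
  proof (rule smalloI_tendsto)
    have "((\<lambda>k. complex_of_real (l0 k - mean)) \<longlongrightarrow> of_real (mean - mean)) sequentially"
      by (intro tendsto_of_real tendsto_diff l0(2) tendsto_const)
    then show "((\<lambda>k. (l k - complex_of_real ((w k)\<^sup>2 + mean_potential G q)) / 1) \<longlongrightarrow> 0) sequentially"
      by (simp add: l_def mean)
  qed simp
  ultimately show ?thesis using count by blast
qed

end

end

section \<open>Return to the given data and to the frequencies \<open>2 k pi\<close> and
  \<open>k pi\<close>\<close>

lemma mean_potential_eq:
  assumes "metric_graph G q"
  shows "mean_potential G q = metric_graph.mean G q"
proof -
  interpret metric_graph G q by fact
  have "(LINT x:{0<..<1}|lebesgue. q e x) = Q e" if e: "e \<in> arcs G" for e
  proof -
    have "q e absolutely_integrable_on {0<..<1}"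
      using q[OF e] absolutely_integrable_on_open_interval[where f = "q e" and a = 0 and b = 1] by simp
    then show ?thesis
      unfolding Q_def by (simp add: set_lebesgue_integral_eq_integral(2) integral_open_interval_real)
  qed
  then show ?thesis unfolding mean_potential_def mean_def by simp
qed

theorem theorem1p1:
  fixes G :: "('v, 'e) pre_digraph" and q :: "'e \<Rightarrow> real \<Rightarrow> real"
  assumes "fin_digraph G" and "Digraph_Component.connected G" and "card (arcs G) \<ge> 1"
    and "\<And>e. e \<in> arcs G \<Longrightarrow> set_integrable lebesgue {0<..<1} (q e)"
  shows "(\<exists>C0::real.
            (\<forall>C\<ge>C0. \<forall>\<^sub>F k::nat in sequentially.
               eigenvalue_count_in G q (cball (complex_of_real ((2 * real k * pi)\<^sup>2)) C)
                 (int (card (arcs G)) - int (card (verts G)) + 2)) \<and>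
            (\<exists>l :: nat \<Rightarrow> complex.
               (\<forall>C\<ge>C0. \<forall>\<^sub>F k in sequentially.
                  is_eigenvalue G q (l k) \<and> l k \<in> cball (complex_of_real ((2 * real k * pi)\<^sup>2)) C) \<and>
               (\<lambda>k. l k - complex_of_real ((2 * real k * pi)\<^sup>2 + mean_potential G q)) \<in> o(\<lambda>k. 1))) \<and>
         (bipartite G \<longrightarrow>
          (\<exists>C0::real.
            (\<forall>C\<ge>C0. \<forall>\<^sub>F k::nat in sequentially.
               eigenvalue_count_in G q (cball (complex_of_real ((real k * pi)\<^sup>2)) C)
                 (int (card (arcs G)) - int (card (verts G)) + 2)) \<and>
            (\<exists>l :: nat \<Rightarrow> complex.
               (\<forall>C\<ge>C0. \<forall>\<^sub>F k in sequentially.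
                  is_eigenvalue G q (l k) \<and> l k \<in> cball (complex_of_real ((real k * pi)\<^sup>2)) C) \<and>
               (\<lambda>k. l k - complex_of_real ((real k * pi)\<^sup>2 + mean_potential G q)) \<in> o(\<lambda>k. 1))))"
proof -
  interpret fin_digraph G by fact
  have mg: "metric_graph G q"
  proof
    show "Digraph_Component.connected G" by fact
    show "arcs G \<noteq> {}" using assms(3) by auto
    show "q e absolutely_integrable_on {0..1}" if "e \<in> arcs G" for e
      using assms(4)[OF that] absolutely_integrable_on_open_interval[where f = "q e" and a = 0 and b = 1] by simp
  qed
  have lin: "filterlim (\<lambda>k. real k * c) at_top sequentially" if "c > 0" for c
    by (rule filterlim_at_top_mult_tendsto_pos[OF tendsto_const that filterlim_real_sequentially])
  show ?thesis
  proof (intro conjI impI)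
    have lim: "filterlim (\<lambda>k. 2 * real k * pi) at_top sequentially"
      using lin[of "2 * pi"] by (simp add: mult_ac)
    have sin: "sin (2 * real k * pi) = 0" and cos: "1 = cos (2 * real k * pi) * 1" for k
      using sin_npi[of "2 * k"] cos_npi[of "2 * k"] by simp_all
    show "\<exists>C0::real.
            (\<forall>C\<ge>C0. \<forall>\<^sub>F k::nat in sequentially.
               eigenvalue_count_in G q (cball (complex_of_real ((2 * real k * pi)\<^sup>2)) C)
                 (int (card (arcs G)) - int (card (verts G)) + 2)) \<and>
            (\<exists>l :: nat \<Rightarrow> complex.
               (\<forall>C\<ge>C0. \<forall>\<^sub>F k in sequentially.
                  is_eigenvalue G q (l k) \<and> l k \<in> cball (complex_of_real ((2 * real k * pi)\<^sup>2)) C) \<and>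
               (\<lambda>k. l k - complex_of_real ((2 * real k * pi)\<^sup>2 + mean_potential G q)) \<in> o(\<lambda>k. 1))"
      \<comment> \<open>Here \<open>cos (w k) = 1\<close>, so the constant sign 1 is consistent on
        every graph, also along odd cycles.\<close>
      by (rule metric_graph.eventually_eigenvalues[where \<sigma> = "\<lambda>k v. 1" and w = "\<lambda>k. 2 * real k * pi",
            OF mg lim sin mult_1 cos mean_potential_eq[OF mg]])
  next
    assume "bipartite G"
    then obtain U W where UW: "verts G = U \<union> W \<and> U \<inter> W = {} \<and>
        (\<forall>e\<in>arcs G. (tail G e \<in> U \<and> head G e \<in> W) \<or> (tail G e \<in> W \<and> head G e \<in> U))"
      unfolding bipartite_def by (elim exE)
    then have disj: "U \<inter> W = {}" by (elim conjE)
    have ends: "(tail G e \<in> U \<and> head G e \<in> W) \<or> (tail G e \<in> W \<and> head G e \<in> U)" if "e \<in> arcs G" for e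
      using UW that by (elim conjE) (rule bspec)
    \<comment> \<open>Exactly one end of each edge lies in \<open>U\<close>, so the sign changes
      along it by \<open>(-1) ^ k = cos (real k * pi)\<close> in either direction; for even
      \<open>k\<close> all signs are 1.\<close>
    define \<sigma> where "\<sigma> k v = (if v \<in> U then 1 else (-1) ^ k :: real)" for k :: nat and v
    have s2: "\<sigma> k v * \<sigma> k v = 1" for k v
      by (simp add: \<sigma>_def flip: power_mult_distrib)
    have se: "\<sigma> k (head G e) = cos (real k * pi) * \<sigma> k (tail G e)" if "e \<in> arcs G" for k e
    proof -
      have "((-1) ^ k :: real) * (-1) ^ k = 1" by (simp flip: power_mult_distrib)
      then show ?thesis using disj ends[OF that] by (auto simp: \<sigma>_def cos_npi)
    qed
    show "\<exists>C0::real.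
            (\<forall>C\<ge>C0. \<forall>\<^sub>F k::nat in sequentially.
               eigenvalue_count_in G q (cball (complex_of_real ((real k * pi)\<^sup>2)) C)
                 (int (card (arcs G)) - int (card (verts G)) + 2)) \<and>
            (\<exists>l :: nat \<Rightarrow> complex.
               (\<forall>C\<ge>C0. \<forall>\<^sub>F k in sequentially.
                  is_eigenvalue G q (l k) \<and> l k \<in> cball (complex_of_real ((real k * pi)\<^sup>2)) C) \<and>
               (\<lambda>k. l k - complex_of_real ((real k * pi)\<^sup>2 + mean_potential G q)) \<in> o(\<lambda>k. 1))"
      by (rule metric_graph.eventually_eigenvalues[where \<sigma> = \<sigma> and w = "\<lambda>k. real k * pi",
            OF mg lin[OF pi_gt_zero] sin_npi s2 se mean_potential_eq[OF mg]])
  qed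
qed

end
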